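(* Let $\alpha,\gamma$ be snowy weak compositions and take $m_1,m_2,n$ with $m_1\ge\max(\alpha)$, $m_2\ge\max(\gamma)$, $\mathsf{supp}(\alpha)\subseteq[n]$, $\mathsf{supp}(\gamma)\subseteq[n]$. Let $u=\mathsf{std}_{m_1,n}(\alpha)$ and $v=\mathsf{std}_{m_2,n}(\gamma)$. For any snowy weak composition $\delta$ with $\mathsf{supp}(\delta)\subseteq[n]$ and $\max(\delta)\le m_1+m_2$, let $w=\mathsf{std}_{m_1+m_2,n}(\delta)$. Then $d^{\delta}_{\alpha,\gamma}=c^w_{u,v}$.
   Context: A weak composition is a sequence of non-negative integers with finitely many positive entries; $\mathsf{supp}(\alpha)=\{i:\alpha_i>0\}$; partition = weakly decreasing; snowy = positive entries pairwise distinct; $s_i\alpha$ swaps entries $i,i+1$. Let $\partial_i(f)=\frac{f-s_if}{x_i-x_{i+1}}$ ($s_i$ swapping $x_i,x_{i+1}$), $\widehat{\pi}_i(f)=x_ix_{i+1}\partial_i(f)$. Top Lascoux polynomials (snowy $\alpha$): $\widehat{\mathfrak{L}}_\alpha=x^\alpha$ if $\alpha$ is a partition, $\widehat{\mathfrak{L}}_\alpha=\widehat{\pi}_i(\widehat{\mathfrak{L}}_{s_i\alpha})$ if $\alpha_i<\alpha_{i+1}$. It is known that $\{\widehat{\mathfrak{L}}_\alpha:\alpha\text{ snowy}\}$ is a basis of its span, which is closed under multiplication; $d^{\delta}_{\alpha,\gamma}$ is defined by $\widehat{\mathfrak{L}}_\alpha\widehat{\mathfrak{L}}_\gamma=\sum_\delta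 d^{\delta}_{\alpha,\gamma}\widehat{\mathfrak{L}}_\delta$. Schubert polynomials, for permutations $w$ of $\{1,2,\dots\}$ fixing all but finitely many elements: $\mathsf{invcode}(w)_i=|\{j>i:w(j)<w(i)\}|$; $\mathfrak{S}_w=x^{\mathsf{invcode}(w)}$ if $\mathsf{invcode}(w)$ is a partition, and $\mathfrak{S}_w=\partial_i(\mathfrak{S}_{ws_i})$ if $w(i)<w(i+1)$. They form a basis of $\mathbb{Q}[x_1,x_2,\dots]$, and $c^w_{u,v}$ is defined by $\mathfrak{S}_u\mathfrak{S}_v=\sum_w c^w_{u,v}\mathfrak{S}_w$. Standardization: for snowy $\alpha$ with $\mathsf{supp}(\alpha)\subseteq[n]$ and $m\ge\max(\alpha)$, let $\beta=(m+1-\alpha_n,\dots,m+1-\alpha_1)$; $\mathsf{std}_{m,n}(\alpha)$ is the unique permutation $w$ with $w(n+1)<w(n+2)<\cdots$ and, for $i\in[n]$, $w(i)=\beta_i$ if $\beta_i\le m$, and $w(i)=m+|\{j\in[i]:\beta_j=m+1\}|$ if $\beta_i=m+1$. *)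

theory Defs
  imports Complex_Main "HOL-Library.Poly_Mapping" "HOL-Combinatorics.Permutations"
begin

text \<open>
  Indices are 1-based as in the mathematics: a weak composition is a finitely supported
  function on \<^typ>\<open>nat\<close> vanishing at 0, and permutations of the positive integers fix 0.
  The polynomial ring is the monoid ring over exponent vectors; the library's product on
  \<^typ>\<open>(nat \<Rightarrow>\<^sub>0 nat) \<Rightarrow>\<^sub>0 rat\<close> is the polynomial product. The variable with index 0
  exists in this type but never occurs in the polynomials defined below.
\<close>

type_synonym comp = "nat \<Rightarrow>\<^sub>0 nat"
type_synonym qpoly = "comp \<Rightarrow>\<^sub>0 rat"

abbreviation entry :: "comp \<Rightarrow> nat \<Rightarrow> nat" where
  "entry \<equiv> Poly_Mapping.lookup"

abbreviation supp :: "comp \<Rightarrow> nat set" where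
  "supp \<equiv> Poly_Mapping.keys"

definition weak_composition :: "comp \<Rightarrow> bool" where
  "weak_composition \<alpha> \<longleftrightarrow> entry \<alpha> 0 = 0"

definition snowy :: "comp \<Rightarrow> bool" where
  "snowy \<alpha> \<longleftrightarrow> (\<forall>i j. 0 < entry \<alpha> i \<and> 0 < entry \<alpha> j \<and> i \<noteq> j \<longrightarrow> entry \<alpha> i \<noteq> entry \<alpha> j)"

definition is_partition :: "comp \<Rightarrow> bool" where
  "is_partition \<alpha> \<longleftrightarrow> (\<forall>i\<ge>1. entry \<alpha> i \<ge> entry \<alpha> (Suc i))"

definition max_entry :: "comp \<Rightarrow> nat" where
  "max_entry \<alpha> = Max (range (entry \<alpha>))"

definition swap_comp :: "nat \<Rightarrow> comp \<Rightarrow> comp" where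
  "swap_comp i \<alpha> = Poly_Mapping.map_key (transpose i (Suc i)) \<alpha>"

definition xpow :: "comp \<Rightarrow> qpoly" where
  "xpow \<alpha> = Poly_Mapping.single \<alpha> 1"

definition X :: "nat \<Rightarrow> qpoly" where
  "X i = xpow (Poly_Mapping.single i 1)"

definition scale :: "rat \<Rightarrow> qpoly \<Rightarrow> qpoly" where
  "scale c f = Poly_Mapping.single 0 c * f"

text \<open>
  Exchanging two variables permutes exponent vectors; as the permutation is an involution,
  the coefficient of \<open>\<alpha>\<close> in the result is the coefficient of the swapped \<open>\<alpha>\<close> in \<open>f\<close>.
\<close>

definition swap_vars :: "nat \<Rightarrow> qpoly \<Rightarrow> qpoly" where
  "swap_vars i f = Poly_Mapping.map_key (swap_comp i) f"

text \<open>
  The quotient is exact, and unique because the ring has no zero divisors.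
\<close>

definition divdiff :: "nat \<Rightarrow> qpoly \<Rightarrow> qpoly" where
  "divdiff i f = (THE g. (X i - X (Suc i)) * g = f - swap_vars i f)"

definition pihat :: "nat \<Rightarrow> qpoly \<Rightarrow> qpoly" where
  "pihat i f = X i * X (Suc i) * divdiff i f"


subsection \<open>Top Lascoux polynomials\<close>

text \<open>
  The recursive description leaves the choice of \<open>i\<close> open. It is rendered as the least
  relation closed under its two clauses; that this relation is the graph of a function on
  snowy weak compositions is the well-definedness of the polynomials. The Schubert
  polynomials are treated in the same way.
\<close>

inductive top_lascoux_rel :: "comp \<Rightarrow> qpoly \<Rightarrow> bool" where
  partition: "weak_composition \<alpha> \<Longrightarrow> snowy \<alpha> \<Longrightarrow> is_partition \<alpha> \<Longrightarrow>
    top_lascoux_rel \<alpha> (xpow \<alpha>)"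
| ascent: "weak_composition \<alpha> \<Longrightarrow> snowy \<alpha> \<Longrightarrow> 1 \<le> i \<Longrightarrow> entry \<alpha> i < entry \<alpha> (Suc i) \<Longrightarrow>
    top_lascoux_rel (swap_comp i \<alpha>) f \<Longrightarrow> top_lascoux_rel \<alpha> (pihat i f)"

definition top_lascoux :: "comp \<Rightarrow> qpoly" where
  "top_lascoux \<alpha> = (THE f. top_lascoux_rel \<alpha> f)"

definition is_top_lascoux_expansion :: "qpoly \<Rightarrow> (comp \<Rightarrow>\<^sub>0 rat) \<Rightarrow> bool" where
  "is_top_lascoux_expansion f d \<longleftrightarrow>
    (\<forall>\<delta>\<in>Poly_Mapping.keys d. weak_composition \<delta> \<and> snowy \<delta>) \<and>
    f = (\<Sum>\<delta>\<in>Poly_Mapping.keys d. scale (Poly_Mapping.lookup d \<delta>) (top_lascoux \<delta>))"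

definition top_lascoux_coeff :: "comp \<Rightarrow> comp \<Rightarrow> comp \<Rightarrow> rat" where
  "top_lascoux_coeff \<alpha> \<gamma> \<delta> =
    Poly_Mapping.lookup
      (THE d. is_top_lascoux_expansion (top_lascoux \<alpha> * top_lascoux \<gamma>) d) \<delta>"


subsection \<open>Schubert polynomials\<close>

definition fin_perm :: "(nat \<Rightarrow> nat) \<Rightarrow> bool" where
  "fin_perm w \<longleftrightarrow> w permutes {1..} \<and> finite {i. w i \<noteq> i}"

text \<open>
  For \<^term>\<open>fin_perm w\<close> the function below has finite support and vanishes at 0, so
  the abstraction is meaningful and yields a weak composition.
\<close>

definition invcode :: "(nat \<Rightarrow> nat) \<Rightarrow> comp" where
  "invcode w = Poly_Mapping.Abs_poly_mapping (\<lambda>i. card {j. i < j \<and> w j < w i})"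

inductive schubert_rel :: "(nat \<Rightarrow> nat) \<Rightarrow> qpoly \<Rightarrow> bool" where
  dominant: "fin_perm w \<Longrightarrow> is_partition (invcode w) \<Longrightarrow> schubert_rel w (xpow (invcode w))"
| ascent: "fin_perm w \<Longrightarrow> 1 \<le> i \<Longrightarrow> w i < w (Suc i) \<Longrightarrow>
    schubert_rel (w \<circ> transpose i (Suc i)) f \<Longrightarrow> schubert_rel w (divdiff i f)"

definition schubert :: "(nat \<Rightarrow> nat) \<Rightarrow> qpoly" where
  "schubert w = (THE f. schubert_rel w f)"

definition is_schubert_expansion :: "qpoly \<Rightarrow> ((nat \<Rightarrow> nat) \<Rightarrow>\<^sub>0 rat) \<Rightarrow> bool" where
  "is_schubert_expansion f c \<longleftrightarrow>
    (\<forall>w\<in>Poly_Mapping.keys c. fin_perm w) \<and>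
    f = (\<Sum>w\<in>Poly_Mapping.keys c. scale (Poly_Mapping.lookup c w) (schubert w))"

definition schubert_coeff :: "(nat \<Rightarrow> nat) \<Rightarrow> (nat \<Rightarrow> nat) \<Rightarrow> (nat \<Rightarrow> nat) \<Rightarrow> rat" where
  "schubert_coeff u v w =
    Poly_Mapping.lookup (THE c. is_schubert_expansion (schubert u * schubert v) c) w"


subsection \<open>Standardization\<close>

definition std_beta :: "nat \<Rightarrow> nat \<Rightarrow> comp \<Rightarrow> nat \<Rightarrow> nat" where
  "std_beta m n \<alpha> i = m + 1 - entry \<alpha> (n + 1 - i)"

definition is_std :: "nat \<Rightarrow> nat \<Rightarrow> comp \<Rightarrow> (nat \<Rightarrow> nat) \<Rightarrow> bool" where
  "is_std m n \<alpha> w \<longleftrightarrow>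
    fin_perm w \<and>
    (\<forall>i>n. w i < w (Suc i)) \<and>
    (\<forall>i\<in>{1..n}.
      (std_beta m n \<alpha> i \<le> m \<longrightarrow> w i = std_beta m n \<alpha> i) \<and>
      (std_beta m n \<alpha> i = m + 1 \<longrightarrow> w i = m + card {j\<in>{1..i}. std_beta m n \<alpha> j = m + 1}))"

definition std :: "nat \<Rightarrow> nat \<Rightarrow> comp \<Rightarrow> nat \<Rightarrow> nat" where
  "std m n \<alpha> = (THE w. is_std m n \<alpha> w)"

end

theory Submission imports Defs
begin

text \<open>
  Substituting \<open>1 / x\<^sub>n\<^sub>+\<^sub>1\<^sub>-\<^sub>i\<close> for \<open>x\<^sub>i\<close> and multiplying by \<open>(x\<^sub>1 \<dots> x\<^sub>n)\<^sup>m\<close>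
  turns \<open>pihat i\<close> into \<open>divdiff (n - i)\<close> and the top Lascoux polynomial of \<open>\<alpha>\<close> into the Schubert
  polynomial of \<open>std m n \<alpha>\<close>. For bounds \<open>m1\<close> and \<open>m2\<close> on the factors and \<open>m1 + m2\<close> on the
  product the substitution is multiplicative, so it carries an expansion of the product in top Lascoux
  polynomials to one in Schubert polynomials, and the latter is unique.

  It remains to see that the product has an expansion whose compositions have support in
  \<open>{1..n}\<close> and entries at most \<open>m1 + m2\<close>. For the support, the span of the top Lascoux
  polynomials is identified with the ring generated by the polynomials \<open>x\<^sub>1 \<dots> x\<^sub>j h\<^sub>a(x\<^sub>1, \<dots>, x\<^sub>j)\<close>:
  products with distinct \<open>j\<close> already span this ring, and \<open>pihat i\<close> acts on them by raising the index \<open>i\<close>.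
  For the entries, the substitution is applied to the product and to its multiple by
  \<open>(x\<^sub>1 \<dots> x\<^sub>n)\<^sup>n\<close>, which visibly has an expansion with bounded entries, and the two resulting
  Schubert expansions are compared.
\<close>

subsection \<open>Divided differences\<close>

text \<open>The obstacle is the shape of the expansion. Reflection turns it into a Schubert
  expansion only if all its compositions fit into the box of the product, and the recursions give no
  formula for products. The span of the top Lascoux polynomials is in general not spanned by
  monomials, so closure under products needs generators adapted to \<open>pihat i\<close>. A
  polynomial with small exponents could a priori have an expansion whose large entries cancel. The
  factor with exponent n helps because it reflects to 1 and lifts every monomial above the staircase
  n, ..., 1, where a monomial is itself a combination of top Lascoux polynomials with entries no
  larger than its exponents. Both families are given by relations that leave the choice of ascent
  open. For Schubert polynomials, commutation and braid relations settle this inside a finite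
  symmetric group. Reflection carries derivations to derivations and is injective on a box, so the
  top Lascoux polynomials inherit uniqueness, vanishing under \<open>pihat i\<close> at weak
  ascents, and linear independence.\<close>

lemma lookup_map_key: "inj f \<Longrightarrow> Poly_Mapping.lookup (Poly_Mapping.map_key f p) k = Poly_Mapping.lookup p (f k)"
  by (simp add: Poly_Mapping.map_key.rep_eq)

lemma lookup_scale: "Poly_Mapping.lookup (scale c f) e = c * Poly_Mapping.lookup f e"
proof -
  have "scale c f = Poly_Mapping.map ((*) c) f"
    by (simp add: scale_def mult_map_scale_conv_mult)
  then show ?thesis by (simp add: Poly_Mapping.map.rep_eq when_def)
qed

section \<open>Polynomials as a rational vector space, with linear maps determined on
  monomials\<close>

global_interpretation qp: vector_space scale
proof unfold_locales
  show "scale a (x + y) = scale a x + scale a y" for a x y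
    by (simp add: scale_def algebra_simps)
  show "scale (a + b) x = scale a x + scale b x" for a b x
    by (simp add: scale_def single_add algebra_simps)
  show "scale a (scale b x) = scale (a * b) x" for a b x
    by (simp add: scale_def mult_single flip: mult.assoc)
  show "scale 1 x = x" for x by (simp add: scale_def)
qed

lemma scale_mult_right: "f * scale c g = scale c (f * g)"
  by (simp add: scale_def mult_ac)

abbreviation qlinear :: "(qpoly \<Rightarrow> qpoly) \<Rightarrow> bool" where
  "qlinear \<equiv> Vector_Spaces.linear scale scale"

lemma qlinearI:
  assumes "\<And>f g. T (f + g) = T f + T g" and "\<And>c f. T (scale c f) = scale c (T f)"
  shows "qlinear T"
  using assms by unfold_locales

lemma qlinear_mult: "qlinear ((*) f)"
  by (rule qlinearI) (simp_all add: algebra_simps scale_mult_right)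

lemma qlinear_compose: "qlinear S \<Longrightarrow> qlinear T \<Longrightarrow> qlinear (\<lambda>f. S (T f))"
  using Vector_Spaces.linear_compose[of scale scale T scale S] by (simp add: o_def)

lemma xpow_expansion: "f = (\<Sum>e\<in>Poly_Mapping.keys f. scale (Poly_Mapping.lookup f e) (xpow e))"
proof (rule poly_mapping_eqI)
  fix k
  have "Poly_Mapping.lookup (\<Sum>e\<in>Poly_Mapping.keys f. scale (Poly_Mapping.lookup f e) (xpow e)) k
      = (\<Sum>e\<in>Poly_Mapping.keys f. if e = k then Poly_Mapping.lookup f e else 0)"
    unfolding lookup_sum
    by (rule sum.cong) (auto simp: lookup_scale xpow_def lookup_single when_def)
  then show "Poly_Mapping.lookup f k = Poly_Mapping.lookup (\<Sum>e\<in>Poly_Mapping.keys f. scale (Poly_Mapping.lookup f e) (xpow e)) k"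
    by (simp add: in_keys_iff)
qed

lemma in_span_xpow_iff: "f \<in> qp.span (xpow ` E) \<longleftrightarrow> Poly_Mapping.keys f \<subseteq> E"
proof
  assume "Poly_Mapping.keys f \<subseteq> E"
  then show "f \<in> qp.span (xpow ` E)"
    by (subst xpow_expansion[of f]) (intro qp.span_sum qp.span_scale qp.span_base imageI; blast)
next
  assume "f \<in> qp.span (xpow ` E)"
  then show "Poly_Mapping.keys f \<subseteq> E"
  proof (induction rule: qp.span_induct_alt)
    case base
    then show ?case by simp
  next
    case (step c x y)
    have "Poly_Mapping.keys (scale c x) \<subseteq> Poly_Mapping.keys x"
      by (auto simp: in_keys_iff lookup_scale)
    moreover have "Poly_Mapping.keys x \<subseteq> E"
      using step by (auto simp: xpow_def split: if_splits)
    ultimately show ?case using step keys_add[of "scale c x" y] by blast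
  qed
qed

lemma qlinear_in_span:
  assumes "qlinear T" and "f \<in> qp.span A" and "\<And>a. a \<in> A \<Longrightarrow> T a \<in> qp.span B"
  shows "T f \<in> qp.span B"
proof -
  interpret Vector_Spaces.linear scale scale T by fact
  show ?thesis using assms(2)
    by (induction rule: qp.span_induct_alt)
      (auto simp: zero add scale assms(3) qp.span_zero intro!: qp.span_add qp.span_scale)
qed

lemma qlinear_eq_on_span:
  assumes "qlinear S" and "qlinear T" and "f \<in> qp.span A" and "\<And>a. a \<in> A \<Longrightarrow> S a = T a"
  shows "S f = T f"
proof -
  interpret S: Vector_Spaces.linear scale scale S by fact
  interpret T: Vector_Spaces.linear scale scale T by fact
  show ?thesis using assms(3)
    by (induction rule: qp.span_induct_alt)
      (auto simp: S.zero S.add S.scale T.zero T.add T.scale assms(4))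
qed

lemma qlinear_eqI:
  assumes "qlinear S" and "qlinear T" and "\<And>e. S (xpow e) = T (xpow e)"
  shows "S f = T f"
  by (rule qlinear_eq_on_span[OF assms(1,2), of f "xpow ` UNIV"]) (auto simp: in_span_xpow_iff assms(3))

lemma mult_in_span:
  assumes "f \<in> qp.span A" and "g \<in> qp.span B" and "\<And>a b. a \<in> A \<Longrightarrow> b \<in> B \<Longrightarrow> a * b \<in> qp.span C"
  shows "f * g \<in> qp.span C"
proof (rule qlinear_in_span[OF qlinear_mult assms(2)])
  fix b assume "b \<in> B"
  then have "b * f \<in> qp.span C"
    by (intro qlinear_in_span[OF qlinear_mult assms(1)]) (simp add: assms(3) mult.commute[of b])
  then show "f * b \<in> qp.span C" by (simp add: mult.commute)
qed

lemma xpow_add: "xpow (a + b) = xpow a * xpow b"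
  by (simp add: xpow_def mult_single)

lemma xpow_0 [simp]: "xpow 0 = 1"
  by (simp add: xpow_def)

lemma xpow_inject: "xpow a = xpow b \<longleftrightarrow> a = b"
  by (metis keys_single one_neq_zero singleton_inject xpow_def)

lemma xpow_single: "xpow (Poly_Mapping.single i c) = X i ^ c"
proof (induction c)
  case (Suc c)
  have "Poly_Mapping.single i (Suc c) = Poly_Mapping.single i 1 + Poly_Mapping.single i c"
    by (simp flip: single_add)
  then show ?case by (simp add: xpow_add Suc X_def)
qed simp

lemma X_inject [simp]: "X i = X j \<longleftrightarrow> i = j"
  unfolding X_def xpow_inject by (metis keys_single one_neq_zero singleton_inject)

lemma X_diff_nonzero: "i \<noteq> j \<Longrightarrow> X i - X j \<noteq> 0"
  by simp

section \<open>The exchange of two adjacent variables as a ring automorphism\<close>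

lemma lookup_swap_comp: "entry (swap_comp i e) k = entry e (transpose i (Suc i) k)"
  by (simp add: swap_comp_def lookup_map_key)

lemma swap_comp_swap_comp [simp]: "swap_comp i (swap_comp i e) = e"
  by (rule poly_mapping_eqI) (simp add: lookup_swap_comp)

lemma inj_swap_comp: "inj (swap_comp i)"
  by (metis injI swap_comp_swap_comp)

lemma swap_comp_add: "swap_comp i (a + b) = swap_comp i a + swap_comp i b"
  by (rule poly_mapping_eqI) (simp add: lookup_swap_comp lookup_add)

lemma lookup_swap_vars: "Poly_Mapping.lookup (swap_vars i f) e = Poly_Mapping.lookup f (swap_comp i e)"
  by (simp add: swap_vars_def lookup_map_key inj_swap_comp)

lemma swap_vars_xpow: "swap_vars i (xpow e) = xpow (swap_comp i e)"
proof (rule poly_mapping_eqI)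
  fix k
  have "swap_comp i k = e \<longleftrightarrow> k = swap_comp i e" by auto
  then show "Poly_Mapping.lookup (swap_vars i (xpow e)) k = Poly_Mapping.lookup (xpow (swap_comp i e)) k"
    by (auto simp: lookup_swap_vars xpow_def lookup_single when_def)
qed

lemma swap_vars_add: "swap_vars i (f + g) = swap_vars i f + swap_vars i g"
  by (rule poly_mapping_eqI) (simp add: lookup_swap_vars lookup_add)

lemma swap_vars_diff: "swap_vars i (f - g) = swap_vars i f - swap_vars i g"
  by (rule poly_mapping_eqI) (simp add: lookup_swap_vars lookup_minus)

lemma swap_vars_scale: "swap_vars i (scale c f) = scale c (swap_vars i f)"
  by (rule poly_mapping_eqI) (simp add: lookup_swap_vars lookup_scale)

lemma qlinear_swap_vars: "qlinear (swap_vars i)"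
  by (rule qlinearI) (simp_all add: swap_vars_add swap_vars_scale)

lemma swap_vars_swap_vars [simp]: "swap_vars i (swap_vars i f) = f"
  by (rule poly_mapping_eqI) (simp add: lookup_swap_vars)

lemma swap_vars_mult: "swap_vars i (f * g) = swap_vars i f * swap_vars i g"
proof -
  have "swap_vars i (xpow b * f) = xpow (swap_comp i b) * swap_vars i f" for b
    by (rule qlinear_eqI[of "\<lambda>f. swap_vars i (xpow b * f)" "\<lambda>f. xpow (swap_comp i b) * swap_vars i f" f])
      (simp_all add: qlinear_compose qlinear_mult qlinear_swap_vars swap_vars_xpow swap_comp_add flip: xpow_add)
  then have *: "swap_vars i (f * xpow b) = swap_vars i f * xpow (swap_comp i b)" for b
    by (simp add: mult.commute)
  show ?thesis
    by (rule qlinear_eqI[of "\<lambda>g. swap_vars i (f * g)" "\<lambda>g. swap_vars i f * swap_vars i g" g])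
      (simp_all add: qlinear_compose qlinear_mult qlinear_swap_vars * swap_vars_xpow)
qed

lemma swap_vars_1 [simp]: "swap_vars i 1 = 1"
proof -
  have "swap_comp i 0 = 0" by (rule poly_mapping_eqI) (simp add: lookup_swap_comp)
  then show ?thesis using swap_vars_xpow[of i 0] by simp
qed

lemma swap_vars_0 [simp]: "swap_vars i 0 = 0"
  using swap_vars_diff[of i 0 0] by simp

lemma swap_vars_power: "swap_vars i (f ^ k) = swap_vars i f ^ k"
  by (induction k) (simp_all add: swap_vars_mult)

lemma swap_vars_prod: "swap_vars i (\<Prod>k\<in>A. f k) = (\<Prod>k\<in>A. swap_vars i (f k))"
  by (induction A rule: infinite_finite_induct) (simp_all add: swap_vars_mult)

lemma swap_vars_X: "swap_vars i (X k) = X (transpose i (Suc i) k)"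
proof -
  have "swap_comp i (Poly_Mapping.single k 1) = Poly_Mapping.single (transpose i (Suc i) k) 1"
    by (rule poly_mapping_eqI) (auto simp: lookup_swap_comp lookup_single when_def transpose_def)
  then show ?thesis by (simp add: X_def swap_vars_xpow)
qed

lemma swap_vars_X_simps [simp]:
  "swap_vars i (X i) = X (Suc i)" "swap_vars i (X (Suc i)) = X i"
  "k \<noteq> i \<Longrightarrow> k \<noteq> Suc i \<Longrightarrow> swap_vars i (X k) = X k"
  by (simp_all add: swap_vars_X)

text \<open>Splits off the part of a monomial that is free of \<open>X i\<close> and
  \<open>X (Suc i)\<close>, hence symmetric in them; divided differences act on the remaining two
  powers only.\<close>

lemma xpow_update2:
  "xpow (Poly_Mapping.update (Suc i) b (Poly_Mapping.update i a e)) =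
    xpow (Poly_Mapping.update (Suc i) 0 (Poly_Mapping.update i 0 e)) * (X i ^ a * X (Suc i) ^ b)"
proof -
  have "Poly_Mapping.update (Suc i) b (Poly_Mapping.update i a e) =
      Poly_Mapping.update (Suc i) 0 (Poly_Mapping.update i 0 e) + (Poly_Mapping.single i a + Poly_Mapping.single (Suc i) b)"
    by (rule poly_mapping_eqI) (simp add: lookup_update lookup_add lookup_single when_def)
  then show ?thesis by (simp add: xpow_add xpow_single)
qed

lemma update2_id: "Poly_Mapping.update (Suc i) (entry e (Suc i)) (Poly_Mapping.update i (entry e i) e) = e"
  by (rule poly_mapping_eqI) (simp add: lookup_update)

lemma swap_vars_xpow_eq: "entry e i = entry e (Suc i) \<Longrightarrow> swap_vars i (xpow e) = xpow e"
proof -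
  assume "entry e i = entry e (Suc i)"
  then have "swap_comp i e = e"
    by (intro poly_mapping_eqI) (auto simp: lookup_swap_comp transpose_def)
  then show ?thesis by (simp add: swap_vars_xpow)
qed

text \<open>The factorization of x^k - y^k, multiplied by (xy)^p. The common factor is spread over
  the summands, so that each of them is a monomial of degree 2p + k - 1.\<close>

lemma power_times_power_diff:
  fixes x y :: "'a::comm_ring_1"
  shows "(x - y) * (\<Sum>c<k. x ^ (p + c) * y ^ (p + k - Suc c)) = x ^ (p + k) * y ^ p - x ^ p * y ^ (p + k)"
proof -
  have "(\<Sum>c<k. x ^ (p + c) * y ^ (p + k - Suc c)) = x ^ p * y ^ p * (\<Sum>c<k. y ^ (k - Suc c) * x ^ c)"
    unfolding sum_distrib_left
  proof (rule sum.cong)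
    fix c assume "c \<in> {..<k}"
    then have "p + k - Suc c = p + (k - Suc c)" by auto
    then show "x ^ (p + c) * y ^ (p + k - Suc c) = x ^ p * y ^ p * (y ^ (k - Suc c) * x ^ c)"
      by (simp add: power_add mult_ac)
  qed simp
  then have "(x - y) * (\<Sum>c<k. x ^ (p + c) * y ^ (p + k - Suc c))
      = x ^ p * y ^ p * ((x - y) * (\<Sum>c<k. y ^ (k - Suc c) * x ^ c))"
    by (simp only: mult.left_commute)
  also have "\<dots> = x ^ p * y ^ p * (x ^ k - y ^ k)"
    by (simp only: power_diff_sumr2)
  finally show ?thesis by (simp add: power_add algebra_simps)
qed

lemma divdiffI:
  assumes "(X i - X (Suc i)) * g = f - swap_vars i f"
  shows "divdiff i f = g"
  unfolding divdiff_def
proof (rule the_equality)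
  fix h assume "(X i - X (Suc i)) * h = f - swap_vars i f"
  then have "(X i - X (Suc i)) * h = (X i - X (Suc i)) * g" using assms by simp
  then show "h = g" using X_diff_nonzero[of i "Suc i"] by simp
qed (fact assms)

lemma divdiff_xpow_exists: "\<exists>g. (X i - X (Suc i)) * g = xpow e - swap_vars i (xpow e)"
proof -
  define h where "h = xpow (Poly_Mapping.update (Suc i) 0 (Poly_Mapping.update i 0 e))"
  have h: "swap_vars i h = h"
    unfolding h_def by (rule swap_vars_xpow_eq) (simp add: lookup_update)
  have e: "xpow e = h * (X i ^ entry e i * X (Suc i) ^ entry e (Suc i))"
    unfolding h_def xpow_update2[symmetric] by (simp add: update2_id)
  have *: "\<exists>g. (X i - X (Suc i)) * g = X i ^ a * X (Suc i) ^ b - X (Suc i) ^ a * X i ^ b" for a b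
  proof (cases "b \<le> a")
    case True
    then obtain k where "a = b + k" using le_Suc_ex by blast
    with power_times_power_diff[of "X i" "X (Suc i)" b k]
    have "(X i - X (Suc i)) * (\<Sum>c<k. X i ^ (b + c) * X (Suc i) ^ (b + k - Suc c))
        = X i ^ a * X (Suc i) ^ b - X (Suc i) ^ a * X i ^ b"
      by (simp add: mult.commute)
    then show ?thesis by blast
  next
    case False
    then obtain k where "b = a + k" using le_Suc_ex nat_le_linear by blast
    with power_times_power_diff[of "X i" "X (Suc i)" a k]
    have "(X i - X (Suc i)) * - (\<Sum>c<k. X i ^ (a + c) * X (Suc i) ^ (a + k - Suc c))
        = X i ^ a * X (Suc i) ^ b - X (Suc i) ^ a * X i ^ b"
      by (simp add: mult_ac)
    then show ?thesis by blast
  qed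
  obtain g where "(X i - X (Suc i)) * g = X i ^ entry e i * X (Suc i) ^ entry e (Suc i)
      - X (Suc i) ^ entry e i * X i ^ entry e (Suc i)" using * by blast
  then have "(X i - X (Suc i)) * (h * g) = xpow e - swap_vars i (xpow e)"
    unfolding e swap_vars_mult h swap_vars_power swap_vars_X_simps
    by (simp only: mult.left_commute[of _ h] right_diff_distrib)
  then show ?thesis by blast
qed

text \<open>The description by \<open>THE\<close> says nothing until a quotient is exhibited:
  monomials have one by geometric sums, and quotients combine linearly; \<open>divdiffI\<close>
  supplies uniqueness.\<close>

lemma divdiff_eq: "(X i - X (Suc i)) * divdiff i f = f - swap_vars i f"
proof -
  have "f \<in> qp.span (xpow ` UNIV)" by (simp add: in_span_xpow_iff)
  then have "\<exists>g. (X i - X (Suc i)) * g = f - swap_vars i f"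
  proof (induction rule: qp.span_induct_alt)
    case base
    show ?case by (intro exI[of _ 0]) simp
  next
    case (step c x y)
    then obtain g h where "(X i - X (Suc i)) * g = x - swap_vars i x" "(X i - X (Suc i)) * h = y - swap_vars i y"
      using divdiff_xpow_exists by blast
    then have "(X i - X (Suc i)) * (scale c g + h) = (scale c x + y) - swap_vars i (scale c x + y)"
      by (simp add: swap_vars_add swap_vars_scale scale_mult_right distrib_left qp.scale_right_diff_distrib)
    then show ?case by blast
  qed
  then show ?thesis using divdiffI by blast
qed

lemma divdiff_cancel: "(X i - X (Suc i)) * f = (X i - X (Suc i)) * g \<longleftrightarrow> f = g"
  using X_diff_nonzero[of i "Suc i"] by simp

lemma qlinear_divdiff: "qlinear (divdiff i)"
  by (rule qlinearI; rule divdiffI)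
    (simp_all add: distrib_left divdiff_eq scale_mult_right swap_vars_add swap_vars_scale qp.scale_right_diff_distrib)

lemma divdiff_add: "divdiff i (f + g) = divdiff i f + divdiff i g"
  by (rule divdiffI) (simp add: distrib_left divdiff_eq swap_vars_add)

lemma divdiff_scale: "divdiff i (scale c f) = scale c (divdiff i f)"
  by (rule divdiffI) (simp add: divdiff_eq scale_mult_right swap_vars_scale qp.scale_right_diff_distrib)

lemma divdiff_mult_sym: "swap_vars i g = g \<Longrightarrow> divdiff i (g * f) = g * divdiff i f"
  by (rule divdiffI) (simp add: mult.left_commute[of _ g] divdiff_eq swap_vars_mult right_diff_distrib)

lemma divdiff_eq_0_iff: "divdiff i f = 0 \<longleftrightarrow> swap_vars i f = f"
proof
  assume "divdiff i f = 0"
  then show "swap_vars i f = f" using divdiff_eq[of i f] by simp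
next
  assume "swap_vars i f = f"
  then show "divdiff i f = 0" by (intro divdiffI) simp
qed

lemma swap_vars_divdiff: "swap_vars i (divdiff i f) = divdiff i f"
proof -
  have "swap_vars i ((X i - X (Suc i)) * divdiff i f) = swap_vars i (f - swap_vars i f)"
    by (simp only: divdiff_eq)
  then have "(X (Suc i) - X i) * swap_vars i (divdiff i f) = swap_vars i f - f"
    by (simp add: swap_vars_mult swap_vars_diff)
  then have "(X i - X (Suc i)) * swap_vars i (divdiff i f) = f - swap_vars i f"
    by (simp add: algebra_simps)
  then show ?thesis by (rule divdiffI[symmetric])
qed

lemma divdiff_divdiff: "divdiff i (divdiff i f) = 0"
  by (simp only: divdiff_eq_0_iff swap_vars_divdiff)

lemma divdiff_0 [simp]: "divdiff i 0 = 0"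
  by (rule divdiffI) simp

lemma divdiff_swap_vars: "divdiff i (swap_vars i f) = - divdiff i f"
  by (rule divdiffI) (simp only: mult_minus_right divdiff_eq swap_vars_swap_vars minus_diff_eq)

lemma divdiff_X: "divdiff i (X i) = 1"
  by (rule divdiffI) simp

section \<open>Commutation and braid relations of the divided differences\<close>

lemma swap_comp_commute: "Suc i < j \<Longrightarrow> swap_comp i (swap_comp j e) = swap_comp j (swap_comp i e)"
  by (rule poly_mapping_eqI) (auto simp: lookup_swap_comp transpose_def)

lemma swap_comp_braid:
  "swap_comp i (swap_comp (Suc i) (swap_comp i e)) = swap_comp (Suc i) (swap_comp i (swap_comp (Suc i) e))"
  by (rule poly_mapping_eqI) (auto simp: lookup_swap_comp transpose_def)

lemma swap_vars_commute:
  "Suc i < j \<Longrightarrow> swap_vars i (swap_vars j f) = swap_vars j (swap_vars i f)"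
  by (rule poly_mapping_eqI) (metis lookup_swap_vars swap_comp_commute)

lemma swap_vars_braid:
  "swap_vars i (swap_vars (Suc i) (swap_vars i f)) = swap_vars (Suc i) (swap_vars i (swap_vars (Suc i) f))"
  by (rule poly_mapping_eqI) (simp add: lookup_swap_vars swap_comp_braid)

lemma divdiff_commute:
  assumes "Suc i < j"
  shows "divdiff i (divdiff j f) = divdiff j (divdiff i f)"
proof -
  have *: "(X i - X (Suc i)) * (X j - X (Suc j)) * divdiff i (divdiff j f) =
      f - swap_vars i f - swap_vars j f + swap_vars i (swap_vars j f)"
    if "Suc i < j \<or> Suc j < i" for i j
  proof -
    \<comment> \<open>As the two index pairs are disjoint, \<open>X j - X (Suc j)\<close> is fixed
      by the swap at \<open>i\<close> and passes through \<open>divdiff i\<close>.\<close>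
    have "(X i - X (Suc i)) * ((X j - X (Suc j)) * divdiff i (divdiff j f))
       = (X i - X (Suc i)) * divdiff i ((X j - X (Suc j)) * divdiff j f)"
      using that by (subst divdiff_mult_sym) (auto simp: swap_vars_diff)
    then show ?thesis by (simp add: divdiff_eq swap_vars_diff mult.assoc)
  qed
  have "(X j - X (Suc j)) * (X i - X (Suc i)) * divdiff j (divdiff i f) =
      (X i - X (Suc i)) * (X j - X (Suc j)) * divdiff i (divdiff j f)"
    using *[of i j] *[of j i] assms
    by (simp only: swap_vars_commute[OF assms, of f] simp_thms diff_diff_eq add.commute[of "swap_vars j f"])
  moreover have "(X i - X (Suc i)) * (X j - X (Suc j)) \<noteq> 0" by simp
  ultimately show ?thesis
    unfolding mult.commute[of "X j - X (Suc j)"] by (metis mult_left_cancel)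
qed

text \<open>Both sides of the braid relation equal the antisymmetrization of \<open>f\<close> over three variables
  divided by their Vandermonde product.\<close>

lemma divdiff_braid:
  "divdiff i (divdiff (Suc i) (divdiff i f)) = divdiff (Suc i) (divdiff i (divdiff (Suc i) f))"
proof -
  define j where "j = Suc i"
  define x y z where "x = X i" and "y = X j" and "z = X (Suc j)"
  note defs = x_def y_def z_def j_def
  have s: "swap_vars i x = y" "swap_vars i y = x" "swap_vars i z = z"
    "swap_vars j x = x" "swap_vars j y = z" "swap_vars j z = y"
    by (simp_all add: defs)
  have D: "(x - y) * divdiff i g = g - swap_vars i g" "(y - z) * divdiff j g = g - swap_vars j g" for g
    using divdiff_eq[of i g] divdiff_eq[of j g] by (simp_all add: defs)
  \<comment> \<open>The swap at \<open>j\<close> carries x - y to x - z, and the swap at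
    \<open>i\<close> carries y - z to x - z.\<close>
  have D': "(x - z) * swap_vars j (divdiff i g) = swap_vars j g - swap_vars j (swap_vars i g)"
    "(x - z) * swap_vars i (divdiff j g) = swap_vars i g - swap_vars i (swap_vars j g)" for g
    using arg_cong[OF D(1)[of g], of "swap_vars j"] arg_cong[OF D(2)[of g], of "swap_vars i"]
    by (simp_all add: swap_vars_mult swap_vars_diff s)
  have ne: "x - y \<noteq> 0" "y - z \<noteq> 0" "x - z \<noteq> 0"
    unfolding defs by (rule X_diff_nonzero; simp)+
  define V where "V = (x - y) * (y - z) * (x - z)"
  \<comment> \<open>\<open>V\<close> is alternating, so \<open>V\<close> times a swapped polynomial
    is minus the swap of the product with \<open>V\<close>; the differences below thereby become
    sums.\<close>
  have sV: "swap_vars i V = - V" "swap_vars j V = - V"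
    unfolding V_def swap_vars_mult swap_vars_diff s by (simp_all add: algebra_simps)
  have V2: "V * divdiff j (divdiff i f) = (x - z) * (f - swap_vars i f) - (x - y) * (swap_vars j f - swap_vars j (swap_vars i f))"
    "V * divdiff i (divdiff j f) = (x - z) * (f - swap_vars j f) - (y - z) * (swap_vars i f - swap_vars i (swap_vars j f))"
  proof -
    have "V * divdiff j (divdiff i f) = (x - y) * (x - z) * ((y - z) * divdiff j (divdiff i f))"
      by (simp add: V_def mult_ac)
    also have "\<dots> = (x - z) * ((x - y) * divdiff i f) - (x - y) * ((x - z) * swap_vars j (divdiff i f))"
      unfolding D(2) by (simp add: algebra_simps)
    finally show "V * divdiff j (divdiff i f) = (x - z) * (f - swap_vars i f) - (x - y) * (swap_vars j f - swap_vars j (swap_vars i f))"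
      unfolding D D' .
    have "V * divdiff i (divdiff j f) = (y - z) * (x - z) * ((x - y) * divdiff i (divdiff j f))"
      by (simp add: V_def mult_ac)
    also have "\<dots> = (x - z) * ((y - z) * divdiff j f) - (y - z) * ((x - z) * swap_vars i (divdiff j f))"
      unfolding D(1) by (simp add: algebra_simps)
    finally show "V * divdiff i (divdiff j f) = (x - z) * (f - swap_vars j f) - (y - z) * (swap_vars i f - swap_vars i (swap_vars j f))"
      unfolding D D' .
  qed
  let ?A = "f - swap_vars i f - swap_vars j f + swap_vars j (swap_vars i f) + swap_vars i (swap_vars j f)
      - swap_vars i (swap_vars j (swap_vars i f))"
  have "(x - y) * (V * divdiff i (divdiff j (divdiff i f))) = V * ((x - y) * divdiff i (divdiff j (divdiff i f)))"
    by (simp add: mult_ac)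
  also have "\<dots> = V * divdiff j (divdiff i f) + swap_vars i (V * divdiff j (divdiff i f))"
    unfolding D by (simp add: swap_vars_mult sV algebra_simps)
  also have "\<dots> = (x - y) * ?A"
    unfolding V2 swap_vars_mult swap_vars_diff s by (simp add: algebra_simps)
  finally have 1: "V * divdiff i (divdiff j (divdiff i f)) = ?A" using ne by simp
  have "(y - z) * (V * divdiff j (divdiff i (divdiff j f))) = V * ((y - z) * divdiff j (divdiff i (divdiff j f)))"
    by (simp add: mult_ac)
  also have "\<dots> = V * divdiff i (divdiff j f) + swap_vars j (V * divdiff i (divdiff j f))"
    unfolding D by (simp add: swap_vars_mult sV algebra_simps)
  also have "\<dots> = (y - z) * ?A"
    unfolding V2 swap_vars_mult swap_vars_diff s swap_vars_braid[of i f, folded j_def]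
    by (simp add: algebra_simps)
  finally have 2: "V * divdiff j (divdiff i (divdiff j f)) = ?A" using ne by simp
  have "V \<noteq> 0" using ne by (simp add: V_def)
  with 1 2 show ?thesis unfolding j_def by (metis mult_left_cancel)
qed

lemma qlinear_pihat: "qlinear (pihat i)"
  unfolding pihat_def by (rule qlinear_compose[OF qlinear_mult qlinear_divdiff])

lemma pihat_mult_sym: "swap_vars i g = g \<Longrightarrow> pihat i (g * f) = g * pihat i f"
  by (simp only: pihat_def divdiff_mult_sym mult.left_commute)

lemma pihat_swap_vars: "pihat i (swap_vars i f) = - pihat i f"
  by (simp add: pihat_def divdiff_swap_vars)

lemma pihat_eq: "(X i - X (Suc i)) * pihat i f = X i * X (Suc i) * (f - swap_vars i f)"
  unfolding pihat_def divdiff_eq[of i f, symmetric] by (simp only: mult.left_commute mult.assoc)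

text \<open>The factor \<open>X i * X (Suc i)\<close> shifts the geometric sum: the exponent pairs
  run from (p + 1, p + k) to (p + k, p + 1), so the larger old exponent is never exceeded.\<close>

lemma pihat_xpow:
  assumes "entry e i = p + k" and "entry e (Suc i) = p"
  shows "pihat i (xpow e) =
    (\<Sum>c<k. xpow (Poly_Mapping.update (Suc i) (p + k - c) (Poly_Mapping.update i (Suc (p + c)) e)))"
proof -
  define h where "h = xpow (Poly_Mapping.update (Suc i) 0 (Poly_Mapping.update i 0 e))"
  have h: "swap_vars i h = h"
    unfolding h_def by (rule swap_vars_xpow_eq) (simp add: lookup_update)
  have e: "xpow e = h * (X i ^ (p + k) * X (Suc i) ^ p)"
    unfolding h_def xpow_update2[symmetric] using update2_id[of i e] by (simp only: assms)
  have d: "divdiff i (X i ^ (p + k) * X (Suc i) ^ p) = (\<Sum>c<k. X i ^ (p + c) * X (Suc i) ^ (p + k - Suc c))"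
    by (rule divdiffI)
      (simp only: power_times_power_diff swap_vars_mult swap_vars_power swap_vars_X_simps mult.commute)
  have "pihat i (X i ^ (p + k) * X (Suc i) ^ p) = (\<Sum>c<k. X i ^ Suc (p + c) * X (Suc i) ^ (p + k - c))"
    unfolding pihat_def d sum_distrib_left
  proof (rule sum.cong)
    fix c assume "c \<in> {..<k}"
    then have "p + k - c = Suc (p + k - Suc c)" by auto
    then show "X i * X (Suc i) * (X i ^ (p + c) * X (Suc i) ^ (p + k - Suc c)) = X i ^ Suc (p + c) * X (Suc i) ^ (p + k - c)"
      by (simp only: power_Suc mult_ac)
  qed simp
  then show ?thesis
    unfolding e pihat_mult_sym[OF h] xpow_update2[of i _ _ e, folded h_def] by (simp only: sum_distrib_left)
qed

declare One_nat_def [simp del]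

subsection \<open>Schubert polynomials\<close>

text \<open>Independence of an indexed family rather than of its image: \<open>B\<close> is then
  injective on \<open>S\<close>, so a coefficient can be attributed to an index.\<close>

definition indep_family :: "('a \<Rightarrow> qpoly) \<Rightarrow> 'a set \<Rightarrow> bool" where
  "indep_family B S \<longleftrightarrow> (\<forall>A c. finite A \<and> A \<subseteq> S \<and> (\<Sum>a\<in>A. scale (c a) (B a)) = 0 \<longrightarrow> (\<forall>a\<in>A. c a = 0))"

lemma sum_keys_superset:
  assumes "finite A" and "Poly_Mapping.keys d \<subseteq> A"
  shows "(\<Sum>k\<in>Poly_Mapping.keys d. scale (Poly_Mapping.lookup d k) (B k)) = (\<Sum>k\<in>A. scale (Poly_Mapping.lookup d k) (B k))"
  using assms by (intro sum.mono_neutral_left) (auto simp: in_keys_iff)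

lemma indep_family_unique:
  assumes "indep_family B S" and "Poly_Mapping.keys c \<subseteq> S" and "Poly_Mapping.keys d \<subseteq> S"
    and "(\<Sum>k\<in>Poly_Mapping.keys c. scale (Poly_Mapping.lookup c k) (B k)) =
      (\<Sum>k\<in>Poly_Mapping.keys d. scale (Poly_Mapping.lookup d k) (B k))"
  shows "c = d"
proof (rule poly_mapping_eqI)
  fix k
  let ?A = "Poly_Mapping.keys c \<union> Poly_Mapping.keys d"
  define e where "e k = Poly_Mapping.lookup c k - Poly_Mapping.lookup d k" for k
  have "(\<Sum>k\<in>?A. scale (e k) (B k)) =
      (\<Sum>k\<in>?A. scale (Poly_Mapping.lookup c k) (B k)) - (\<Sum>k\<in>?A. scale (Poly_Mapping.lookup d k) (B k))"
    unfolding e_def qp.scale_left_diff_distrib sum_subtractf ..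
  also have "\<dots> = 0"
    using assms(4) by (subst (1 2) sum_keys_superset[symmetric]) simp_all
  finally have "(\<Sum>k\<in>?A. scale (e k) (B k)) = 0" .
  moreover have "finite ?A" by simp
  moreover have "?A \<subseteq> S" using assms(2,3) by (rule Un_least)
  ultimately have "\<forall>k\<in>?A. e k = 0"
    using assms(1) unfolding indep_family_def by blast
  then have "e k = 0"
    by (cases "k \<in> ?A") (simp_all add: e_def not_in_keys_iff_lookup_eq_zero)
  then show "Poly_Mapping.lookup c k = Poly_Mapping.lookup d k" by (simp add: e_def)
qed

section \<open>Permutations of finite support and their codes\<close>

lemma fin_perm_iff: "fin_perm w \<longleftrightarrow> (\<exists>N. w permutes {1..N})"
proof
  assume w: "fin_perm w"
  then obtain N where "\<forall>i\<in>{i. w i \<noteq> i}. i \<le> N"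
    unfolding fin_perm_def finite_nat_set_iff_bounded_le by blast
  then have "w permutes {1..N}"
    using w unfolding fin_perm_def by (elim conjE permutes_superset) auto
  then show "\<exists>N. w permutes {1..N}" ..
next
  assume "\<exists>N. w permutes {1..N}"
  then obtain N where N: "w permutes {1..N}" by blast
  then have "{i. w i \<noteq> i} \<subseteq> {1..N}" using permutes_not_in[OF N] by blast
  then have "finite {i. w i \<noteq> i}" by (rule finite_subset) simp
  then show "fin_perm w"
    using permutes_subset[OF N, of "{1..}"] unfolding fin_perm_def by auto
qed

lemma permutes_atLeastAtMost_mono: "w permutes {1..N} \<Longrightarrow> N \<le> M \<Longrightarrow> w permutes {1..M::nat}"
  by (erule permutes_subset) auto

lemma permutes_swap:
  assumes "w permutes {1..N}" and "1 \<le> i" and "i < N"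
  shows "w \<circ> transpose i (Suc i) permutes {1..N}"
  using assms by (intro permutes_compose permutes_swap_id) auto

lemma fin_perm_swap: "fin_perm w \<Longrightarrow> 1 \<le> i \<Longrightarrow> fin_perm (w \<circ> transpose i (Suc i))"
proof -
  assume "fin_perm w" "1 \<le> i"
  then obtain N where "w permutes {1..N}" unfolding fin_perm_iff by blast
  then have "w permutes {1..max N (Suc i)}" by (rule permutes_atLeastAtMost_mono) simp
  from permutes_swap[OF this, of i] \<open>1 \<le> i\<close> show ?thesis
    unfolding fin_perm_iff by (metis less_max_iff_disj lessI)
qed

lemma fin_perm_inj: "fin_perm w \<Longrightarrow> inj w"
  by (auto simp: fin_perm_def intro: permutes_inj)

lemma inversions_subset:
  assumes "w permutes {1..N::nat}" and "i < j" and "w j < w i"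
  shows "1 \<le> i" "j \<le> N"
proof -
  show "j \<le> N"
  proof (rule ccontr)
    assume "\<not> j \<le> N"
    then have j: "w j = j" using assms(1) by (simp add: permutes_not_in)
    have "w i \<le> N \<or> w i = i"
      using permutes_in_image[OF assms(1), of i] permutes_not_in[OF assms(1), of i] by auto
    with j \<open>\<not> j \<le> N\<close> assms(2,3) show False by linarith
  qed
  show "1 \<le> i"
    using assms permutes_not_in[OF assms(1), of 0] by (cases i) auto
qed

lemma finite_inversions: "fin_perm w \<Longrightarrow> finite {j. i < j \<and> w j < w i}"
proof -
  assume "fin_perm w"
  then obtain N where "w permutes {1..N}" unfolding fin_perm_iff by blast
  then have "{j. i < j \<and> w j < w i} \<subseteq> {..N}" using inversions_subset(2)[OF \<open>w permutes {1..N}\<close>] by auto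
  then show ?thesis by (rule finite_subset) simp
qed

lemma lookup_invcode:
  assumes "fin_perm w"
  shows "entry (invcode w) i = card {j. i < j \<and> w j < w i}"
proof -
  obtain N where w: "w permutes {1..N}" using assms unfolding fin_perm_iff by blast
  have "{i. card {j. i < j \<and> w j < w i} \<noteq> 0} \<subseteq> {..N}"
  proof safe
    fix i assume "0 < card {j. i < j \<and> w j < w i}"
    then obtain j where "i < j" "w j < w i" by (auto simp: card_gt_0_iff)
    with inversions_subset[OF w this] show "i \<le> N" by simp
  qed
  then have "finite {i. card {j. i < j \<and> w j < w i} \<noteq> 0}" by (rule finite_subset) simp
  then show ?thesis unfolding invcode_def by simp
qed

lemma invcode_beyond: "w permutes {1..N} \<Longrightarrow> N < i \<Longrightarrow> entry (invcode w) i = 0"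
proof -
  assume w: "w permutes {1..N}" "N < i"
  then have "{j. i < j \<and> w j < w i} = {}" using inversions_subset(2)[OF w(1), of i] by force
  moreover have "fin_perm w" using w(1) fin_perm_iff by blast
  ultimately show ?thesis by (simp only: lookup_invcode card.empty)
qed

lemma invcode_descent:
  assumes "fin_perm w" and "w (Suc i) < w i"
  shows "entry (invcode w) (Suc i) < entry (invcode w) i"
proof -
  have "{j. Suc i < j \<and> w j < w (Suc i)} \<subset> {j. i < j \<and> w j < w i}"
    using assms(2) by (auto simp: psubset_eq set_eq_iff)
  then show ?thesis
    unfolding lookup_invcode[OF assms(1)] by (rule psubset_card_mono[OF finite_inversions[OF assms(1)]])
qed

lemma invcode_ascent:
  assumes "fin_perm w" and "w i < w (Suc i)"
  shows "entry (invcode w) i \<le> entry (invcode w) (Suc i)"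
proof -
  have "j \<noteq> Suc i" if "w j < w i" for j using that assms(2) by auto
  then have "{j. i < j \<and> w j < w i} \<subseteq> {j. Suc i < j \<and> w j < w (Suc i)}"
    using assms(2) by (force simp: Suc_lessI)
  then show ?thesis
    unfolding lookup_invcode[OF assms(1)] by (rule card_mono[OF finite_inversions[OF assms(1)]])
qed

text \<open>Turning an ascent into a descent creates exactly one inversion, that of the positions
  \<open>i\<close> and \<open>Suc i\<close>. It is counted at \<open>i\<close>; otherwise the counts
  travel with the values.\<close>

lemma invcode_swap:
  assumes "fin_perm w" and "1 \<le> i" and "w i < w (Suc i)"
  shows "entry (invcode (w \<circ> transpose i (Suc i))) k =
    (if k = i then Suc (entry (invcode w) (Suc i)) else if k = Suc i then entry (invcode w) i
     else entry (invcode w) k)"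
proof -
  let ?t = "transpose i (Suc i)"
  consider (i) "k = i" | (Suc) "k = Suc i" | (other) "k \<noteq> i" "k \<noteq> Suc i" by blast
  then show ?thesis
  proof cases
    case i
    have "{j. i < j \<and> (w \<circ> ?t) j < (w \<circ> ?t) i} = insert (Suc i) {j. Suc i < j \<and> w j < w (Suc i)}"
      using assms(3) by (auto simp: transpose_def)
    then have "card {j. i < j \<and> (w \<circ> ?t) j < (w \<circ> ?t) i} = Suc (card {j. Suc i < j \<and> w j < w (Suc i)})"
      using finite_inversions[OF assms(1), of "Suc i"] by simp
    then show ?thesis using i by (simp only: lookup_invcode assms(1) fin_perm_swap[OF assms(1,2)] if_True simp_thms)
  next
    case Suc
    have "j \<noteq> Suc i" if "w j < w i" for j using that assms(3) by auto
    then have "{j. Suc i < j \<and> (w \<circ> ?t) j < (w \<circ> ?t) (Suc i)} = {j. i < j \<and> w j < w i}"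
      by (force simp: transpose_def Suc_lessI)
    then show ?thesis using Suc by (simp add: lookup_invcode assms(1) fin_perm_swap[OF assms(1,2)])
  next
    case other
    have "{j. k < j \<and> (w \<circ> ?t) j < (w \<circ> ?t) k} = ?t ` {j. k < j \<and> w j < w k}"
    proof (rule set_eqI)
      fix j
      have "k < j \<longleftrightarrow> k < ?t j" using other by (auto simp: transpose_def)
      then show "j \<in> {j. k < j \<and> (w \<circ> ?t) j < (w \<circ> ?t) k} \<longleftrightarrow> j \<in> ?t ` {j. k < j \<and> w j < w k}"
        using other by (auto simp: image_iff intro!: exI[of _ "?t j"])
    qed
    then have "card {j. k < j \<and> (w \<circ> ?t) j < (w \<circ> ?t) k} = card {j. k < j \<and> w j < w k}"
      by (simp only: card_image[OF inj_on_subset[OF inj_transpose subset_UNIV]])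
    then show ?thesis using other by (simp only: lookup_invcode assms(1) fin_perm_swap[OF assms(1,2)] if_False simp_thms)
  qed
qed

text \<open>Such a \<open>w\<close> is the longest element of the symmetric group on
  \<open>{1..N}\<close>, where the recursion along ascents stops.\<close>

lemma is_partition_decreasing:
  assumes "w permutes {1..N}" and "\<And>i. 1 \<le> i \<Longrightarrow> i < N \<Longrightarrow> \<not> w i < w (Suc i)"
  shows "is_partition (invcode w)"
  unfolding is_partition_def
proof (intro allI impI)
  fix i :: nat assume "1 \<le> i"
  have "fin_perm w" using assms(1) fin_perm_iff by blast
  show "entry (invcode w) (Suc i) \<le> entry (invcode w) i"
  proof (cases "i < N")
    case True
    then have "w (Suc i) < w i"
      using assms(2)[OF \<open>1 \<le> i\<close>] injD[OF permutes_inj[OF assms(1)], of i "Suc i"] by fastforce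
    then show ?thesis using invcode_descent[OF \<open>fin_perm w\<close>] by (simp add: less_imp_le)
  next
    case False
    then show ?thesis by (simp add: invcode_beyond[OF assms(1)])
  qed
qed

lemma sum_swap_weights:
  fixes a w :: "nat \<Rightarrow> nat"
  assumes "1 \<le> i" and "i < N"
  shows "(\<Sum>j=1..N. a j * (w \<circ> transpose i (Suc i)) j) + (a i * w i + a (Suc i) * w (Suc i)) =
    (\<Sum>j=1..N. a j * w j) + (a i * w (Suc i) + a (Suc i) * w i)"
proof -
  have split: "sum f {1..N} = sum f ({1..N} - {i, Suc i}) + (f i + f (Suc i))" for f :: "nat \<Rightarrow> nat"
  proof -
    have "sum f {1..N} = sum f ({1..N} - {i, Suc i}) + sum f {i, Suc i}"
      using assms by (intro sum.subset_diff) auto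
    then show ?thesis by simp
  qed
  have "(\<Sum>j\<in>{1..N} - {i, Suc i}. a j * (w \<circ> transpose i (Suc i)) j) = (\<Sum>j\<in>{1..N} - {i, Suc i}. a j * w j)"
    by (intro sum.cong) (auto simp: transpose_def)
  then show ?thesis unfolding split by simp
qed

text \<open>Measures for two directions of induction: the first weight drops when an ascent is
  exchanged, on the way to the longest element; the second drops when a descent is exchanged, on the
  way to the identity.\<close>

lemma swap_weight_less:
  assumes "1 \<le> i" and "i < N" and "w i < (w (Suc i) :: nat)"
  shows "(\<Sum>j=1..N. j * (w \<circ> transpose i (Suc i)) j) < (\<Sum>j=1..N. j * w j)"
    and "(\<Sum>j=1..N. (N - j) * w j) < (\<Sum>j=1..N. (N - j) * (w \<circ> transpose i (Suc i)) j)"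
proof -
  show "(\<Sum>j=1..N. j * (w \<circ> transpose i (Suc i)) j) < (\<Sum>j=1..N. j * w j)"
    using sum_swap_weights[OF assms(1,2), of "\<lambda>j. j" w] assms(3) by simp
  have "N - i = Suc (N - Suc i)" using assms(2) by simp
  then show "(\<Sum>j=1..N. (N - j) * w j) < (\<Sum>j=1..N. (N - j) * (w \<circ> transpose i (Suc i)) j)"
    using sum_swap_weights[OF assms(1,2), of "\<lambda>j. N - j" w] assms(3) by simp
qed

text \<open>The Schubert polynomial computed inside the symmetric group on \<open>{1..N}\<close>, along the path to the
  longest element that always uses the first ascent.\<close>

function schubert_upto :: "nat \<Rightarrow> (nat \<Rightarrow> nat) \<Rightarrow> qpoly" where
  "schubert_upto N w =
    (if \<exists>i. 1 \<le> i \<and> i < N \<and> w i < w (Suc i)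
     then let i = (LEAST i. 1 \<le> i \<and> i < N \<and> w i < w (Suc i)) in
       divdiff i (schubert_upto N (w \<circ> transpose i (Suc i)))
     else xpow (invcode w))"
  by pat_completeness auto
termination
proof (relation "measure (\<lambda>(N, w). \<Sum>j=1..N. j * w j)")
  fix N :: nat and w :: "nat \<Rightarrow> nat" and i
  assume "\<exists>i. 1 \<le> i \<and> i < N \<and> w i < w (Suc i)" and i: "i = (LEAST i. 1 \<le> i \<and> i < N \<and> w i < w (Suc i))"
  have "1 \<le> i \<and> i < N \<and> w i < w (Suc i)" unfolding i by (rule LeastI_ex) fact
  then show "((N, w \<circ> transpose i (Suc i)), (N, w)) \<in> measure (\<lambda>(N, w). \<Sum>j=1..N. j * w j)"
    using swap_weight_less(1)[of i N w] by simp
qed simp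

declare schubert_upto.simps [simp del]

text \<open>A confluence argument. For two distinct ascents the induction hypothesis applies to both
  successors: ascents far apart close a diamond by \<open>divdiff_commute\<close>, adjacent ones a
  hexagon by \<open>divdiff_braid\<close>.\<close>

lemma schubert_upto_ascent:
  assumes "1 \<le> i" and "i < N" and "w i < w (Suc i)"
  shows "schubert_upto N w = divdiff i (schubert_upto N (w \<circ> transpose i (Suc i)))"
  using assms
proof (induction "\<Sum>j=1..N. j * w j" arbitrary: w i rule: less_induct)
  case less
  let ?t = "\<lambda>k. transpose k (Suc k) :: nat \<Rightarrow> nat"
  let ?P = "\<lambda>i. 1 \<le> i \<and> i < N \<and> w i < w (Suc i)"
  define j where "j = (LEAST i. ?P i)"
  have P: "?P i" using less.prems by blast
  then have j: "?P j" unfolding j_def by (rule LeastI)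
  have "j \<le> i" unfolding j_def using P by (rule Least_le)
  have w: "schubert_upto N w = divdiff j (schubert_upto N (w \<circ> ?t j))"
    using P unfolding schubert_upto.simps[of N w] Let_def j_def by auto
  have IH: "schubert_upto N u = divdiff k (schubert_upto N (u \<circ> ?t k))"
    if "1 \<le> k" "k < N" "u k < u (Suc k)" "(\<Sum>j=1..N. j * u j) < (\<Sum>j=1..N. j * w j)" for u k
    using less.hyps[OF that(4,1,2,3)] .
  have wi: "(\<Sum>j=1..N. j * (w \<circ> ?t i) j) < (\<Sum>j=1..N. j * w j)"
    using P by (intro swap_weight_less) auto
  have wj: "(\<Sum>k=1..N. k * (w \<circ> ?t j) k) < (\<Sum>k=1..N. k * w k)"
    using j by (intro swap_weight_less) auto
  consider "i = j" | "Suc j < i" | "i = Suc j" using \<open>j \<le> i\<close> by linarith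
  then show ?case
  proof cases
    case 1
    then show ?thesis using w by simp
  next
    case 2
    have "schubert_upto N (w \<circ> ?t j) = divdiff i (schubert_upto N (w \<circ> ?t j \<circ> ?t i))"
      using P 2 by (intro IH wj) (auto simp: transpose_def)
    moreover have "schubert_upto N (w \<circ> ?t i) = divdiff j (schubert_upto N (w \<circ> ?t i \<circ> ?t j))"
      using j 2 by (intro IH wi) (auto simp: transpose_def)
    moreover have "w \<circ> ?t i \<circ> ?t j = w \<circ> ?t j \<circ> ?t i"
      using 2 by (auto simp: fun_eq_iff transpose_def)
    ultimately show ?thesis unfolding w using divdiff_commute[OF 2] by simp
  next
    case 3
    \<comment> \<open>Adjacent ascents make \<open>w\<close> increasing on three consecutive
      positions; both routes reverse these three values.\<close>
    have ij: "1 \<le> j" "Suc j < N" "w j < w (Suc j)" "w (Suc j) < w (Suc (Suc j))"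
      using P j 3 by auto
    have "schubert_upto N (w \<circ> ?t j) = divdiff i (schubert_upto N (w \<circ> ?t j \<circ> ?t i))"
      using ij 3 by (intro IH wj) (auto simp: transpose_def)
    moreover have 1: "(\<Sum>k=1..N. k * (w \<circ> ?t j \<circ> ?t i) k) < (\<Sum>k=1..N. k * (w \<circ> ?t j) k)"
      using ij 3 by (intro swap_weight_less) (auto simp: transpose_def)
    have "schubert_upto N (w \<circ> ?t j \<circ> ?t i) = divdiff j (schubert_upto N (w \<circ> ?t j \<circ> ?t i \<circ> ?t j))"
      using ij 3 by (intro IH less_trans[OF 1 wj]) (auto simp: transpose_def)
    moreover have "schubert_upto N (w \<circ> ?t i) = divdiff j (schubert_upto N (w \<circ> ?t i \<circ> ?t j))"
      using ij 3 by (intro IH wi) (auto simp: transpose_def)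
    moreover have 2: "(\<Sum>k=1..N. k * (w \<circ> ?t i \<circ> ?t j) k) < (\<Sum>k=1..N. k * (w \<circ> ?t i) k)"
      using ij 3 by (intro swap_weight_less) (auto simp: transpose_def)
    have "schubert_upto N (w \<circ> ?t i \<circ> ?t j) = divdiff i (schubert_upto N (w \<circ> ?t i \<circ> ?t j \<circ> ?t i))"
      using ij 3 by (intro IH less_trans[OF 2 wi]) (auto simp: transpose_def)
    moreover have "w \<circ> ?t i \<circ> ?t j \<circ> ?t i = w \<circ> ?t j \<circ> ?t i \<circ> ?t j"
      using 3 by (auto simp: fun_eq_iff transpose_def)
    ultimately show ?thesis unfolding w using divdiff_braid[of j] 3 by simp
  qed
qed

text \<open>In a partition code an ascent forces equal entries at \<open>i\<close> and
  \<open>Suc i\<close>, so exchanging it multiplies the monomial by \<open>X i\<close>, which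
  \<open>divdiff i\<close> undoes. Taking the first ascent keeps the new code a partition: a
  position just before it is a descent and has a strictly larger code entry.\<close>

lemma schubert_upto_dominant:
  assumes "w permutes {1..N}" and "is_partition (invcode w)"
  shows "schubert_upto N w = xpow (invcode w)"
  using assms
proof (induction "\<Sum>j=1..N. j * w j" arbitrary: w rule: less_induct)
  case less
  let ?P = "\<lambda>i. 1 \<le> i \<and> i < N \<and> w i < w (Suc i)"
  show ?case
  proof (cases "\<exists>i. ?P i")
    case False
    then show ?thesis unfolding schubert_upto.simps[of N w] by auto
  next
    case True
    define i where "i = (LEAST i. ?P i)"
    have i: "1 \<le> i" "i < N" "w i < w (Suc i)"
      using LeastI_ex[OF True] unfolding i_def by auto
    let ?w = "w \<circ> transpose i (Suc i)"
    have fw: "fin_perm w" using less.prems fin_perm_iff by blast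
    have part: "entry (invcode w) (Suc k) \<le> entry (invcode w) k" if "1 \<le> k" for k
      using less.prems(2) that unfolding is_partition_def by blast
    have eq: "entry (invcode w) (Suc i) = entry (invcode w) i"
      using invcode_ascent[OF fw i(3)] part[OF i(1)] by simp
    have code: "invcode ?w = Poly_Mapping.single i 1 + invcode w"
      by (rule poly_mapping_eqI) (simp add: invcode_swap[OF fw i(1,3)] eq lookup_add lookup_single when_def)
    have "is_partition (invcode ?w)"
      unfolding is_partition_def
    proof (intro allI impI)
      fix k :: nat assume k: "1 \<le> k"
      show "entry (invcode ?w) (Suc k) \<le> entry (invcode ?w) k"
      proof (cases "Suc k = i")
        case True
        then have "\<not> w k < w i" using not_less_Least[of k ?P] k i unfolding i_def by auto
        then have "w i < w k" using injD[OF fin_perm_inj[OF fw], of k i] True by fastforce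
        then have "entry (invcode w) i < entry (invcode w) k"
          using invcode_descent[OF fw, of k] True by simp
        then show ?thesis using True by (auto simp: code lookup_add lookup_single when_def)
      next
        case False
        then show ?thesis using part[OF k] by (auto simp: code lookup_add lookup_single when_def)
      qed
    qed
    then have "schubert_upto N ?w = xpow (invcode ?w)"
      using less.hyps[of ?w] swap_weight_less(1)[OF i] permutes_swap[OF less.prems(1) i(1,2)] by blast
    then have "schubert_upto N w = divdiff i (xpow (invcode w) * X i)"
      using schubert_upto_ascent[OF i] by (simp add: code xpow_add X_def mult.commute)
    also have "\<dots> = xpow (invcode w)"
      by (simp add: divdiff_mult_sym swap_vars_xpow_eq eq divdiff_X)
    finally show ?thesis .
  qed
qed

text \<open>A derivation may use ascents beyond a given symmetric group, so its value is compared
  with \<open>schubert_upto N\<close> for all sufficiently large \<open>N\<close>; two derivations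
  then meet at a common \<open>N\<close>.\<close>

lemma schubert_rel_upto:
  "schubert_rel w f \<Longrightarrow> \<exists>M. \<forall>N\<ge>M. w permutes {1..N} \<and> f = schubert_upto N w"
proof (induction rule: schubert_rel.induct)
  case (dominant w)
  then obtain M where "w permutes {1..M}" unfolding fin_perm_iff by blast
  then show ?case
    using schubert_upto_dominant dominant permutes_atLeastAtMost_mono by metis
next
  case (ascent w i f)
  then obtain M M' where M: "w permutes {1..M}" and M': "\<forall>N\<ge>M'. f = schubert_upto N (w \<circ> transpose i (Suc i))"
    unfolding fin_perm_iff by blast
  have "\<forall>N\<ge>max M (max M' (Suc i)). w permutes {1..N} \<and> divdiff i f = schubert_upto N w"
    using M M' permutes_atLeastAtMost_mono[OF M] schubert_upto_ascent[of i _ w] ascent.hyps by auto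
  then show ?case by blast
qed

lemma schubert_rel_exists:
  assumes "w permutes {1..N}"
  shows "schubert_rel w (schubert_upto N w)"
  using assms
proof (induction "\<Sum>j=1..N. j * w j" arbitrary: w rule: less_induct)
  case less
  have fw: "fin_perm w" using less.prems fin_perm_iff by blast
  show ?case
  proof (cases "\<exists>i. 1 \<le> i \<and> i < N \<and> w i < w (Suc i)")
    case False
    then have "is_partition (invcode w)" using is_partition_decreasing[OF less.prems] by blast
    then show ?thesis
      using schubert_rel.dominant[OF fw] schubert_upto_dominant[OF less.prems] by simp
  next
    case True
    then obtain i where i: "1 \<le> i" "i < N" "w i < w (Suc i)" by blast
    then have "schubert_rel (w \<circ> transpose i (Suc i)) (schubert_upto N (w \<circ> transpose i (Suc i)))"
      using less.hyps swap_weight_less(1)[OF i] permutes_swap[OF less.prems i(1,2)] by blast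
    then show ?thesis
      using schubert_rel.ascent[OF fw i(1,3)] schubert_upto_ascent[OF i] by simp
  qed
qed

lemma schubert_rel_unique:
  assumes "schubert_rel w f" and "schubert_rel w g"
  shows "f = g"
  using assms[THEN schubert_rel_upto] by (metis nat_le_linear)

lemma schubert_rel_schubert: "fin_perm w \<Longrightarrow> schubert_rel w (schubert w)"
  unfolding schubert_def fin_perm_iff by (rule theI') (use schubert_rel_exists schubert_rel_unique in blast)

lemma schubert_eqI: "schubert_rel w f \<Longrightarrow> schubert w = f"
  unfolding schubert_def using schubert_rel_unique by blast

lemma schubert_divdiff_descent:
  assumes "fin_perm w" and "1 \<le> i" and "w (Suc i) < w i"
  shows "divdiff i (schubert w) = schubert (w \<circ> transpose i (Suc i))"
proof -
  have "w \<circ> transpose i (Suc i) \<circ> transpose i (Suc i) = w" by (simp add: fun_eq_iff)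
  then have "schubert_rel (w \<circ> transpose i (Suc i)) (divdiff i (schubert w))"
    using assms schubert_rel_schubert fin_perm_swap by (intro schubert_rel.ascent) auto
  then show ?thesis by (simp add: schubert_eqI)
qed

text \<open>At an ascent \<open>schubert w\<close> is itself an image of \<open>divdiff i\<close>,
  whose square vanishes.\<close>

lemma schubert_divdiff_ascent:
  assumes "fin_perm w" and "1 \<le> i" and "w i < w (Suc i)"
  shows "divdiff i (schubert w) = 0"
proof -
  have "schubert_rel w (divdiff i (schubert (w \<circ> transpose i (Suc i))))"
    using assms schubert_rel_schubert fin_perm_swap by (intro schubert_rel.ascent) auto
  then show ?thesis by (simp only: schubert_eqI divdiff_divdiff)
qed

lemma schubert_id: "schubert id = 1"
proof -
  have f: "fin_perm id" by (simp add: fin_perm_def permutes_id)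
  have "invcode id = 0"
    by (rule poly_mapping_eqI) (use lookup_invcode[OF f] in \<open>simp add: id_def\<close>)
  then show ?thesis
    using schubert_rel.dominant[OF f] by (intro schubert_eqI) (simp add: is_partition_def)
qed

section \<open>Linear independence of the Schubert polynomials\<close>

lemma permutes_no_descent:
  assumes "w permutes {1..N::nat}" and "\<And>i. 1 \<le> i \<Longrightarrow> i < N \<Longrightarrow> \<not> w (Suc i) < w i"
  shows "w = id"
proof -
  have step: "w i < w (Suc i)" for i
  proof -
    consider "i = 0" | "1 \<le> i" "i < N" | "N \<le> i" "1 \<le> i" by linarith
    then show ?thesis
    proof cases
      case 1
      then show ?thesis using permutes_not_in[OF assms(1), of 0] injD[OF permutes_inj[OF assms(1)], of 0 1]
        by (cases "w 1") (auto simp: One_nat_def)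
    next
      case 2
      then show ?thesis using assms(2)[of i] injD[OF permutes_inj[OF assms(1)], of i "Suc i"] by fastforce
    next
      case 3
      then show ?thesis
        using permutes_not_in[OF assms(1), of "Suc i"] permutes_not_in[OF assms(1), of i]
          permutes_in_image[OF assms(1), of i] by (cases "i = N") auto
    qed
  qed
  \<comment> \<open>An increasing map satisfies \<open>i \<le> w i\<close>; downward induction from
    \<open>N\<close> turns this into equality.\<close>
  then have mono: "strict_mono w" by (rule strict_mono_Suc_iff[THEN iffD2, rule_format])
  have le: "i \<le> w i" for i using strict_mono_imp_increasing[OF mono] .
  have "w i = i" for i
  proof (cases "i \<le> N")
    case True
    then show ?thesis
    proof (induction i rule: inc_induct)
      case base
      have "w N \<in> {1..N} \<or> w N = N"
        using permutes_in_image[OF assms(1), of N] permutes_not_in[OF assms(1), of N] by blast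
      then show ?case using le[of N] by auto
    next
      case (step k)
      then show ?case using strict_monoD[OF mono, of k "Suc k"] le[of k] by simp
    qed
  next
    case False
    then show ?thesis using permutes_not_in[OF assms(1), of i] by simp
  qed
  then show ?thesis by (simp add: fun_eq_iff)
qed

text \<open>For \<open>w\<close> other than the identity, \<open>divdiff\<close> at a descent of
  \<open>w\<close> kills the terms ascending there and maps the others injectively to Schubert
  polynomials of smaller weight, so induction on the weight bound \<open>k\<close> gives
  \<open>c w = 0\<close>. What remains is a multiple of \<open>schubert id = 1\<close>.\<close>

lemma schubert_sum_eq_0:
  assumes "finite A" and "\<And>w. w \<in> A \<Longrightarrow> w permutes {1..N}" and "(\<Sum>w\<in>A. scale (c w) (schubert w)) = 0"
    and "\<And>w. w \<in> A \<Longrightarrow> (\<Sum>j=1..N. (N - j) * w j) < k"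
  shows "\<forall>w\<in>A. c w = 0"
  using assms
proof (induction k arbitrary: A c)
  case 0
  then show ?case by auto
next
  case (Suc k)
  have fp: "fin_perm w" if "w \<in> A" for w using Suc.prems(2)[OF that] fin_perm_iff by blast
  have ne: "c w = 0" if w: "w \<in> A" and "w \<noteq> id" for w
  proof -
    obtain i where i: "1 \<le> i" "i < N" "w (Suc i) < w i"
      using permutes_no_descent[OF Suc.prems(2)[OF w]] \<open>w \<noteq> id\<close> by blast
    let ?s = "\<lambda>w. w \<circ> transpose i (Suc i)"
    have ss [simp]: "?s (?s w) = w" for w :: "nat \<Rightarrow> nat" by (simp add: fun_eq_iff)
    let ?D = "{w \<in> A. w (Suc i) < w i}"
    have inj: "inj_on ?s ?D" by (rule inj_on_inverseI[where g = ?s]) simp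
    have "0 = divdiff i (\<Sum>w\<in>A. scale (c w) (schubert w))"
      by (simp add: Suc.prems(3))
    also have "\<dots> = (\<Sum>w\<in>A. scale (c w) (divdiff i (schubert w)))"
      by (induction A rule: infinite_finite_induct) (simp_all add: divdiff_add divdiff_scale)
    also have "\<dots> = (\<Sum>w\<in>?D. scale (c w) (divdiff i (schubert w)))"
    proof (rule sum.mono_neutral_right)
      show "\<forall>w\<in>A - ?D. scale (c w) (divdiff i (schubert w)) = 0"
      proof
        fix w assume "w \<in> A - ?D"
        then have "w i < w (Suc i)" using injD[OF fin_perm_inj[OF fp], of w i "Suc i"] by fastforce
        then show "scale (c w) (divdiff i (schubert w)) = 0"
          using schubert_divdiff_ascent[OF fp i(1)] \<open>w \<in> A - ?D\<close> by simp
      qed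
    qed (use Suc.prems(1) in auto)
    also have "\<dots> = (\<Sum>w\<in>?D. scale (c w) (schubert (?s w)))"
      by (intro sum.cong) (auto simp: schubert_divdiff_descent[OF fp i(1)])
    also have "\<dots> = (\<Sum>v\<in>?s ` ?D. scale (c (?s v)) (schubert v))"
      unfolding sum.reindex[OF inj] by (rule sum.cong) (simp_all only: o_apply[of _ ?s] ss)
    finally have 0: "(\<Sum>v\<in>?s ` ?D. scale (c (?s v)) (schubert v)) = 0" by simp
    have "\<forall>v\<in>?s ` ?D. c (?s v) = 0"
    proof (rule Suc.IH[OF _ _ 0])
      show "finite (?s ` ?D)" using Suc.prems(1) by simp
      show "v permutes {1..N}" if "v \<in> ?s ` ?D" for v
        using that Suc.prems(2) permutes_swap[OF _ i(1,2)] by auto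
      show "(\<Sum>j=1..N. (N - j) * v j) < k" if v: "v \<in> ?s ` ?D" for v
      proof -
        obtain u where u: "u \<in> A" "u (Suc i) < u i" "v = ?s u" using v by auto
        then have "v i < v (Suc i)" by simp
        from swap_weight_less(2)[OF i(1,2) this] u Suc.prems(4)[OF u(1)] show ?thesis by simp
      qed
    qed
    moreover have "?s w \<in> ?s ` ?D" using w i(3) by (intro imageI CollectI conjI)
    ultimately have "c (?s (?s w)) = 0" by (rule bspec)
    then show "c w = 0" by (simp only: ss)
  qed
  show ?case
  proof
    fix w assume w: "w \<in> A"
    show "c w = 0"
    proof (cases "w = id")
      case True
      have "(\<Sum>w\<in>A. scale (c w) (schubert w)) = (\<Sum>w\<in>{id}. scale (c w) (schubert w))"
        using Suc.prems(1) w True by (intro sum.mono_neutral_right) (auto simp: ne)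
      then show ?thesis using True Suc.prems(3) by (simp add: schubert_id)
    qed (use ne w in blast)
  qed
qed

lemma indep_family_schubert: "indep_family schubert (Collect fin_perm)"
  unfolding indep_family_def
proof (intro allI impI)
  fix A c
  assume A: "finite A \<and> A \<subseteq> Collect fin_perm \<and> (\<Sum>w\<in>A. scale (c w) (schubert w)) = 0"
  have "\<exists>N. \<forall>w\<in>A. w permutes {1..N}"
    using conjunct1[OF A] conjunct1[OF conjunct2[OF A]]
  proof (induction A rule: finite_induct)
    case (insert w A)
    then obtain N M where "\<forall>w\<in>A. w permutes {1..N}" "w permutes {1..M}"
      unfolding fin_perm_iff by auto
    then have "\<forall>u\<in>insert w A. u permutes {1..max N M}"
      using permutes_atLeastAtMost_mono[of _ N "max N M"] permutes_atLeastAtMost_mono[of _ M "max N M"] by auto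
    then show ?case by blast
  qed simp
  then obtain N where N: "\<And>w. w \<in> A \<Longrightarrow> w permutes {1..N}" by blast
  let ?m = "\<lambda>w. \<Sum>j=1..N. (N - j) * w j"
  show "\<forall>w\<in>A. c w = 0"
  proof (rule schubert_sum_eq_0[of A N c "Suc (sum ?m A)"])
    \<comment> \<open>The sum of all weights is a crude common bound.\<close>
    show "?m w < Suc (sum ?m A)" if "w \<in> A" for w
      using member_le_sum[of w A ?m] that A by (simp add: less_Suc_eq_le)
  qed (use A N in auto)
qed

lemma schubert_expansion_unique:
  assumes "is_schubert_expansion f c" and "is_schubert_expansion f d"
  shows "c = d"
  by (rule indep_family_unique[OF indep_family_schubert]) (use assms in \<open>auto simp: is_schubert_expansion_def\<close>)

subsection \<open>Complementing exponents in a box\<close>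

text \<open>A \<open>qpoly\<close> is also a finite table of rational coefficients indexed by
  compositions. So \<open>lin_ext B\<close> serves both as the linear map with prescribed values on
  monomials and as the combination of the family \<open>B\<close> with coefficients
  \<open>f\<close>.\<close>

definition lin_ext :: "(comp \<Rightarrow> qpoly) \<Rightarrow> qpoly \<Rightarrow> qpoly" where
  "lin_ext B f = (\<Sum>e\<in>Poly_Mapping.keys f. scale (Poly_Mapping.lookup f e) (B e))"

lemma lin_ext_xpow [simp]: "lin_ext B (xpow e) = B e"
  by (simp add: lin_ext_def xpow_def)

lemma qlinear_lin_ext: "qlinear (lin_ext B)"
proof (rule qlinearI)
  fix f g :: qpoly and c :: rat
  let ?A = "Poly_Mapping.keys f \<union> Poly_Mapping.keys g"
  have "lin_ext B (f + g) = (\<Sum>e\<in>?A. scale (Poly_Mapping.lookup (f + g) e) (B e))"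
    unfolding lin_ext_def by (rule sum_keys_superset) (auto dest: subsetD[OF keys_add])
  also have "\<dots> = (\<Sum>e\<in>?A. scale (Poly_Mapping.lookup f e) (B e)) + (\<Sum>e\<in>?A. scale (Poly_Mapping.lookup g e) (B e))"
    by (simp only: lookup_add qp.scale_left_distrib sum.distrib)
  also have "\<dots> = lin_ext B f + lin_ext B g"
    unfolding lin_ext_def by (subst (1 2) sum_keys_superset[of ?A]) simp_all
  finally show "lin_ext B (f + g) = lin_ext B f + lin_ext B g" .
  have "lin_ext B (scale c f) = (\<Sum>e\<in>Poly_Mapping.keys f. scale (Poly_Mapping.lookup (scale c f) e) (B e))"
    unfolding lin_ext_def by (rule sum_keys_superset) (auto simp: in_keys_iff lookup_scale)
  then show "lin_ext B (scale c f) = scale c (lin_ext B f)"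
    by (simp only: lin_ext_def lookup_scale qp.scale_sum_right qp.scale_scale)
qed

definition cbox :: "nat \<Rightarrow> nat \<Rightarrow> comp set" where
  "cbox n m = {e. supp e \<subseteq> {1..n} \<and> (\<forall>i. entry e i \<le> m)}"

abbreviation boxpoly :: "nat \<Rightarrow> nat \<Rightarrow> qpoly set" where
  "boxpoly n m \<equiv> qp.span (xpow ` cbox n m)"

definition reflect :: "nat \<Rightarrow> nat \<Rightarrow> comp \<Rightarrow> comp" where
  "reflect m n e = Poly_Mapping.Abs_poly_mapping (\<lambda>i. if i \<in> {1..n} then m - entry e (n + 1 - i) else 0)"

text \<open>The substitution of \<open>1 / x\<^sub>n\<^sub>+\<^sub>1\<^sub>-\<^sub>i\<close> for \<open>x\<^sub>i\<close> followed by multiplication with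
  \<open>(x\<^sub>1 \<dots> x\<^sub>n)\<^sup>m\<close>. Exponents outside the box are truncated, so this
  is meaningful on \<open>boxpoly n m\<close> only.\<close>

definition reflect_poly :: "nat \<Rightarrow> nat \<Rightarrow> qpoly \<Rightarrow> qpoly" where
  "reflect_poly m n = lin_ext (\<lambda>e. xpow (reflect m n e))"

lemma lookup_reflect: "entry (reflect m n e) i = (if i \<in> {1..n} then m - entry e (n + 1 - i) else 0)"
proof -
  have "finite {i. (if i \<in> {1..n} then m - entry e (n + 1 - i) else 0) \<noteq> 0}"
    by (rule finite_subset[of _ "{1..n}"]) auto
  then show ?thesis unfolding reflect_def by simp
qed

lemma cboxD: "e \<in> cbox n m \<Longrightarrow> entry e i \<le> m" "e \<in> cbox n m \<Longrightarrow> i \<notin> {1..n} \<Longrightarrow> entry e i = 0"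
  by (auto simp: cbox_def in_keys_iff)

lemma cboxI:
  assumes "\<And>i. entry e i \<le> m" and "\<And>i. i \<notin> {1..n} \<Longrightarrow> entry e i = 0"
  shows "e \<in> cbox n m"
proof -
  have "i \<in> {1..n}" if "i \<in> supp e" for i
    using assms(2)[of i] that unfolding in_keys_iff by blast
  then show ?thesis using assms(1) unfolding cbox_def by blast
qed

lemma cbox_mono: "n \<le> n' \<Longrightarrow> m \<le> m' \<Longrightarrow> cbox n m \<subseteq> cbox n' m'"
proof
  fix e assume n: "n \<le> n'" and m: "m \<le> m'" and e: "e \<in> cbox n m"
  show "e \<in> cbox n' m'"
  proof (rule cboxI)
    show "entry e i \<le> m'" for i using cboxD(1)[OF e, of i] m by simp
    show "entry e i = 0" if "i \<notin> {1..n'}" for i using cboxD(2)[OF e, of i] that n by auto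
  qed
qed

lemma cbox_add: "e \<in> cbox n m \<Longrightarrow> e' \<in> cbox n m' \<Longrightarrow> e + e' \<in> cbox n (m + m')"
  by (intro cboxI) (auto simp: lookup_add add_mono cboxD)

lemma zero_in_cbox: "0 \<in> cbox n m"
  by (simp add: cbox_def)

lemma reflect_in_cbox: "reflect m n e \<in> cbox n m"
  by (rule cboxI) (auto simp: lookup_reflect)

lemma reflect_reflect: "e \<in> cbox n m \<Longrightarrow> reflect m n (reflect m n e) = e"
  by (rule poly_mapping_eqI) (auto simp: lookup_reflect cboxD)

text \<open>Bounds add up because truncated subtraction is exact inside the boxes; the bound
  \<open>m1 + m2\<close> of the theorem comes from here.\<close>

lemma reflect_add:
  assumes "e \<in> cbox n m" and "e' \<in> cbox n m'"
  shows "reflect (m + m') n (e + e') = reflect m n e + reflect m' n e'"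
proof (rule poly_mapping_eqI)
  fix k
  show "entry (reflect (m + m') n (e + e')) k = entry (reflect m n e + reflect m' n e') k"
    using cboxD(1)[OF assms(1), of "n + 1 - k"] cboxD(1)[OF assms(2), of "n + 1 - k"]
    by (simp add: lookup_reflect lookup_add)
qed

lemma qlinear_reflect_poly: "qlinear (reflect_poly m n)"
  unfolding reflect_poly_def by (rule qlinear_lin_ext)

lemma reflect_poly_xpow [simp]: "reflect_poly m n (xpow e) = xpow (reflect m n e)"
  by (simp add: reflect_poly_def)

lemma reflect_poly_0 [simp]: "reflect_poly m n 0 = 0"
  by (simp add: reflect_poly_def lin_ext_def)

lemma reflect_poly_diff: "reflect_poly m n (f - g) = reflect_poly m n f - reflect_poly m n g"
  using Vector_Spaces.linear.axioms(3)[OF qlinear_reflect_poly[of m n]]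
  by (rule module_hom.diff)

lemma reflect_poly_sum_scale:
  "reflect_poly m n (\<Sum>a\<in>A. scale (c a) (B a)) = (\<Sum>a\<in>A. scale (c a) (reflect_poly m n (B a)))"
proof -
  interpret Vector_Spaces.linear scale scale "reflect_poly m n" by (rule qlinear_reflect_poly)
  show ?thesis by (simp add: sum scale)
qed

lemma xpow_in_span: "e \<in> E \<Longrightarrow> xpow e \<in> qp.span (xpow ` E)"
  by (intro qp.span_base imageI)

text \<open>Makes reflection injective on the box, so that facts about Schubert polynomials can be
  pulled back.\<close>

lemma reflect_poly_reflect_poly:
  assumes "f \<in> boxpoly n m"
  shows "reflect_poly m n (reflect_poly m n f) = f"
proof (rule qlinear_eq_on_span[OF _ _ assms, of "\<lambda>f. reflect_poly m n (reflect_poly m n f)" "\<lambda>f. f"])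
  show "qlinear (\<lambda>f. f)" by (rule qlinearI) simp_all
qed (auto simp: reflect_reflect qlinear_compose[OF qlinear_reflect_poly qlinear_reflect_poly])

lemma reflect_poly_inject:
  "f \<in> boxpoly n m \<Longrightarrow> g \<in> boxpoly n m \<Longrightarrow> reflect_poly m n f = reflect_poly m n g \<Longrightarrow> f = g"
  by (metis reflect_poly_reflect_poly)

lemma boxpoly_mult: "f \<in> boxpoly n m \<Longrightarrow> g \<in> boxpoly n m' \<Longrightarrow> f * g \<in> boxpoly n (m + m')"
  by (rule mult_in_span) (auto simp flip: xpow_add intro!: xpow_in_span cbox_add)

lemma reflect_poly_mult:
  assumes "f \<in> boxpoly n m" and "g \<in> boxpoly n m'"
  shows "reflect_poly (m + m') n (f * g) = reflect_poly m n f * reflect_poly m' n g"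
proof -
  have *: "reflect_poly (m + m') n (xpow e * f) = xpow (reflect m' n e) * reflect_poly m n f"
    if "e \<in> cbox n m'" for e
  proof (rule qlinear_eq_on_span[OF _ _ assms(1), of "\<lambda>f. reflect_poly (m + m') n (xpow e * f)"
        "\<lambda>f. xpow (reflect m' n e) * reflect_poly m n f"])
    fix a assume "a \<in> xpow ` cbox n m"
    then obtain d where d: "a = xpow d" "d \<in> cbox n m" by blast
    have eq: "xpow e * xpow d = xpow (d + e)" unfolding xpow_add by (rule mult.commute)
    show "reflect_poly (m + m') n (xpow e * a) = xpow (reflect m' n e) * reflect_poly m n a"
      unfolding d(1) eq reflect_poly_xpow reflect_add[OF d(2) that] xpow_add[of "reflect m n d"] by (rule mult.commute)
  qed (intro qlinear_compose[OF qlinear_reflect_poly qlinear_mult] qlinear_compose[OF qlinear_mult qlinear_reflect_poly])+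
  show ?thesis
  proof (rule qlinear_eq_on_span[OF _ _ assms(2), of "\<lambda>g. reflect_poly (m + m') n (f * g)"
        "\<lambda>g. reflect_poly m n f * reflect_poly m' n g"])
    fix a assume "a \<in> xpow ` cbox n m'"
    then obtain e where e: "a = xpow e" "e \<in> cbox n m'" by blast
    show "reflect_poly (m + m') n (f * a) = reflect_poly m n f * reflect_poly m' n a"
      unfolding e mult.commute[of f] *[OF e(2)] reflect_poly_xpow by (rule mult.commute)
  qed (intro qlinear_compose[OF qlinear_reflect_poly qlinear_mult] qlinear_compose[OF qlinear_mult qlinear_reflect_poly])+
qed

lemma swap_comp_in_cbox: "e \<in> cbox n m \<Longrightarrow> 1 \<le> i \<Longrightarrow> i < n \<Longrightarrow> swap_comp i e \<in> cbox n m"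
  by (intro cboxI) (auto simp: lookup_swap_comp cboxD transpose_def)

text \<open>The reversal of positions sends the pair \<open>i\<close>, \<open>Suc i\<close> to the
  pair \<open>Suc (n - i)\<close>, \<open>n - i\<close>.\<close>

lemma reflect_swap_comp:
  assumes "1 \<le> i" and "i < n"
  shows "reflect m n (swap_comp i e) = swap_comp (n - i) (reflect m n e)"
proof (rule poly_mapping_eqI)
  fix k
  consider "k = n - i" | "k = Suc (n - i)" | "k \<noteq> n - i" "k \<noteq> Suc (n - i)" by blast
  then show "entry (reflect m n (swap_comp i e)) k = entry (swap_comp (n - i) (reflect m n e)) k"
  proof cases
    case 1
    then have *: "n + 1 - k = Suc i" "n + 1 - Suc (n - i) = i" "transpose (n - i) (Suc (n - i)) k = Suc (n - i)"
      using assms by auto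
    show ?thesis unfolding lookup_swap_comp lookup_reflect * using 1 assms by auto
  next
    case 2
    then have *: "n + 1 - k = i" "n + 1 - (n - i) = Suc i" "transpose (n - i) (Suc (n - i)) k = n - i"
      using assms by auto
    show ?thesis unfolding lookup_swap_comp lookup_reflect * using 2 assms by auto
  next
    case 3
    then have "k \<in> {1..n} \<longrightarrow> n + 1 - k \<noteq> i \<and> n + 1 - k \<noteq> Suc i" using assms by auto
    then show ?thesis using 3 by (auto simp: lookup_swap_comp lookup_reflect)
  qed
qed

lemma swap_vars_in_boxpoly: "f \<in> boxpoly n m \<Longrightarrow> 1 \<le> i \<Longrightarrow> i < n \<Longrightarrow> swap_vars i f \<in> boxpoly n m"
  by (erule qlinear_in_span[OF qlinear_swap_vars]) (auto simp: swap_vars_xpow intro!: xpow_in_span swap_comp_in_cbox)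

lemma reflect_poly_swap_vars:
  assumes "1 \<le> i" and "i < n"
  shows "reflect_poly m n (swap_vars i f) = swap_vars (n - i) (reflect_poly m n f)"
  by (rule qlinear_eqI[of "\<lambda>f. reflect_poly m n (swap_vars i f)" "\<lambda>f. swap_vars (n - i) (reflect_poly m n f)"])
    (simp_all add: swap_vars_xpow reflect_swap_comp[OF assms] qlinear_compose[OF qlinear_reflect_poly qlinear_swap_vars]
      qlinear_compose[OF qlinear_swap_vars qlinear_reflect_poly])

lemma pihat_xpow_in_box:
  assumes "e \<in> cbox n m" and "1 \<le> i" and "i < n" and "entry e (Suc i) \<le> entry e i"
  shows "pihat i (xpow e) \<in> boxpoly n m"
proof -
  obtain k where k: "entry e i = entry e (Suc i) + k" using assms(4) le_Suc_ex by blast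
  have "entry e (Suc i) + k \<le> m" using cboxD(1)[OF assms(1), of i] k by simp
  then show ?thesis
    unfolding pihat_xpow[OF k refl]
    by (intro qp.span_sum xpow_in_span cboxI) (use assms in \<open>auto simp: lookup_update cboxD\<close>)
qed

text \<open>Antisymmetry of \<open>pihat i\<close> under the swap reduces an ascending pair of
  exponents to a descending one.\<close>

lemma pihat_in_boxpoly:
  assumes "f \<in> boxpoly n m" and "1 \<le> i" and "i < n"
  shows "pihat i f \<in> boxpoly n m"
proof (rule qlinear_in_span[OF qlinear_pihat assms(1)])
  fix a assume "a \<in> xpow ` cbox n m"
  then obtain e where e: "a = xpow e" "e \<in> cbox n m" by blast
  show "pihat i a \<in> boxpoly n m"
  proof (cases "entry e (Suc i) \<le> entry e i")
    case True
    then show ?thesis unfolding e using e(2) assms by (intro pihat_xpow_in_box)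
  next
    case False
    have "xpow e = swap_vars i (xpow (swap_comp i e))" by (simp add: swap_vars_xpow)
    then have "pihat i (xpow e) = - pihat i (xpow (swap_comp i e))" by (simp only: pihat_swap_vars)
    moreover have "pihat i (xpow (swap_comp i e)) \<in> boxpoly n m"
      using False by (intro pihat_xpow_in_box swap_comp_in_cbox e assms) (simp add: lookup_swap_comp)
    ultimately show ?thesis unfolding e by (simp add: qp.span_neg)
  qed
qed

text \<open>The factor \<open>X i * X (Suc i)\<close> over \<open>X i - X (Suc i)\<close> is the
  reciprocal of 1 / \<open>X (Suc i)\<close> - 1 / \<open>X i\<close>, which the substitution sends
  to the difference of the variables at \<open>n - i\<close> and its successor. To stay among
  polynomials, everything is multiplied by x_1 ... x_n, which reflects to 1 with bound 1.\<close>

lemma reflect_poly_pihat: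
  assumes f: "f \<in> boxpoly n m" and i: "1 \<le> i" "i < n"
  shows "reflect_poly m n (pihat i f) = divdiff (n - i) (reflect_poly m n f)"
proof (rule divdiffI[symmetric])
  define j where "j = n - i"
  \<comment> \<open>Here \<open>xpow h\<close> is x_1 ... x_n, while \<open>xpow a\<close> and
    \<open>xpow b\<close> are the same product without \<open>X (Suc i)\<close> and without
    \<open>X i\<close>.\<close>
  define a where "a = reflect 1 n (Poly_Mapping.single j 1)"
  define b where "b = reflect 1 n (Poly_Mapping.single (Suc j) 1)"
  define h where "h = reflect 1 n 0"
  have box: "a \<in> cbox n 1" "b \<in> cbox n 1" "h \<in> cbox n 1"
    by (simp_all add: a_def b_def h_def reflect_in_cbox)
  have "Poly_Mapping.single j 1 \<in> cbox n 1" "Poly_Mapping.single (Suc j) 1 \<in> cbox n 1"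
    using i by (auto intro!: cboxI simp: lookup_single when_def j_def)
  then have refl: "reflect 1 n a = Poly_Mapping.single j 1" "reflect 1 n b = Poly_Mapping.single (Suc j) 1"
    unfolding a_def b_def by (simp_all add: reflect_reflect)
  have hh: "reflect 1 n h = 0" unfolding h_def by (simp add: reflect_reflect zero_in_cbox)
  have "a + Poly_Mapping.single (Suc i) 1 = h" "b + Poly_Mapping.single i 1 = h"
    using i by (auto intro!: poly_mapping_eqI simp: a_def b_def h_def j_def lookup_add lookup_reflect lookup_single when_def)
  then have ab: "xpow a * X (Suc i) = xpow h" "xpow b * X i = xpow h"
    by (simp_all add: X_def flip: xpow_add)
  have "(X i - X (Suc i)) * ((xpow a - xpow b) * pihat i f) = (xpow a - xpow b) * ((X i - X (Suc i)) * pihat i f)"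
    by (rule mult.left_commute)
  also have "\<dots> = ((xpow a * X (Suc i)) * X i - (xpow b * X i) * X (Suc i)) * (f - swap_vars i f)"
    unfolding pihat_eq by (simp add: algebra_simps)
  also have "\<dots> = (X i - X (Suc i)) * (xpow h * (f - swap_vars i f))"
    unfolding ab by (simp add: algebra_simps)
  finally have key: "(xpow a - xpow b) * pihat i f = xpow h * (f - swap_vars i f)"
    by (simp only: divdiff_cancel)
  have "(X j - X (Suc j)) * reflect_poly m n (pihat i f)
      = reflect_poly 1 n (xpow a - xpow b) * reflect_poly m n (pihat i f)"
    by (simp add: reflect_poly_diff refl X_def)
  also have "\<dots> = reflect_poly (1 + m) n ((xpow a - xpow b) * pihat i f)"
    by (intro reflect_poly_mult[symmetric] pihat_in_boxpoly f i qp.span_diff xpow_in_span box)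
  also have "\<dots> = reflect_poly 1 n (xpow h) * reflect_poly m n (f - swap_vars i f)"
    unfolding key by (intro reflect_poly_mult swap_vars_in_boxpoly f i qp.span_diff xpow_in_span box)
  also have "\<dots> = reflect_poly m n f - swap_vars j (reflect_poly m n f)"
    by (simp add: hh reflect_poly_diff reflect_poly_swap_vars[OF i] j_def)
  finally show "(X (n - i) - X (Suc (n - i))) * reflect_poly m n (pihat i f)
      = reflect_poly m n f - swap_vars (n - i) (reflect_poly m n f)"
    unfolding j_def .
qed

subsection \<open>Standardization\<close>

definition snowy_box :: "nat \<Rightarrow> nat \<Rightarrow> comp set" where
  "snowy_box n m = {\<alpha> \<in> cbox n m. snowy \<alpha>}"

lemma snowyD: "snowy \<alpha> \<Longrightarrow> 0 < entry \<alpha> i \<Longrightarrow> j \<noteq> i \<Longrightarrow> entry \<alpha> j \<noteq> entry \<alpha> i"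
  unfolding snowy_def by metis

lemma snowy_box_weak: "\<alpha> \<in> snowy_box n m \<Longrightarrow> weak_composition \<alpha> \<and> snowy \<alpha>"
  by (auto simp: snowy_box_def weak_composition_def cboxD)

lemma snowy_box_mono: "n \<le> n' \<Longrightarrow> m \<le> m' \<Longrightarrow> snowy_box n m \<subseteq> snowy_box n' m'"
  using cbox_mono[of n n' m m'] by (auto simp: snowy_box_def)

lemma finite_range_entry: "finite (range (entry e))"
proof -
  have "range (entry e) \<subseteq> insert 0 (entry e ` supp e)" by (auto simp: in_keys_iff image_iff)
  then show ?thesis by (rule finite_subset) simp
qed

lemma max_entry_le_iff: "max_entry e \<le> m \<longleftrightarrow> (\<forall>i. entry e i \<le> m)"
  unfolding max_entry_def by (simp add: finite_range_entry)

lemma weak_snowy_in_box: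
  assumes "weak_composition \<alpha>" and "snowy \<alpha>"
  shows "\<exists>N. \<alpha> \<in> snowy_box N N"
proof -
  obtain N where "\<forall>i\<in>supp \<alpha>. i \<le> N" using finite_nat_set_iff_bounded_le[of "supp \<alpha>"] by auto
  moreover have "0 \<notin> supp \<alpha>" using assms(1) by (simp add: in_keys_iff weak_composition_def)
  ultimately have "supp \<alpha> \<subseteq> {1..N}" by (metis One_nat_def Suc_leI atLeastAtMost_iff bot_nat_0.not_eq_extremum subsetI)
  then have "\<alpha> \<in> cbox N (max_entry \<alpha>)" using max_entry_le_iff[of \<alpha> "max_entry \<alpha>"] by (simp add: cbox_def)
  then have "\<alpha> \<in> cbox (max N (max_entry \<alpha>)) (max N (max_entry \<alpha>))"
    using cbox_mono[of N "max N (max_entry \<alpha>)" "max_entry \<alpha>" "max N (max_entry \<alpha>)"] by auto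
  then show ?thesis using assms(2) by (auto simp: snowy_box_def)
qed

text \<open>The values that \<open>is_std\<close> demands on \<open>{1..n}\<close>, with its
  conditions on \<open>std_beta\<close> read off from \<open>\<alpha>\<close>: the value
  \<open>m + 1\<close> occurs exactly at zero entries.\<close>

definition std_value :: "nat \<Rightarrow> nat \<Rightarrow> comp \<Rightarrow> nat \<Rightarrow> nat" where
  "std_value m n \<alpha> i = (if entry \<alpha> (n + 1 - i) = 0 then m + card {j \<in> {1..i}. entry \<alpha> (n + 1 - j) = 0}
    else m + 1 - entry \<alpha> (n + 1 - i))"

lemma is_std_iff:
  "is_std m n \<alpha> w \<longleftrightarrow> fin_perm w \<and> (\<forall>i>n. w i < w (Suc i)) \<and> (\<forall>i\<in>{1..n}. w i = std_value m n \<alpha> i)"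
proof -
  have 1: "std_beta m n \<alpha> i = m + 1 \<longleftrightarrow> entry \<alpha> (n + 1 - i) = 0" for i
    by (auto simp: std_beta_def)
  have 2: "std_beta m n \<alpha> i \<le> m \<longleftrightarrow> entry \<alpha> (n + 1 - i) \<noteq> 0" for i
    by (auto simp: std_beta_def)
  show ?thesis unfolding is_std_def 1 2 std_value_def by (auto simp: std_beta_def)
qed

lemma std_value_zero: "entry \<alpha> (n + 1 - i) = 0 \<Longrightarrow> 1 \<le> i \<Longrightarrow> m < std_value m n \<alpha> i"
proof -
  assume "entry \<alpha> (n + 1 - i) = 0" "1 \<le> i"
  then have "{j \<in> {1..i}. entry \<alpha> (n + 1 - j) = 0} \<noteq> {}" by force
  then show ?thesis using \<open>entry \<alpha> (n + 1 - i) = 0\<close> by (simp add: std_value_def card_gt_0_iff)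
qed

lemma std_value_zero_less:
  assumes "entry \<alpha> (n + 1 - i) = 0" and "entry \<alpha> (n + 1 - k) = 0" and "1 \<le> i" and "i < k"
  shows "std_value m n \<alpha> i < std_value m n \<alpha> k"
proof -
  let ?Z = "\<lambda>k. {j \<in> {1..k}. entry \<alpha> (n + 1 - j) = 0}"
  have "k \<in> ?Z k" "k \<notin> ?Z i" using assms by auto
  moreover have "?Z i \<subseteq> ?Z k" using assms(4) by auto
  ultimately have "?Z i \<subset> ?Z k" by blast
  then have "card (?Z i) < card (?Z k)" by (intro psubset_card_mono) auto
  then show ?thesis unfolding std_value_def using assms(1,2) by simp
qed

lemma std_value_less:
  assumes "\<alpha> \<in> snowy_box n m" and "1 \<le> i" and "i \<le> n" and "1 \<le> k" and "k \<le> n"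
  shows "entry \<alpha> (n + 1 - i) > entry \<alpha> (n + 1 - k) \<Longrightarrow> std_value m n \<alpha> i < std_value m n \<alpha> k"
proof -
  assume less: "entry \<alpha> (n + 1 - i) > entry \<alpha> (n + 1 - k)"
  have le: "entry \<alpha> (n + 1 - i) \<le> m" using assms by (auto simp: snowy_box_def cboxD)
  show "std_value m n \<alpha> i < std_value m n \<alpha> k"
  proof (cases "entry \<alpha> (n + 1 - k) = 0")
    case True
    then show ?thesis using std_value_zero[OF True assms(4), of m] less le by (simp add: std_value_def)
  next
    case False
    then show ?thesis using less le by (simp add: std_value_def)
  qed
qed

text \<open>Positive entries are distinct because \<open>\<alpha>\<close> is snowy; repeated zeros
  are separated by their running count.\<close>

lemma std_value_inj:
  assumes "\<alpha> \<in> snowy_box n m"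
  shows "inj_on (std_value m n \<alpha>) {1..n}"
proof (rule linorder_inj_onI)
  fix i k assume ik: "i < k" "i \<in> {1..n}" "k \<in> {1..n}"
  show "std_value m n \<alpha> i \<noteq> std_value m n \<alpha> k"
  proof (cases "entry \<alpha> (n + 1 - i) = entry \<alpha> (n + 1 - k)")
    case True
    have "n + 1 - i \<noteq> n + 1 - k" using ik by auto
    moreover have "snowy \<alpha>" using assms by (simp add: snowy_box_def)
    ultimately have "entry \<alpha> (n + 1 - i) = 0" "entry \<alpha> (n + 1 - k) = 0"
      using True unfolding snowy_def by (metis neq0_conv)+
    then show ?thesis using std_value_zero_less[of \<alpha> n i k m] ik by simp
  next
    case False
    then show ?thesis
      using std_value_less[OF assms, of i k] std_value_less[OF assms, of k i] ik
      by (cases "entry \<alpha> (n + 1 - i) < entry \<alpha> (n + 1 - k)") auto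
  qed
qed auto

lemma std_value_range:
  assumes "\<alpha> \<in> snowy_box n m" and "i \<in> {1..n}"
  shows "std_value m n \<alpha> i \<in> {1..n + m}"
proof -
  have "entry \<alpha> (n + 1 - i) \<le> m" using assms by (auto simp: snowy_box_def cboxD)
  moreover have "card {j \<in> {1..i}. entry \<alpha> (n + 1 - j) = 0} \<le> card {1..i}" by (intro card_mono) auto
  moreover have "entry \<alpha> (n + 1 - i) = 0 \<Longrightarrow> m < std_value m n \<alpha> i" using std_value_zero assms by simp
  ultimately show ?thesis using assms(2) by (auto simp: std_value_def)
qed

text \<open>The \<open>m\<close> values of \<open>{1..n + m}\<close> missed by \<open>f\<close> are
  listed increasingly on the positions \<open>n + 1\<close> to \<open>n + m\<close>, and everything
  beyond is fixed.\<close>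

lemma ascending_completion_exists:
  fixes f :: "nat \<Rightarrow> nat"
  assumes "inj_on f {1..n}" and "f ` {1..n} \<subseteq> {1..n + m}"
  shows "\<exists>w. fin_perm w \<and> (\<forall>i>n. w i < w (Suc i)) \<and> (\<forall>i\<in>{1..n}. w i = f i)"
proof -
  define R where "R = {1..n + m} - f ` {1..n}"
  define xs where "xs = sorted_list_of_set R"
  have R: "finite R" "set xs = R" "length xs = m" "sorted_wrt (<) xs"
    using assms by (auto simp: R_def xs_def card_Diff_subset card_image)
  define w where "w i = (if i \<in> {1..n} then f i else if i \<in> {n+1..n+m} then xs ! (i - n - 1) else i)" for i
  have "w ` {1..n} = f ` {1..n}" by (auto simp: w_def)
  moreover have "w ` {n+1..n+m} = R"
  proof -
    have "w ` {n+1..n+m} = (\<lambda>k. w (k + (n + 1))) ` {..<m}"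
    proof -
      have "{n+1..n+m} = (\<lambda>k. k + (n + 1)) ` {..<m}"
      proof (rule set_eqI, rule iffI)
        fix x assume "x \<in> {n+1..n+m}"
        then show "x \<in> (\<lambda>k. k + (n + 1)) ` {..<m}" by (intro image_eqI[of _ _ "x - (n + 1)"]) auto
      qed auto
      then show ?thesis by (simp only: image_image)
    qed
    also have "\<dots> = (\<lambda>k. xs ! k) ` {..<m}"
      by (intro image_cong) (auto simp: w_def)
    also have "\<dots> = R" using R(2,3) by (auto simp: set_conv_nth)
    finally show ?thesis .
  qed
  moreover have "{1..n + m} = {1..n} \<union> {n+1..n+m}" by auto
  ultimately have im: "w ` {1..n+m} = {1..n+m}"
    using assms(2) unfolding R_def by (simp only: image_Un) blast
  then have "bij_betw w {1..n+m} {1..n+m}"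
    unfolding bij_betw_def by (auto intro: eq_card_imp_inj_on)
  then have perm: "w permutes {1..n+m}"
    by (rule bij_imp_permutes) (auto simp: w_def)
  have "w i < w (Suc i)" if "n < i" for i
  proof (cases "i < n + m")
    case True
    have "i - n - 1 < Suc i - n - 1" "Suc i - n - 1 < length xs" using that True R(3) by auto
    then have "xs ! (i - n - 1) < xs ! (Suc i - n - 1)" by (rule sorted_wrt_nth_less[OF R(4)])
    then show ?thesis using that True by (auto simp: w_def)
  next
    case False
    \<comment> \<open>At the border \<open>i = n + m\<close> the value is at most
      \<open>n + m\<close>, and the next position is already fixed.\<close>
    have "w i \<le> i" using False that permutes_in_image[OF perm, of i] by (cases "i = n + m") (auto simp: w_def)
    then show ?thesis using False by (auto simp: w_def)
  qed
  moreover have "\<forall>i\<in>{1..n}. w i = f i" by (simp add: w_def)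
  ultimately show ?thesis using perm fin_perm_iff by blast
qed

lemma fin_perm_0: "fin_perm w \<Longrightarrow> w 0 = 0"
  using permutes_not_in[of w "{1..}" 0] by (simp add: fin_perm_def)

lemma ascending_less:
  fixes u :: "nat \<Rightarrow> nat"
  assumes "\<forall>i>n. u i < u (Suc i)" and "n < i" and "i < k"
  shows "u i < u k"
  using assms(3)
proof (induction k)
  case (Suc k)
  have "u k < u (Suc k)" using assms(1,2) Suc.prems by auto
  then show ?case using Suc by (cases "i = k") auto
qed simp

text \<open>At a first difference beyond \<open>n\<close> the smaller of the two values must also
  occur in the other permutation: an earlier occurrence breaks injectivity, a later one breaks the
  ascent.\<close>

lemma ascending_completion_unique:
  assumes "fin_perm v" and "\<forall>i>n. v i < v (Suc i)" and "fin_perm w" and "\<forall>i>n. w i < w (Suc i)"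
    and "\<forall>i\<in>{1..n}. v i = w i"
  shows "v = w"
proof
  fix i
  have le: "\<not> v i < w i"
    if eq: "\<And>k. k < i \<Longrightarrow> v k = w k" and "n < i" and v: "fin_perm v" and w: "fin_perm w" "\<forall>i>n. w i < w (Suc i)"
    for v w :: "nat \<Rightarrow> nat" and i
  proof
    assume less: "v i < w i"
    have "surj w" using w(1) permutes_surj[of w "{1..}"] by (simp add: fin_perm_def)
    then obtain k where k: "v i = w k" by (metis surjD)
    consider "k < i" | "k = i" | "i < k" by linarith
    then show False
    proof cases
      case 1
      then have "v k = v i" using eq k by simp
      then show False using injD[OF fin_perm_inj[OF v]] 1 by blast
    next
      case 3
      then show False using ascending_less[OF w(2) \<open>n < i\<close> 3] less k by simp
    qed (use k less in simp)
  qed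
  show "v i = w i"
  proof (induction i rule: less_induct)
    case (less i)
    consider "i = 0" | "i \<in> {1..n}" | "n < i" by force
    then show ?case
    proof cases
      case 1
      then show ?thesis
        using assms(1,3) by (simp add: fin_perm_0)
    next
      case 2
      then show ?thesis using assms(5) by blast
    next
      case 3
      then show ?thesis
        using le[of i v w] le[of i w v] less assms by (metis linorder_neqE_nat)
    qed
  qed
qed

lemma is_std_std: "\<alpha> \<in> snowy_box n m \<Longrightarrow> is_std m n \<alpha> (std m n \<alpha>)"
proof -
  assume a: "\<alpha> \<in> snowy_box n m"
  have "std_value m n \<alpha> ` {1..n} \<subseteq> {1..n + m}" using std_value_range[OF a] by blast
  from ascending_completion_exists[OF std_value_inj[OF a] this]
  obtain w where w: "fin_perm w" "\<forall>i>n. w i < w (Suc i)" "\<forall>i\<in>{1..n}. w i = std_value m n \<alpha> i" by blast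
  have "\<exists>!w. is_std m n \<alpha> w"
    unfolding is_std_iff
  proof (rule ex1I[of _ w])
    fix v assume v: "fin_perm v \<and> (\<forall>i>n. v i < v (Suc i)) \<and> (\<forall>i\<in>{1..n}. v i = std_value m n \<alpha> i)"
    show "v = w" by (rule ascending_completion_unique[of _ n]) (use v w in auto)
  qed (use w in blast)
  then show ?thesis unfolding std_def by (rule theI')
qed

lemma std_eqI: "is_std m n \<alpha> w \<Longrightarrow> std m n \<alpha> = w"
  unfolding std_def
  by (rule the_equality) (auto simp: is_std_iff intro: ascending_completion_unique[of _ n])

lemma std_props:
  assumes "\<alpha> \<in> snowy_box n m"
  shows "fin_perm (std m n \<alpha>)" and "n < i \<Longrightarrow> std m n \<alpha> i < std m n \<alpha> (Suc i)"
    and "i \<in> {1..n} \<Longrightarrow> std m n \<alpha> i = std_value m n \<alpha> i"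
  using is_std_std[OF assms] unfolding is_std_iff by auto

lemma std_value_small: "\<alpha> \<in> snowy_box n m \<Longrightarrow> 0 < entry \<alpha> i \<Longrightarrow>
    i \<in> {1..n} \<and> std m n \<alpha> (n + 1 - i) = m + 1 - entry \<alpha> i \<and> std m n \<alpha> (n + 1 - i) \<le> m"
proof -
  assume a: "\<alpha> \<in> snowy_box n m" "0 < entry \<alpha> i"
  then have i: "i \<in> {1..n}" by (metis cboxD(2) mem_Collect_eq less_irrefl snowy_box_def)
  then have "n + 1 - i \<in> {1..n}" "n + 1 - (n + 1 - i) = i" by auto
  then show ?thesis using a i std_props(3)[OF a(1), of "n + 1 - i"] by (auto simp: std_value_def)
qed

text \<open>Among the first \<open>n\<close> values, those at most \<open>m\<close> mark the
  positive entries, and \<open>m + 1\<close> minus the value is the entry.\<close>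

lemma std_inj: "inj_on (std m n) (snowy_box n m)"
proof (rule inj_onI)
  have le: "entry \<alpha> i \<le> entry \<gamma> i"
    if a: "\<alpha> \<in> snowy_box n m" and g: "\<gamma> \<in> snowy_box n m" and eq: "std m n \<alpha> = std m n \<gamma>" for \<alpha> \<gamma> i
  proof (cases "entry \<alpha> i = 0")
    case False
    then have i: "i \<in> {1..n}" "std m n \<alpha> (n + 1 - i) = m + 1 - entry \<alpha> i" "std m n \<alpha> (n + 1 - i) \<le> m"
      using std_value_small[OF a] by auto
    have "n + 1 - i \<in> {1..n}" "n + 1 - (n + 1 - i) = i" using i by auto
    then have "0 < entry \<gamma> i"
      using i(3) std_props(3)[OF g, of "n + 1 - i"] std_value_zero[of \<gamma> n "n + 1 - i" m] unfolding eq by auto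
    then have "m + 1 - entry \<alpha> i = m + 1 - entry \<gamma> i" using std_value_small[OF g] i eq by auto
    moreover have "entry \<alpha> i \<le> m" "entry \<gamma> i \<le> m" using a g by (auto simp: snowy_box_def cboxD)
    ultimately show ?thesis by simp
  qed simp
  fix \<alpha> \<gamma> assume "\<alpha> \<in> snowy_box n m" "\<gamma> \<in> snowy_box n m" "std m n \<alpha> = std m n \<gamma>"
  then show "\<alpha> = \<gamma>" by (intro poly_mapping_eqI order_antisym le) auto
qed

lemma swap_comp_in_snowy_box:
  assumes "\<alpha> \<in> snowy_box n m" and "1 \<le> i" and "i < n"
  shows "swap_comp i \<alpha> \<in> snowy_box n m"
proof -
  have "snowy \<alpha>" using assms(1) by (simp add: snowy_box_def)
  then have "snowy (swap_comp i \<alpha>)"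
    unfolding snowy_def lookup_swap_comp by (metis transpose_eq_iff)
  then show ?thesis using assms by (simp add: snowy_box_def swap_comp_in_cbox)
qed

text \<open>For comparing running counts of zeros before and after a swap: only the exchanged pair
  itself can change its relative order.\<close>

lemma transpose_interval_iff:
  "\<not> (j = p \<and> k = Suc p) \<Longrightarrow> \<not> (j = Suc p \<and> k = p) \<Longrightarrow> 1 \<le> p \<Longrightarrow>
    j \<in> {1..k} \<longleftrightarrow> transpose p (Suc p) j \<in> {1..transpose p (Suc p) k}"
  by (auto simp: transpose_def)

text \<open>Since the two entries differ, at most one of them is zero, so the zeros keep their
  relative order and their running counts. The exchanged positions are at most \<open>n\<close>, so
  the ascending tail is untouched.\<close>

lemma std_swap_comp:
  assumes a: "\<alpha> \<in> snowy_box n m" and i: "1 \<le> i" "i < n" and ne: "entry \<alpha> i \<noteq> entry \<alpha> (Suc i)"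
  shows "std m n (swap_comp i \<alpha>) = std m n \<alpha> \<circ> transpose (n - i) (Suc (n - i))"
proof (rule std_eqI, unfold is_std_iff, intro conjI ballI allI impI)
  let ?p = "n - i"
  let ?t = "transpose ?p (Suc ?p)"
  show "fin_perm (std m n \<alpha> \<circ> ?t)"
    using std_props(1)[OF a] i by (intro fin_perm_swap) auto
  show "(std m n \<alpha> \<circ> ?t) k < (std m n \<alpha> \<circ> ?t) (Suc k)" if "n < k" for k
    using that i std_props(2)[OF a that] by simp
  have pi: "n + 1 - ?p = Suc i" "n + 1 - Suc ?p = i" using i by auto
  have e: "entry (swap_comp i \<alpha>) (n + 1 - k) = entry \<alpha> (n + 1 - ?t k)" if "k \<in> {1..n}" for k
  proof -
    have "transpose i (Suc i) (n + 1 - k) = n + 1 - ?t k"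
      using that i pi unfolding transpose_def by auto
    then show ?thesis by (simp add: lookup_swap_comp)
  qed
  fix k assume k: "k \<in> {1..n}"
  have tk: "?t k \<in> {1..n}" using k i by (auto simp: transpose_def)
  have "card {j \<in> {1..k}. entry (swap_comp i \<alpha>) (n + 1 - j) = 0} = card {j \<in> {1..?t k}. entry \<alpha> (n + 1 - j) = 0}"
    if z: "entry \<alpha> (n + 1 - ?t k) = 0"
  proof -
    have "{j \<in> {1..k}. entry (swap_comp i \<alpha>) (n + 1 - j) = 0} = {j \<in> {1..k}. entry \<alpha> (n + 1 - ?t j) = 0}"
      using e k by auto
    also have "\<dots> = ?t ` {j \<in> {1..?t k}. entry \<alpha> (n + 1 - j) = 0}"
    proof (rule set_eqI)
      fix j
      have "j \<in> {1..k} \<longleftrightarrow> ?t j \<in> {1..?t k}" if zj: "entry \<alpha> (n + 1 - ?t j) = 0"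
      proof (rule transpose_interval_iff)
        show "\<not> (j = ?p \<and> k = Suc ?p)" "\<not> (j = Suc ?p \<and> k = ?p)"
          using z zj ne by (auto simp only: transpose_apply_first transpose_apply_second pi)
      qed (use i in simp)
      then show "j \<in> {j \<in> {1..k}. entry \<alpha> (n + 1 - ?t j) = 0} \<longleftrightarrow> j \<in> ?t ` {j \<in> {1..?t k}. entry \<alpha> (n + 1 - j) = 0}"
        by (auto simp: image_iff intro!: exI[of _ "?t j"])
    qed
    finally show ?thesis by (simp only: card_image[OF inj_on_subset[OF inj_transpose subset_UNIV]])
  qed
  then show "(std m n \<alpha> \<circ> ?t) k = std_value m n (swap_comp i \<alpha>) k"
    using std_props(3)[OF a tk] unfolding std_value_def e[OF k] by simp
qed

text \<open>A weak ascent suffices: equal neighbours in a snowy composition are both zero, and zeros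
  receive increasing values.\<close>

lemma std_ascent:
  assumes a: "\<alpha> \<in> snowy_box n m" and i: "1 \<le> i" "i < n" and le: "entry \<alpha> i \<le> entry \<alpha> (Suc i)"
  shows "std m n \<alpha> (n - i) < std m n \<alpha> (Suc (n - i))"
proof -
  have pi: "n + 1 - (n - i) = Suc i" "n + 1 - Suc (n - i) = i" using i by auto
  have mem: "n - i \<in> {1..n}" "Suc (n - i) \<in> {1..n}" using i by auto
  show ?thesis
  proof (cases "entry \<alpha> i = entry \<alpha> (Suc i)")
    case True
    moreover have "snowy \<alpha>" using a by (simp add: snowy_box_def)
    ultimately have "entry \<alpha> i = 0" "entry \<alpha> (Suc i) = 0"
      unfolding snowy_def by (metis neq0_conv n_not_Suc_n)+
    then show ?thesis
      unfolding std_props(3)[OF a mem(1)] std_props(3)[OF a mem(2)]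
      using mem(1) by (intro std_value_zero_less) (simp_all only: pi lessI atLeastAtMost_iff)
  next
    case False
    then show ?thesis
      unfolding std_props(3)[OF a mem(1)] std_props(3)[OF a mem(2)]
      using mem le by (intro std_value_less[OF a]) (simp_all add: pi del: One_nat_def)
  qed
qed

text \<open>Counts the smaller values not yet used before \<open>i\<close>; only the values up to
  position \<open>i\<close> enter, and these are explicit for \<open>std\<close>.\<close>

lemma invcode_image:
  assumes "fin_perm w" and "1 \<le> i"
  shows "entry (invcode w) i = card ({1..<w i} - w ` {1..<i})"
proof -
  have w: "w permutes {1..}" using assms by (simp add: fin_perm_def)
  have "w ` {j. i < j \<and> w j < w i} = {1..<w i} - w ` {1..<i}"
  proof (rule set_eqI, rule iffI)
    fix x assume "x \<in> w ` {j. i < j \<and> w j < w i}"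
    then obtain j where j: "x = w j" "i < j" "w j < w i" by blast
    then have "1 \<le> w j" using permutes_in_image[OF w, of j] by auto
    moreover have "w j \<notin> w ` {1..<i}" using injD[OF permutes_inj[OF w], of j] j(2) by auto
    ultimately show "x \<in> {1..<w i} - w ` {1..<i}" using j by auto
  next
    fix x assume x: "x \<in> {1..<w i} - w ` {1..<i}"
    obtain j where j: "x = w j" using permutes_surj[OF w] by (metis surjD)
    then have "j \<in> {1..}" using x permutes_in_image[OF w, of j] by auto
    moreover have "j \<notin> {1..<i}" "j \<noteq> i" using x j by auto
    ultimately have "i < j" by auto
    then show "x \<in> w ` {j. i < j \<and> w j < w i}" using x j by auto
  qed
  then show ?thesis
    using card_image[OF inj_on_subset[OF permutes_inj[OF w] subset_UNIV], of "{j. i < j \<and> w j < w i}"]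
    by (simp add: lookup_invcode[OF assms(1)])
qed

lemma partition_antimono:
  assumes "is_partition \<alpha>" and "1 \<le> i" and "i \<le> k"
  shows "entry \<alpha> k \<le> entry \<alpha> i"
  using assms(3)
proof (induction k rule: dec_induct)
  case (step k)
  then show ?case using assms(1,2) unfolding is_partition_def by (meson le_trans)
qed simp

lemma invcode_std_partition:
  assumes a: "\<alpha> \<in> snowy_box n m" and p: "is_partition \<alpha>"
  shows "invcode (std m n \<alpha>) = reflect m n \<alpha>"
proof (rule poly_mapping_eqI)
  let ?w = "std m n \<alpha>"
  note fp = std_props(1)[OF a]
  have "snowy \<alpha>" using a by (simp add: snowy_box_def)
  fix i
  consider "i = 0" | "n < i" | "i \<in> {1..n}" "entry \<alpha> (n + 1 - i) = 0" | "i \<in> {1..n}" "entry \<alpha> (n + 1 - i) > 0"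
    by fastforce
  then show "entry (invcode ?w) i = entry (reflect m n \<alpha>) i"
  proof cases
    case 1
    then show ?thesis by (simp add: lookup_invcode[OF fp] lookup_reflect fin_perm_0[OF fp])
  next
    case 2
    have "?w i < ?w j" if "i < j" for j
      using that 2 std_props(2)[OF a] by (intro ascending_less[of n "std m n \<alpha>" i j] allI impI)
    then have "{j. i < j \<and> ?w j < ?w i} = {}" using less_asym by blast
    moreover have "entry (reflect m n \<alpha>) i = 0" using 2 by (simp add: lookup_reflect)
    ultimately show ?thesis by (simp only: lookup_invcode[OF fp] card.empty)
  next
    case 3
    have w: "?w j = m + j" if j: "1 \<le> j" "j \<le> i" for j
    proof -
      have z: "entry \<alpha> (n + 1 - k) = 0" if "1 \<le> k" "k \<le> i" for k
        using partition_antimono[OF p, of "n + 1 - i" "n + 1 - k"] 3 that by auto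
      then have "{k \<in> {1..j}. entry \<alpha> (n + 1 - k) = 0} = {1..j}" using j by auto
      then show ?thesis using std_props(3)[OF a, of j] 3 z[OF j] j by (simp add: std_value_def)
    qed
    have "?w ` {1..<i} = (\<lambda>j. m + j) ` {1..<i}" by (intro image_cong refl w) auto
    then have "?w ` {1..<i} = {1 + m..<i + m}" by (simp only: image_add_atLeastLessThan)
    moreover have "?w i = m + i" using 3 by (intro w) auto
    moreover have "{1..<m + i} - {1 + m..<i + m} = {1..m}" using 3(1) by auto
    ultimately have "{1..<?w i} - ?w ` {1..<i} = {1..m}" by (simp only:)
    then show ?thesis using 3 by (simp add: invcode_image[OF fp] lookup_reflect)
  next
    case 4
    have w: "?w i = m + 1 - entry \<alpha> (n + 1 - i)" using std_props(3)[OF a 4(1)] 4 by (simp add: std_value_def)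
    have "?w i < ?w j" if "j \<in> {1..<i}" for j
    proof -
      have "n + 1 - j \<noteq> n + 1 - i" "n + 1 - i \<le> n + 1 - j" "1 \<le> n + 1 - i" using that 4 by auto
      then have "entry \<alpha> (n + 1 - j) < entry \<alpha> (n + 1 - i)"
        using partition_antimono[OF p, of "n + 1 - i" "n + 1 - j"] snowyD[OF \<open>snowy \<alpha>\<close> 4(2), of "n + 1 - j"]
        by (simp only: order_le_less) blast
      moreover have "1 \<le> i" "i \<le> n" "1 \<le> j" "j \<le> n" using that 4 by auto
      ultimately show ?thesis
        using std_value_less[OF a, of i j] std_props(3)[OF a, of i] std_props(3)[OF a, of j]
        by (simp only: atLeastAtMost_iff simp_thms)
    qed
    then have "x \<notin> {1..<?w i}" if "x \<in> ?w ` {1..<i}" for x using that by fastforce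
    then have "{1..<?w i} - ?w ` {1..<i} = {1..<?w i}" by blast
    then show ?thesis using 4 w by (simp add: invcode_image[OF fp] lookup_reflect)
  qed
qed

lemma is_partition_reflect:
  assumes "is_partition \<alpha>"
  shows "is_partition (reflect m n \<alpha>)"
  unfolding is_partition_def
proof (intro allI impI)
  fix i :: nat assume "1 \<le> i"
  show "entry (reflect m n \<alpha>) (Suc i) \<le> entry (reflect m n \<alpha>) i"
  proof (cases "i < n")
    case True
    then have "entry \<alpha> (n + 1 - i) \<le> entry \<alpha> (n + 1 - Suc i)"
      by (intro partition_antimono[OF assms]) auto
    then show ?thesis using True \<open>1 \<le> i\<close> by (simp add: lookup_reflect)
  qed (simp add: lookup_reflect)
qed

subsection \<open>Top Lascoux polynomials\<close>

text \<open>Both relations have the same shape, so a derivation is translated clause by clause: the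
  partition clause becomes the dominant one, and an exchange at \<open>i\<close> becomes one at
  \<open>n - i\<close>.\<close>

lemma top_lascoux_rel_schubert_rel:
  assumes "top_lascoux_rel \<alpha> f" and "\<alpha> \<in> snowy_box n m"
  shows "f \<in> boxpoly n m \<and> schubert_rel (std m n \<alpha>) (reflect_poly m n f)"
  using assms
proof (induction rule: top_lascoux_rel.induct)
  case (partition \<alpha>)
  have "is_partition (invcode (std m n \<alpha>))"
    using partition by (simp add: invcode_std_partition is_partition_reflect)
  then have "schubert_rel (std m n \<alpha>) (xpow (invcode (std m n \<alpha>)))"
    using std_props(1) partition by (intro schubert_rel.dominant)
  then show ?case
    using partition by (auto simp: invcode_std_partition snowy_box_def intro!: xpow_in_span)
next
  case (ascent \<alpha> i f)
  \<comment> \<open>The entry at \<open>Suc i\<close> is positive, so \<open>Suc i\<close> lies in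
    the support, and \<open>n - i\<close> is a legitimate index.\<close>
  have "Suc i \<le> n" using std_value_small[OF ascent.prems, of "Suc i"] ascent.hyps by auto
  then have i: "1 \<le> i" "i < n" using ascent.hyps by auto
  have IH: "f \<in> boxpoly n m" "schubert_rel (std m n (swap_comp i \<alpha>)) (reflect_poly m n f)"
    using ascent.IH swap_comp_in_snowy_box[OF ascent.prems i] by auto
  have "schubert_rel (std m n \<alpha>) (divdiff (n - i) (reflect_poly m n f))"
  proof (rule schubert_rel.ascent)
    show "schubert_rel (std m n \<alpha> \<circ> transpose (n - i) (Suc (n - i))) (reflect_poly m n f)"
      using IH(2) std_swap_comp[OF ascent.prems i] ascent.hyps by simp
    show "std m n \<alpha> (n - i) < std m n \<alpha> (Suc (n - i))"
      using ascent.hyps by (intro std_ascent[OF ascent.prems i]) auto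
  qed (use i std_props(1)[OF ascent.prems] in auto)
  then show ?case using IH(1) i by (simp add: reflect_poly_pihat pihat_in_boxpoly)
qed

lemma top_lascoux_rel_exists:
  assumes "\<alpha> \<in> snowy_box n m"
  shows "\<exists>f. top_lascoux_rel \<alpha> f"
  using assms
proof (induction "\<Sum>j=1..n. j * entry \<alpha> j" arbitrary: \<alpha> rule: less_induct)
  case less
  note ws = conjunct1[OF snowy_box_weak[OF less.prems]] conjunct2[OF snowy_box_weak[OF less.prems]]
  show ?case
  proof (cases "\<exists>i. 1 \<le> i \<and> i < n \<and> entry \<alpha> i < entry \<alpha> (Suc i)")
    case True
    then obtain i where i: "1 \<le> i" "i < n" "entry \<alpha> i < entry \<alpha> (Suc i)" by blast
    have "entry (swap_comp i \<alpha>) = entry \<alpha> \<circ> transpose i (Suc i)" by (simp add: fun_eq_iff lookup_swap_comp)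
    then have "(\<Sum>j=1..n. j * entry (swap_comp i \<alpha>) j) < (\<Sum>j=1..n. j * entry \<alpha> j)"
      using swap_weight_less(1)[OF i] by simp
    then obtain f where "top_lascoux_rel (swap_comp i \<alpha>) f"
      using less.hyps swap_comp_in_snowy_box[OF less.prems i(1,2)] by blast
    then show ?thesis using top_lascoux_rel.ascent[OF ws i(1,3)] by blast
  next
    case False
    have "entry \<alpha> (Suc i) \<le> entry \<alpha> i" if "1 \<le> i" for i
    proof (cases "i < n")
      case True
      then show ?thesis using False that by (meson not_less)
    next
      case False
      then have "entry \<alpha> (Suc i) = 0" using less.prems by (intro cboxD(2)) (auto simp: snowy_box_def)
      then show ?thesis by simp
    qed
    then have "is_partition \<alpha>" by (simp add: is_partition_def)
    then show ?thesis using top_lascoux_rel.partition[OF ws] by blast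
  qed
qed

text \<open>Both derivations reflect to derivations for the same permutation, and reflection is
  injective on a box large enough for \<open>\<alpha>\<close>.\<close>

lemma top_lascoux_rel_unique:
  assumes "top_lascoux_rel \<alpha> f" and "top_lascoux_rel \<alpha> g"
  shows "f = g"
proof -
  have "weak_composition \<alpha>" "snowy \<alpha>" using assms(1) by (auto elim: top_lascoux_rel.cases)
  then obtain N where N: "\<alpha> \<in> snowy_box N N" using weak_snowy_in_box by blast
  show ?thesis
    using top_lascoux_rel_schubert_rel[OF assms(1) N] top_lascoux_rel_schubert_rel[OF assms(2) N]
      schubert_rel_unique reflect_poly_inject by blast
qed

lemma top_lascoux_eqI: "top_lascoux_rel \<alpha> f \<Longrightarrow> top_lascoux \<alpha> = f"
  unfolding top_lascoux_def using top_lascoux_rel_unique by blast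

lemma top_lascoux_rel_top_lascoux: "weak_composition \<alpha> \<Longrightarrow> snowy \<alpha> \<Longrightarrow> top_lascoux_rel \<alpha> (top_lascoux \<alpha>)"
  using weak_snowy_in_box top_lascoux_rel_exists top_lascoux_eqI by metis

lemma top_lascoux_in_boxpoly: "\<alpha> \<in> snowy_box n m \<Longrightarrow> top_lascoux \<alpha> \<in> boxpoly n m"
  and reflect_poly_top_lascoux: "\<alpha> \<in> snowy_box n m \<Longrightarrow> reflect_poly m n (top_lascoux \<alpha>) = schubert (std m n \<alpha>)"
  using top_lascoux_rel_schubert_rel[OF top_lascoux_rel_top_lascoux] snowy_box_weak schubert_eqI by metis+

text \<open>A strict descent is the recursive clause read backwards. Otherwise
  \<open>std m n \<alpha>\<close> ascends at \<open>n - i\<close>, where the divided difference of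
  its Schubert polynomial vanishes.\<close>

lemma pihat_top_lascoux:
  assumes a: "\<alpha> \<in> snowy_box n m" and i: "1 \<le> i" "i < n"
  shows "pihat i (top_lascoux \<alpha>) = (if entry \<alpha> (Suc i) < entry \<alpha> i then top_lascoux (swap_comp i \<alpha>) else 0)"
proof (cases "entry \<alpha> (Suc i) < entry \<alpha> i")
  case True
  have "top_lascoux_rel (swap_comp i \<alpha>) (pihat i (top_lascoux \<alpha>))"
    using snowy_box_weak[OF swap_comp_in_snowy_box[OF a i]] snowy_box_weak[OF a] top_lascoux_rel_top_lascoux True i
    by (intro top_lascoux_rel.ascent) (auto simp: lookup_swap_comp)
  then show ?thesis using True by (simp add: top_lascoux_eqI)
next
  case False
  have "reflect_poly m n (pihat i (top_lascoux \<alpha>)) = divdiff (n - i) (schubert (std m n \<alpha>))"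
    using reflect_poly_pihat[OF top_lascoux_in_boxpoly[OF a] i] reflect_poly_top_lascoux[OF a] by simp
  also have "\<dots> = 0"
    using i False by (intro schubert_divdiff_ascent std_props(1)[OF a] std_ascent[OF a]) auto
  finally have "pihat i (top_lascoux \<alpha>) = 0"
    using reflect_poly_reflect_poly[OF pihat_in_boxpoly[OF top_lascoux_in_boxpoly[OF a] i]] by simp
  then show ?thesis using False by simp
qed

lemma indep_family_top_lascoux: "indep_family top_lascoux {\<alpha>. weak_composition \<alpha> \<and> snowy \<alpha>}"
  unfolding indep_family_def
proof (intro allI impI)
  fix A c
  assume A: "finite A \<and> A \<subseteq> {\<alpha>. weak_composition \<alpha> \<and> snowy \<alpha>} \<and> (\<Sum>\<alpha>\<in>A. scale (c \<alpha>) (top_lascoux \<alpha>)) = 0"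
  have "\<exists>N. A \<subseteq> snowy_box N N"
    using conjunct1[OF A] conjunct1[OF conjunct2[OF A]]
  proof (induction A rule: finite_induct)
    case (insert \<alpha> A)
    then obtain N M where "A \<subseteq> snowy_box N N" "\<alpha> \<in> snowy_box M M"
      using weak_snowy_in_box[of \<alpha>] by auto
    then have "insert \<alpha> A \<subseteq> snowy_box (max N M) (max N M)"
      using snowy_box_mono[of N "max N M" N "max N M"] snowy_box_mono[of M "max N M" M "max N M"] by auto
    then show ?case by blast
  qed simp
  then obtain N where N: "A \<subseteq> snowy_box N N" by blast
  let ?s = "std N N"
  have inj: "inj_on ?s A" using std_inj N by (rule inj_on_subset)
  have "0 = reflect_poly N N (\<Sum>\<alpha>\<in>A. scale (c \<alpha>) (top_lascoux \<alpha>))" using A by simp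
  also have "\<dots> = (\<Sum>\<alpha>\<in>A. scale (c \<alpha>) (schubert (?s \<alpha>)))"
    unfolding reflect_poly_sum_scale using N by (intro sum.cong) (auto simp: reflect_poly_top_lascoux)
  also have "\<dots> = (\<Sum>w\<in>?s ` A. scale (c (inv_into A ?s w)) (schubert w))"
    unfolding sum.reindex[OF inj] by (rule sum.cong) (simp_all add: inv_into_f_f[OF inj])
  finally have "(\<Sum>w\<in>?s ` A. scale (c (inv_into A ?s w)) (schubert w)) = 0" by simp
  moreover have "?s ` A \<subseteq> Collect fin_perm" "finite (?s ` A)" using N std_props(1) A by auto
  ultimately have "\<forall>w\<in>?s ` A. c (inv_into A ?s w) = 0"
    using indep_family_schubert[unfolded indep_family_def, rule_format, of "?s ` A" "\<lambda>w. c (inv_into A ?s w)"]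
    by blast
  then show "\<forall>\<alpha>\<in>A. c \<alpha> = 0" by (simp add: inv_into_f_f[OF inj])
qed

lemma top_lascoux_expansion_unique:
  assumes "is_top_lascoux_expansion f c" and "is_top_lascoux_expansion f d"
  shows "c = d"
  by (rule indep_family_unique[OF indep_family_top_lascoux])
    (use assms in \<open>auto simp: is_top_lascoux_expansion_def\<close>)

subsection \<open>The ring of top Lascoux polynomials\<close>

text \<open>\<open>rowp j a\<close> is \<open>x\<^sub>1 \<dots> x\<^sub>j\<close> times the complete homogeneous polynomial
  of degree \<open>a\<close> in \<open>x\<^sub>1, \<dots>, x\<^sub>j\<close>.\<close>

fun rowp :: "nat \<Rightarrow> nat \<Rightarrow> qpoly" where
  "rowp 0 a = (if a = 0 then 1 else 0)"
| "rowp (Suc j) 0 = X (Suc j) * rowp j 0"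
| "rowp (Suc j) (Suc a) = X (Suc j) * (rowp j (Suc a) + rowp (Suc j) a)"

definition rowprod :: "nat set \<Rightarrow> (nat \<Rightarrow> nat) \<Rightarrow> qpoly" where
  "rowprod J a = (\<Prod>j\<in>J. rowp j (a j))"

definition rowspan :: "nat \<Rightarrow> qpoly set" where
  "rowspan n = qp.span {rowprod J a | J a. J \<subseteq> {1..n}}"

text \<open>With \<open>p\<^sub>j(t)\<close> the generating function of \<open>rowp j\<close>, the next two lemmas say
  \<open>(t - s) p\<^sub>j(t) p\<^sub>j(s) = p\<^sub>j(t) p\<^sub>j\<^sub>-\<^sub>1(s) - p\<^sub>j\<^sub>-\<^sub>1(t) p\<^sub>j(s)\<close>:
  a repeated index can be lowered.\<close>

lemma rowp_mult_Suc:
  "rowp (Suc j) a * rowp (Suc j) (Suc b) =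
    rowp (Suc j) (Suc a) * rowp (Suc j) b + (rowp (Suc j) (Suc a) * rowp j (Suc b) - rowp (Suc j) (Suc b) * rowp j (Suc a))"
  by (simp add: algebra_simps)

lemma rowp_mult_0:
  "rowp (Suc j) a * rowp (Suc j) 0 = rowp (Suc j) (Suc a) * rowp j 0 - rowp (Suc j) 0 * rowp j (Suc a)"
  by (simp add: algebra_simps)

text \<open>Degree is shifted from the second factor to the first until the second has degree
  parameter 0; each shift leaves correction terms with one index lowered.\<close>

lemma rowp_square_in_span:
  "rowp (Suc j) a * rowp (Suc j) b \<in> qp.span {rowp (Suc j) c * rowp j d | c d. True}"
proof (induction b arbitrary: a)
  case 0
  show ?case unfolding rowp_mult_0 by (intro qp.span_diff qp.span_base) blast+
next
  case (Suc b)
  show ?case unfolding rowp_mult_Suc by (intro qp.span_add Suc.IH qp.span_diff qp.span_base) blast+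
qed

lemma rowprod_in_rowspan: "J \<subseteq> {1..n} \<Longrightarrow> rowprod J a \<in> rowspan n"
  unfolding rowspan_def by (intro qp.span_base) blast

lemma rowprod_remove: "finite J \<Longrightarrow> j \<in> J \<Longrightarrow> rowprod J a = rowp j (a j) * rowprod (J - {j}) a"
  unfolding rowprod_def by (rule prod.remove)

lemma rowprod_insert: "finite J \<Longrightarrow> j \<notin> J \<Longrightarrow> rowp j c * rowprod J a = rowprod (insert j J) (a(j := c))"
proof -
  assume "finite J" "j \<notin> J"
  moreover have "(\<Prod>k\<in>J. rowp k (a k)) = (\<Prod>k\<in>J. rowp k ((a(j := c)) k))"
    using \<open>j \<notin> J\<close> by (intro prod.cong) auto
  ultimately show ?thesis unfolding rowprod_def by simp
qed

text \<open>Straightening: if the index is already taken, the two rows of index \<open>Suc j\<close>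
  are rewritten by one of index \<open>Suc j\<close>, which stays in the product, and one of index
  \<open>j\<close>, which the induction hypothesis multiplies in.\<close>

lemma rowp_mult_rowspan:
  assumes "j \<le> n" and "f \<in> rowspan n"
  shows "rowp j a * f \<in> rowspan n"
  using assms
proof (induction j arbitrary: a f)
  case 0
  then show ?case by (cases "a = 0") (auto simp: rowspan_def qp.span_zero)
next
  case (Suc j)
  show ?case unfolding rowspan_def
  proof (rule qlinear_in_span[OF qlinear_mult Suc.prems(2)[unfolded rowspan_def]], fold rowspan_def)
    fix y assume "y \<in> {rowprod J a | J a. J \<subseteq> {1..n}}"
    then obtain J b where y: "y = rowprod J b" and J: "J \<subseteq> {1..n}" by blast
    have fin: "finite J" using J by (rule finite_subset) simp
    show "rowp (Suc j) a * y \<in> rowspan n"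
    proof (cases "Suc j \<in> J")
      case False
      have "insert (Suc j) J \<subseteq> {1..n}" using J Suc.prems(1) by auto
      then show ?thesis unfolding y rowprod_insert[OF fin False] by (rule rowprod_in_rowspan)
    next
      case True
      let ?P = "rowprod (J - {Suc j}) b"
      have "?P * (rowp (Suc j) a * rowp (Suc j) (b (Suc j))) \<in> rowspan n"
        unfolding rowspan_def
      proof (rule qlinear_in_span[OF qlinear_mult rowp_square_in_span], fold rowspan_def)
        fix z assume "z \<in> {rowp (Suc j) c * rowp j d | c d. True}"
        then obtain c d where z: "z = rowp (Suc j) c * rowp j d" by blast
        have "rowp (Suc j) c * ?P = rowprod J (b(Suc j := c))"
          using True by (subst rowprod_insert) (simp_all add: fin insert_absorb)
        then have "?P * z = rowp j d * rowprod J (b(Suc j := c))"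
          unfolding z by (metis mult.assoc mult.commute)
        then show "?P * z \<in> rowspan n"
          using Suc.IH[of "rowprod J (b(Suc j := c))"] Suc.prems(1) rowprod_in_rowspan[OF J] by simp
      qed
      then show ?thesis unfolding y rowprod_remove[OF fin True] by (metis mult.assoc mult.commute)
    qed
  qed
qed

lemma rowprod_mult_rowspan:
  assumes "J \<subseteq> {1..n}" and "f \<in> rowspan n"
  shows "rowprod J a * f \<in> rowspan n"
proof -
  have "finite J" using assms(1) by (rule finite_subset) simp
  then show ?thesis using assms(1)
  proof (induction J rule: finite_induct)
    case empty
    then show ?case using assms(2) by (simp add: rowprod_def)
  next
    case (insert j J)
    have "rowp j (a j) * (rowprod J a * f) \<in> rowspan n"
      using insert by (intro rowp_mult_rowspan) auto
    then show ?case using insert.hyps by (simp add: rowprod_def mult.assoc)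
  qed
qed

lemma rowspan_mult: "f \<in> rowspan n \<Longrightarrow> g \<in> rowspan n \<Longrightarrow> f * g \<in> rowspan n"
proof -
  assume f: "f \<in> rowspan n" and g: "g \<in> rowspan n"
  have "g * f \<in> rowspan n"
    unfolding rowspan_def
  proof (rule qlinear_in_span[OF qlinear_mult f[unfolded rowspan_def]], fold rowspan_def)
    fix y assume "y \<in> {rowprod J a | J a. J \<subseteq> {1..n}}"
    then obtain J b where y: "y = rowprod J b" "J \<subseteq> {1..n}" by blast
    show "g * y \<in> rowspan n"
      unfolding y mult.commute[of g] by (rule rowprod_mult_rowspan[OF y(2) g])
  qed
  then show ?thesis by (simp only: mult.commute)
qed

lemma swap_vars_rowp_less: "j < i \<Longrightarrow> swap_vars i (rowp j a) = rowp j a"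
  by (induction j a rule: rowp.induct) (simp_all add: swap_vars_mult swap_vars_add)

text \<open>The claim \<open>pihat i (rowp i a) = rowp (Suc i) a\<close> cleared of its denominator;
  the induction on \<open>a\<close> works because \<open>rowp k\<close> with \<open>k < i\<close> is
  fixed by the swap.\<close>

lemma rowp_Suc_divdiff:
  assumes "1 \<le> i"
  shows "(X i - X (Suc i)) * rowp (Suc i) a = X i * X (Suc i) * (rowp i a - swap_vars i (rowp i a))"
proof -
  obtain k where k: "i = Suc k" using assms by (cases i) auto
  have s: "swap_vars i (rowp k b) = rowp k b" for b by (rule swap_vars_rowp_less) (simp add: k)
  show ?thesis
  proof (induction a)
    case 0
    show ?case using s[of 0] by (simp add: k swap_vars_mult algebra_simps)
  next
    case (Suc a)
    define x y where "x = X i" and "y = X (Suc i)"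
    define q where "q = rowp k (Suc a)"
    define p where "p = rowp i a"
    define p' where "p' = swap_vars i p"
    have 1: "rowp i (Suc a) = x * (q + p)" by (simp add: k q_def p_def x_def)
    have 2: "swap_vars i (rowp i (Suc a)) = y * (q + p')"
      unfolding 1 using s[of "Suc a"] by (simp add: swap_vars_mult swap_vars_add q_def p'_def x_def y_def)
    have 3: "rowp (Suc i) (Suc a) = y * (x * (q + p) + rowp (Suc i) a)"
      unfolding 1[symmetric] y_def by simp
    have "(x - y) * rowp (Suc i) (Suc a) = y * ((x - y) * (x * (q + p))) + y * ((x - y) * rowp (Suc i) a)"
      unfolding 3 by (simp add: algebra_simps)
    also have "(x - y) * rowp (Suc i) a = x * y * (p - p')"
      using Suc.IH by (simp only: x_def y_def p_def p'_def)
    also have "y * ((x - y) * (x * (q + p))) + y * (x * y * (p - p')) = x * y * (x * (q + p) - y * (q + p'))"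
      by (simp add: algebra_simps)
    finally show ?case unfolding 2 unfolding 1 by (simp only: x_def y_def)
  qed
qed

text \<open>Starting from powers of \<open>X 1\<close>, this identifies \<open>rowp j a\<close> with
  \<open>1 \<le> j\<close> as the top Lascoux polynomial whose only positive entry is
  \<open>a + 1\<close> at position \<open>j\<close>.\<close>

lemma pihat_rowp: "1 \<le> i \<Longrightarrow> pihat i (rowp i a) = rowp (Suc i) a"
  using rowp_Suc_divdiff[of i a] by (simp only: pihat_eq[symmetric] divdiff_cancel)

text \<open>Rows of index below \<open>i\<close> do not contain the two variables. The row of index
  \<open>Suc i\<close> is an image of \<open>pihat i\<close>, hence symmetric, and longer rows are
  built from it with other variables.\<close>

lemma swap_vars_rowp:
  assumes "1 \<le> i" and "j \<noteq> i"
  shows "swap_vars i (rowp j a) = rowp j a"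
proof (cases "j < i")
  case False
  then have "Suc i \<le> j" using assms(2) by simp
  then show ?thesis
  proof (induction j arbitrary: a rule: dec_induct)
    case base
    have "pihat i (rowp i a) = X i * X (Suc i) * divdiff i (rowp i a)" by (rule pihat_def)
    then show ?case
      unfolding pihat_rowp[OF assms(1)] by (simp add: swap_vars_mult swap_vars_divdiff mult.commute)
  next
    case (step j)
    then show ?case by (induction a) (simp_all add: swap_vars_mult swap_vars_add)
  qed
qed (rule swap_vars_rowp_less)

lemma pihat_1: "pihat i 1 = 0"
  by (simp add: pihat_def divdiff_eq_0_iff[THEN iffD2])

lemma swap_vars_rowprod: "1 \<le> i \<Longrightarrow> i \<notin> J \<Longrightarrow> swap_vars i (rowprod J a) = rowprod J a"
  unfolding rowprod_def swap_vars_prod by (rule prod.cong) (auto intro!: swap_vars_rowp)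

text \<open>All rows of index other than \<open>i\<close> are symmetric in the two variables and
  pass through. The raised index may collide with one in \<open>J\<close>, so the result is stated
  as a product with one separate row.\<close>

lemma pihat_rowprod:
  assumes "finite J" and "1 \<le> i"
  shows "pihat i (rowprod J a) = (if i \<in> J then rowp (Suc i) (a i) * rowprod (J - {i}) a else 0)"
proof (cases "i \<in> J")
  case True
  have "pihat i (rowprod (J - {i}) a * rowp i (a i)) = rowprod (J - {i}) a * rowp (Suc i) (a i)"
    using assms(2) by (simp only: pihat_mult_sym swap_vars_rowprod pihat_rowp Diff_iff singletonI simp_thms)
  then show ?thesis using True by (simp only: rowprod_remove[OF assms(1) True] mult.commute if_True)
next
  case False
  then show ?thesis
    using pihat_mult_sym[OF swap_vars_rowprod[OF assms(2) False], of a 1] by (simp add: pihat_1)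
qed

lemma pihat_rowspan:
  assumes "f \<in> rowspan n" and "1 \<le> i" and "i < n"
  shows "pihat i f \<in> rowspan n"
  unfolding rowspan_def
proof (rule qlinear_in_span[OF qlinear_pihat assms(1)[unfolded rowspan_def]], fold rowspan_def)
  fix y assume "y \<in> {rowprod J a | J a. J \<subseteq> {1..n}}"
  then obtain J a where y: "y = rowprod J a" and J: "J \<subseteq> {1..n}" by blast
  have "finite J" using J by (rule finite_subset) simp
  moreover have "rowp (Suc i) (a i) * rowprod (J - {i}) a \<in> rowspan n"
    using J assms(3) by (intro rowp_mult_rowspan rowprod_in_rowspan) auto
  ultimately show "pihat i y \<in> rowspan n"
    unfolding y using assms(2) by (auto simp: pihat_rowprod rowspan_def qp.span_zero)
qed

section \<open>Multiples of staircase monomials\<close>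

abbreviation polyring :: "nat \<Rightarrow> qpoly set" where
  "polyring r \<equiv> qp.span (xpow ` {e. supp e \<subseteq> {1..r}})"

lemma polyring_mult: "f \<in> polyring r \<Longrightarrow> g \<in> polyring r \<Longrightarrow> f * g \<in> polyring r"
proof (rule mult_in_span)
  fix a b assume "a \<in> xpow ` {e. supp e \<subseteq> {1..r}}" "b \<in> xpow ` {e. supp e \<subseteq> {1..r}}"
  then obtain d e where "a = xpow d" "b = xpow e" "supp d \<subseteq> {1..r}" "supp e \<subseteq> {1..r}" by blast
  then show "a * b \<in> polyring r"
    using keys_add[of d e] by (auto simp flip: xpow_add intro!: xpow_in_span)
qed

lemma polyring_mono: "r \<le> s \<Longrightarrow> polyring r \<subseteq> polyring s"
  by (intro qp.span_mono image_mono) auto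

lemma polyring_1: "1 \<in> polyring r"
  using xpow_in_span[of 0 "{e. supp e \<subseteq> {1..r}}"] by simp

lemma polyring_X: "1 \<le> i \<Longrightarrow> i \<le> r \<Longrightarrow> X i \<in> polyring r"
  unfolding X_def by (rule xpow_in_span) simp

lemma rowp_factor: "\<exists>h\<in>polyring j. rowp j a = rowp j 0 * h"
proof (induction j a rule: rowp.induct)
  case (1 a)
  show ?case
    by (cases "a = 0") (auto intro: bexI[of _ 1] bexI[of _ 0] qp.span_base qp.span_zero)
next
  case (2 j)
  show ?case by (rule bexI[of _ 1]) (simp_all add: polyring_1)
next
  case (3 j a)
  then obtain h h' where h: "h \<in> polyring j" "rowp j (Suc a) = rowp j 0 * h"
    "h' \<in> polyring (Suc j)" "rowp (Suc j) a = rowp (Suc j) 0 * h'" by blast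
  have "rowp (Suc j) (Suc a) = rowp (Suc j) 0 * (h + X (Suc j) * h')"
    by (simp add: h algebra_simps)
  moreover have "h + X (Suc j) * h' \<in> polyring (Suc j)"
    using h polyring_mono[of j "Suc j"] by (intro qp.span_add polyring_mult polyring_X) auto
  ultimately show ?case by blast
qed

text \<open>The monomial with exponents r, r - 1, ..., 1, the least snowy partition with support
  \<open>{1..r}\<close>.\<close>

definition staircase :: "nat \<Rightarrow> qpoly" where
  "staircase r = rowprod {1..r} (\<lambda>_. 0)"

lemma staircase_Suc: "staircase (Suc r) = rowp (Suc r) 0 * staircase r"
proof -
  have "{1..Suc r} = insert (Suc r) {1..r}" by auto
  then show ?thesis by (simp add: staircase_def rowprod_def)
qed

text \<open>One variable at a time: powers of \<open>X (Suc r)\<close> times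
  \<open>rowp (Suc r) 0\<close> become combinations of rows \<open>rowp (Suc r) d\<close> with
  coefficients in the first \<open>r\<close> variables, and the smaller staircase absorbs the
  coefficients.\<close>

lemma staircase_mult_rowspan:
  assumes "r \<le> n" and "f \<in> polyring r"
  shows "staircase r * f \<in> rowspan n"
  using assms
proof (induction r arbitrary: f)
  case 0
  have "f \<in> polyring 0 \<Longrightarrow> f \<in> rowspan n"
  proof (unfold rowspan_def, erule qlinear_in_span[rotated], fold rowspan_def)
    show "qlinear (\<lambda>f. f)" by (rule qlinearI) simp_all
    fix a assume "a \<in> xpow ` {e. supp e \<subseteq> {1..0}}"
    then have "a = rowprod {} (\<lambda>_. 0)" by (auto simp: rowprod_def)
    then show "a \<in> rowspan n" using rowprod_in_rowspan[of "{}"] by simp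
  qed
  then show ?case using 0 by (simp add: staircase_def rowprod_def)
next
  case (Suc r)
  define W where "W = {rowp (Suc r) d * h | d h. h \<in> polyring r}"
  have W: "staircase r * w \<in> rowspan n" if "w \<in> qp.span W" for w
    unfolding rowspan_def
  proof (rule qlinear_in_span[OF qlinear_mult that], fold rowspan_def)
    fix a assume "a \<in> W"
    then obtain d h where a: "a = rowp (Suc r) d * h" "h \<in> polyring r" unfolding W_def by blast
    have "rowp (Suc r) d * (staircase r * h) \<in> rowspan n"
      using Suc.IH[OF _ a(2)] Suc.prems(1) by (intro rowp_mult_rowspan) auto
    then show "staircase r * a \<in> rowspan n" unfolding a(1) by (simp only: mult.left_commute)
  qed
  have XW: "X (Suc r) * w \<in> qp.span W" if "w \<in> qp.span W" for w
  proof (rule qlinear_in_span[OF qlinear_mult that])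
    fix a assume "a \<in> W"
    then obtain d h where a: "a = rowp (Suc r) d * h" "h \<in> polyring r" unfolding W_def by blast
    obtain g where g: "g \<in> polyring r" "rowp r (Suc d) = rowp r 0 * g" using rowp_factor by blast
    \<comment> \<open>The recursion of \<open>rowp\<close> solved for its last term; the leftover
      row of index \<open>r\<close> is a multiple of \<open>rowp r 0\<close>, which
      \<open>X (Suc r)\<close> completes to \<open>rowp (Suc r) 0\<close>.\<close>
    have "X (Suc r) * a = rowp (Suc r) (Suc d) * h - rowp (Suc r) 0 * (g * h)"
      unfolding a(1) by (simp add: g(2) algebra_simps)
    also have "\<dots> \<in> qp.span W"
      unfolding W_def using a(2) polyring_mult[OF g(1) a(2)] by (intro qp.span_diff qp.span_base) blast+
    finally show "X (Suc r) * a \<in> qp.span W" .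
  qed
  have XcW: "X (Suc r) ^ c * (rowp (Suc r) 0 * g) \<in> qp.span W" if "g \<in> polyring r" for c g
  proof (induction c)
    case 0
    have "rowp (Suc r) 0 * g \<in> W" unfolding W_def using that by blast
    then show ?case by (simp add: qp.span_base)
  next
    case (Suc c)
    then show ?case using XW by (simp add: mult.assoc)
  qed
  show ?case unfolding rowspan_def
  proof (rule qlinear_in_span[OF qlinear_mult Suc.prems(2)], fold rowspan_def)
    fix a assume "a \<in> xpow ` {e. supp e \<subseteq> {1..Suc r}}"
    then obtain e where a: "a = xpow e" and e: "supp e \<subseteq> {1..Suc r}" by blast
    define d where "d = Poly_Mapping.update (Suc r) 0 e"
    have "e = Poly_Mapping.single (Suc r) (entry e (Suc r)) + d"
      by (rule poly_mapping_eqI) (simp add: d_def lookup_update lookup_add lookup_single when_def)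
    then have a2: "a = X (Suc r) ^ entry e (Suc r) * xpow d"
      unfolding a by (metis xpow_add xpow_single)
    have "supp d \<subseteq> {1..r}"
    proof
      fix i assume "i \<in> supp d"
      then have "i \<noteq> Suc r" "i \<in> supp e"
        unfolding d_def in_keys_iff lookup_update by (auto split: if_splits)
      then show "i \<in> {1..r}" using e by force
    qed
    then have "xpow d \<in> polyring r" by (intro xpow_in_span) simp
    from W[OF XcW[OF this, of "entry e (Suc r)"]]
    show "staircase (Suc r) * a \<in> rowspan n"
      unfolding a2 staircase_Suc by (simp only: mult_ac)
  qed
qed

primrec stair_exp :: "nat \<Rightarrow> comp" where
  "stair_exp 0 = 0"
| "stair_exp (Suc r) = reflect 1 (Suc r) 0 + stair_exp r"

lemma lookup_stair_exp: "entry (stair_exp r) i = (if i \<in> {1..r} then r + 1 - i else 0)"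
  by (induction r) (auto simp: lookup_add lookup_reflect)

lemma rowp_0_xpow: "rowp j 0 = xpow (reflect 1 j 0)"
proof (induction j)
  case 0
  have "reflect 1 0 0 = 0" by (rule poly_mapping_eqI) (simp add: lookup_reflect)
  then show ?case by simp
next
  case (Suc j)
  have "reflect 1 (Suc j) 0 = Poly_Mapping.single (Suc j) 1 + reflect 1 j 0"
    by (rule poly_mapping_eqI) (auto simp: lookup_reflect lookup_add lookup_single when_def)
  then show ?case using Suc by (simp add: xpow_add X_def)
qed

lemma staircase_xpow: "staircase r = xpow (stair_exp r)"
proof (induction r)
  case 0
  then show ?case by (simp add: staircase_def rowprod_def)
next
  case (Suc r)
  then show ?case by (simp only: staircase_Suc stair_exp.simps xpow_add rowp_0_xpow)
qed

text \<open>Positive parts of a snowy partition decrease strictly, so counted from the last one they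
  are at least 1, 2, 3, ...; here \<open>r\<close> is the number of parts.\<close>

lemma snowy_partition_staircase:
  assumes "\<alpha> \<in> snowy_box n m" and "is_partition \<alpha>"
  shows "\<exists>r\<le>n. supp \<alpha> \<subseteq> {1..r} \<and> (\<forall>i\<in>{1..r}. r + 1 - i \<le> entry \<alpha> i)"
proof -
  define r where "r = Max (insert 0 (supp \<alpha>))"
  have sub: "supp \<alpha> \<subseteq> {1..n}" and sn: "snowy \<alpha>" using assms(1) by (auto simp: snowy_box_def cbox_def)
  have le: "i \<le> r" if "i \<in> supp \<alpha>" for i unfolding r_def using that by simp
  have r: "r \<in> insert 0 (supp \<alpha>)" unfolding r_def by (rule Max_in) auto
  have "r + 1 - i \<le> entry \<alpha> i" if "i \<in> {1..r}" for i
  proof -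
    have "1 \<le> i" "i \<le> r" using that by auto
    then have "r \<in> supp \<alpha>" using r by auto
    from \<open>i \<le> r\<close> show ?thesis using \<open>1 \<le> i\<close>
    proof (induction i rule: inc_induct)
      case base
      then show ?case using \<open>r \<in> supp \<alpha>\<close> by (simp add: in_keys_iff One_nat_def)
    next
      case (step k)
      have IH: "r + 1 - Suc k \<le> entry \<alpha> (Suc k)" using step by simp
      then have pos: "0 < entry \<alpha> (Suc k)" using step.hyps by simp
      have "entry \<alpha> k \<noteq> entry \<alpha> (Suc k)" by (rule snowyD[OF sn pos]) simp
      moreover have "entry \<alpha> (Suc k) \<le> entry \<alpha> k"
        using assms(2) step.prems unfolding is_partition_def by blast
      ultimately show ?case using IH by linarith
    qed
  qed
  moreover have "supp \<alpha> \<subseteq> {1..r}" using le sub by force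
  moreover have "r \<le> n" using r sub by auto
  ultimately show ?thesis by blast
qed

text \<open>The monomial of a snowy partition is a staircase multiple, and \<open>rowspan n\<close>
  is closed under \<open>pihat i\<close>.\<close>

lemma top_lascoux_in_rowspan:
  assumes "top_lascoux_rel \<alpha> f" and "\<alpha> \<in> snowy_box n m"
  shows "f \<in> rowspan n"
  using assms
proof (induction rule: top_lascoux_rel.induct)
  case (partition \<alpha>)
  then obtain r where r: "r \<le> n" "supp \<alpha> \<subseteq> {1..r}" "\<And>i. i \<in> {1..r} \<Longrightarrow> r + 1 - i \<le> entry \<alpha> i"
    using snowy_partition_staircase by blast
  have "supp (\<alpha> - stair_exp r) \<subseteq> supp \<alpha>" by (auto simp: in_keys_iff lookup_minus)
  then have "xpow (\<alpha> - stair_exp r) \<in> polyring r" using r(2) by (intro xpow_in_span) auto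
  then have "xpow (stair_exp r) * xpow (\<alpha> - stair_exp r) \<in> rowspan n"
    using staircase_mult_rowspan[OF r(1)] by (simp only: staircase_xpow)
  moreover have "stair_exp r + (\<alpha> - stair_exp r) = \<alpha>"
  proof (rule poly_mapping_eqI)
    fix i
    have "entry (stair_exp r) i \<le> entry \<alpha> i" using r(3)[of i] by (auto simp: lookup_stair_exp)
    then show "entry (stair_exp r + (\<alpha> - stair_exp r)) i = entry \<alpha> i" by (simp add: lookup_add lookup_minus)
  qed
  ultimately show ?case by (simp only: xpow_add[symmetric])
next
  case (ascent \<alpha> i f)
  have "Suc i \<le> n" using std_value_small[OF ascent.prems, of "Suc i"] ascent.hyps by auto
  then have i: "1 \<le> i" "i < n" using ascent.hyps by auto
  show ?case
    using ascent.IH[OF swap_comp_in_snowy_box[OF ascent.prems i]] i by (rule pihat_rowspan)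
qed

section \<open>Monomials above a staircase as combinations of top Lascoux polynomials\<close>

lemma pihat_lascoux_span:
  assumes "f \<in> qp.span (top_lascoux ` snowy_box n m)" and "1 \<le> i" and "i < n"
  shows "pihat i f \<in> qp.span (top_lascoux ` snowy_box n m)"
proof (rule qlinear_in_span[OF qlinear_pihat assms(1)])
  fix a assume "a \<in> top_lascoux ` snowy_box n m"
  then obtain \<alpha> where "a = top_lascoux \<alpha>" "\<alpha> \<in> snowy_box n m" by blast
  then show "pihat i a \<in> qp.span (top_lascoux ` snowy_box n m)"
    using swap_comp_in_snowy_box[of \<alpha> n m i] assms(2,3)
    by (auto simp: pihat_top_lascoux qp.span_zero intro: qp.span_base)
qed

lemma sum_update2:
  fixes e :: comp
  assumes "1 \<le> i" and "i < r"
  shows "(\<Sum>j=1..r. j * entry (Poly_Mapping.update (Suc i) y (Poly_Mapping.update i x e)) j) + (i * entry e i + Suc i * entry e (Suc i))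
    = (\<Sum>j=1..r. j * entry e j) + (i * x + Suc i * y)"
proof -
  have split: "sum f {1..r} = sum f ({1..r} - {i, Suc i}) + (f i + f (Suc i))" for f :: "nat \<Rightarrow> nat"
  proof -
    have "sum f {1..r} = sum f ({1..r} - {i, Suc i}) + sum f {i, Suc i}"
      using assms by (intro sum.subset_diff) auto
    then show ?thesis by simp
  qed
  have "(\<Sum>j\<in>{1..r} - {i, Suc i}. j * entry (Poly_Mapping.update (Suc i) y (Poly_Mapping.update i x e)) j) = (\<Sum>j\<in>{1..r} - {i, Suc i}. j * entry e j)"
    by (intro sum.cong) (auto simp: lookup_update)
  then show ?thesis unfolding split by (simp add: lookup_update)
qed

text \<open>At a weak ascent \<open>e\<^sub>i \<le> e\<^sub>i\<^sub>+\<^sub>1\<close> the monomial is the extreme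
  term of \<open>pihat i\<close> applied to a monomial with exponents \<open>e\<^sub>i\<^sub>+\<^sub>1, e\<^sub>i - 1\<close>;
  this monomial and all other terms have smaller weight \<open>\<Sum>j. j * e\<^sub>j\<close>.\<close>

lemma xpow_in_lascoux_span:
  assumes "r \<le> n" and "e \<in> cbox r m" and "\<And>i. i \<in> {1..r} \<Longrightarrow> r + 1 - i \<le> entry e i"
  shows "xpow e \<in> qp.span (top_lascoux ` snowy_box n m)"
  using assms(2,3)
proof (induction "\<Sum>j=1..r. j * entry e j" arbitrary: e rule: less_induct)
  case less
  note box = cboxD[OF less.prems(1)]
  show ?case
  proof (cases "\<exists>i. 1 \<le> i \<and> i < r \<and> entry e i \<le> entry e (Suc i)")
    case True
    then obtain i where i: "1 \<le> i" "i < r" "entry e i \<le> entry e (Suc i)" by blast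
    define a b where "a = entry e i" and "b = entry e (Suc i)"
    have ab: "a \<le> b" "r + 1 - i \<le> a" "1 \<le> a" "b \<le> m"
      using i less.prems(2)[of i] box(1)[of "Suc i"] by (auto simp: a_def b_def)
    define t where "t x y = Poly_Mapping.update (Suc i) y (Poly_Mapping.update i x e)" for x y
    \<comment> \<open>The induction hypothesis for exponents changed at \<open>i\<close> and
      \<open>Suc i\<close> only; the bounds \<open>r + 1 - i\<close> and \<open>r - i\<close> keep
      them above the staircase.\<close>
    have t: "xpow (t x y) \<in> qp.span (top_lascoux ` snowy_box n m)"
      if "x \<le> m" "y \<le> m" "r + 1 - i \<le> x" "r - i \<le> y" "i * x + Suc i * y < i * a + Suc i * b" for x y
    proof (rule less.hyps)
      show "(\<Sum>j=1..r. j * entry (t x y) j) < (\<Sum>j=1..r. j * entry e j)"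
        using sum_update2[OF i(1,2), of y x e] that(5) unfolding t_def a_def b_def by linarith
      show "t x y \<in> cbox r m"
        using box that i unfolding t_def by (intro cboxI) (auto simp: lookup_update)
      show "r + 1 - k \<le> entry (t x y) k" if "k \<in> {1..r}" for k
        using that less.prems(2)[OF that] \<open>r + 1 - i \<le> x\<close> \<open>r - i \<le> y\<close> unfolding t_def
        by (auto simp: lookup_update)
    qed
    have tt: "Poly_Mapping.update (Suc i) y' (Poly_Mapping.update i x' (t x y)) = t x' y'" for x y x' y'
      by (rule poly_mapping_eqI) (simp add: t_def lookup_update)
    have te: "t a b = e" by (rule poly_mapping_eqI) (simp add: t_def lookup_update a_def b_def)
    \<comment> \<open>For the exponent pair (b, a - 1) the sum given by \<open>pihat_xpow\<close>
      runs from the pair (a, b), which is \<open>e\<close>, to the pair (b, a).\<close>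
    define k where "k = b - (a - 1)"
    have k: "b = (a - 1) + k" "0 < k" using ab by (auto simp: k_def)
    have "entry (t b (a - 1)) i = (a - 1) + k" "entry (t b (a - 1)) (Suc i) = a - 1"
      by (simp_all add: t_def lookup_update flip: k(1))
    from pihat_xpow[OF this] have "pihat i (xpow (t b (a - 1))) = (\<Sum>c<k. xpow (t (Suc (a - 1 + c)) (a - 1 + k - c)))"
      unfolding tt .
    also have "\<dots> = (\<Sum>c<k. xpow (t (a + c) (b - c)))"
      using ab by (simp add: k(1)[symmetric])
    also have "\<dots> = xpow e + (\<Sum>c\<in>{1..<k}. xpow (t (a + c) (b - c)))"
    proof -
      have "{..<k} = insert 0 {1..<k}" using k(2) by auto
      then show ?thesis by (simp add: te)
    qed
    finally have eq: "xpow e = pihat i (xpow (t b (a - 1))) - (\<Sum>c\<in>{1..<k}. xpow (t (a + c) (b - c)))"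
      by simp
    have "i * b + Suc i * (a - 1) < i * a + Suc i * b"
    proof -
      have "Suc i * (a - 1) + Suc i = Suc i * a" using ab(3) by (metis Suc_diff_le add.commute diff_Suc_1 mult_Suc_right plus_1_eq_Suc le_add_diff_inverse2)
      then show ?thesis using ab(1) by simp
    qed
    then have "pihat i (xpow (t b (a - 1))) \<in> qp.span (top_lascoux ` snowy_box n m)"
      using ab i assms(1) by (intro pihat_lascoux_span t) auto
    moreover have "xpow (t (a + c) (b - c)) \<in> qp.span (top_lascoux ` snowy_box n m)" if "c \<in> {1..<k}" for c
    proof (rule t)
      have c: "1 \<le> c" "c \<le> b - a" using that ab by (auto simp: k_def)
      show "a + c \<le> m" "b - c \<le> m" "r + 1 - i \<le> a + c" "r - i \<le> b - c" using c ab by auto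
      have "i * (b - c) + i * c = i * b" using c ab by (simp flip: distrib_left)
      then show "i * (a + c) + Suc i * (b - c) < i * a + Suc i * b"
        using c ab by (simp add: distrib_left)
    qed
    ultimately show ?thesis unfolding eq by (intro qp.span_diff qp.span_sum)
  next
    case False
    \<comment> \<open>Without weak ascents \<open>e\<close> is a snowy partition, and the monomial
      is itself a top Lascoux polynomial.\<close>
    then have dec: "entry e (Suc i) < entry e i" if "1 \<le> i" "i < r" for i
      using that by (meson not_less)
    have zero: "entry e i = 0" if "i \<notin> {1..r}" for i using box(2)[OF that] .
    have "is_partition e"
      unfolding is_partition_def
    proof (intro allI impI)
      fix i :: nat assume "1 \<le> i"
      then show "entry e (Suc i) \<le> entry e i" using dec[of i] zero[of "Suc i"] by (cases "i < r") auto
    qed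
    have lt: "entry e k < entry e i" if "1 \<le> i" "i < k" "k \<le> r" for i k
      using that(2,3)
    proof (induction k)
      case (Suc k)
      then show ?case using dec[of k] that(1) by (cases "i = k") auto
    qed simp
    have "snowy e"
      unfolding snowy_def
    proof (intro allI impI)
      fix i j assume ij: "0 < entry e i \<and> 0 < entry e j \<and> i \<noteq> j"
      then have "i \<in> {1..r}" "j \<in> {1..r}" using zero by fastforce+
      then show "entry e i \<noteq> entry e j" using lt[of i j] lt[of j i] ij by (cases "i < j") auto
    qed
    moreover have "e \<in> cbox n m" using cbox_mono[OF assms(1) order_refl] less.prems(1) by blast
    ultimately have sb: "e \<in> snowy_box n m" by (simp add: snowy_box_def)
    have "top_lascoux e = xpow e"
      using snowy_box_weak[OF sb] \<open>is_partition e\<close> by (intro top_lascoux_eqI top_lascoux_rel.partition) auto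
    then show ?thesis using sb by (metis imageI qp.span_base)
  qed
qed

text \<open>Only the support is bounded here; the bound on the entries is recovered afterwards by
  \<open>snowy_box_bound\<close>.\<close>

definition lascoux_span :: "nat \<Rightarrow> qpoly set" where
  "lascoux_span n = qp.span (top_lascoux ` (\<Union>m. snowy_box n m))"

lemma lascoux_span_box: "qp.span (top_lascoux ` snowy_box n m) \<subseteq> lascoux_span n"
  unfolding lascoux_span_def by (intro qp.span_mono image_mono) auto

lemma pihat_lascoux_span_all:
  assumes "f \<in> lascoux_span n" and "1 \<le> i" and "i < n"
  shows "pihat i f \<in> lascoux_span n"
  unfolding lascoux_span_def
proof (rule qlinear_in_span[OF qlinear_pihat assms(1)[unfolded lascoux_span_def]], fold lascoux_span_def)
  fix a assume "a \<in> top_lascoux ` (\<Union>m. snowy_box n m)"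
  then obtain m where "a \<in> top_lascoux ` snowy_box n m" by blast
  then have "pihat i a \<in> qp.span (top_lascoux ` snowy_box n m)"
    using assms(2,3) by (intro pihat_lascoux_span qp.span_base)
  then show "pihat i a \<in> lascoux_span n" using lascoux_span_box by blast
qed

lemma staircase_mult_lascoux_span:
  assumes "r \<le> n" and "f \<in> polyring r"
  shows "staircase r * f \<in> lascoux_span n"
  unfolding lascoux_span_def
proof (rule qlinear_in_span[OF qlinear_mult assms(2)], fold lascoux_span_def)
  fix a assume "a \<in> xpow ` {e. supp e \<subseteq> {1..r}}"
  then obtain e where e: "a = xpow e" "supp e \<subseteq> {1..r}" by blast
  define d where "d = stair_exp r + e"
  have "staircase r * a = xpow d" by (simp add: e d_def staircase_xpow xpow_add)
  moreover have "d \<in> cbox r (max_entry d)"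
  proof (rule cboxI)
    show "entry d i \<le> max_entry d" for i using max_entry_le_iff[of d "max_entry d"] by blast
    show "entry d i = 0" if "i \<notin> {1..r}" for i
    proof -
      have "i \<notin> supp e" using e(2) that by blast
      then show ?thesis using that by (simp only: d_def lookup_add lookup_stair_exp in_keys_iff if_False not_not add_0)
    qed
  qed
  then have "xpow d \<in> qp.span (top_lascoux ` snowy_box n (max_entry d))"
    using assms(1) by (intro xpow_in_lascoux_span) (auto simp: d_def lookup_add lookup_stair_exp)
  ultimately show "staircase r * a \<in> lascoux_span n" using lascoux_span_box by auto
qed

lemma rowprod_factor:
  "\<exists>h\<in>polyring r. rowprod {1..r} a = staircase r * h"
proof (induction r)
  case 0
  show ?case by (rule bexI[of _ 1]) (simp_all add: rowprod_def staircase_def qp.span_base)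
next
  case (Suc r)
  then obtain h where h: "h \<in> polyring r" "rowprod {1..r} a = staircase r * h" by blast
  obtain g where g: "g \<in> polyring (Suc r)" "rowp (Suc r) (a (Suc r)) = rowp (Suc r) 0 * g"
    using rowp_factor by blast
  have "{1..Suc r} = insert (Suc r) {1..r}" by auto
  then have "rowprod {1..Suc r} a = rowp (Suc r) (a (Suc r)) * rowprod {1..r} a"
    by (simp add: rowprod_def)
  also have "\<dots> = staircase (Suc r) * (g * h)"
    unfolding h(2) g(2) staircase_Suc by (simp only: mult_ac)
  finally show ?case using polyring_mult[OF g(1)] h(1) polyring_mono[of r "Suc r"] by auto
qed

text \<open>\<open>pihat i\<close> moves a row from index \<open>i\<close> to a free index \<open>i + 1\<close>, so all products are
  reached from those whose index set is an initial interval.\<close>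

lemma rowprod_in_lascoux_span:
  assumes "J \<subseteq> {1..n}"
  shows "rowprod J a \<in> lascoux_span n"
  using assms
proof (induction "\<Sum>J" arbitrary: J a rule: less_induct)
  case less
  have fin: "finite J" using less.prems by (rule finite_subset) simp
  show ?case
  proof (cases "\<exists>i. 1 \<le> i \<and> i \<notin> J \<and> Suc i \<in> J")
    case True
    \<comment> \<open>Lowering the index \<open>Suc i\<close> into the gap at \<open>i\<close>
      decreases the sum of \<open>J\<close>, and \<open>pihat i\<close> raises it again.\<close>
    then obtain i where i: "1 \<le> i" "i \<notin> J" "Suc i \<in> J" by blast
    let ?K = "J - {Suc i}"
    let ?J = "insert i ?K"
    have "i \<notin> ?K" using i by simp
    have "\<Sum>J = Suc i + \<Sum>?K" using fin i by (simp add: sum.remove)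
    moreover have "\<Sum>?J = i + \<Sum>?K" using fin i by simp
    ultimately have "\<Sum>?J < \<Sum>J" by simp
    moreover have "?J \<subseteq> {1..n}" using less.prems i by auto
    ultimately have "rowprod ?J (a(i := a (Suc i))) \<in> lascoux_span n" by (rule less.hyps)
    moreover have "i < n" using less.prems i by auto
    ultimately have "pihat i (rowprod ?J (a(i := a (Suc i)))) \<in> lascoux_span n"
      using i(1) by (intro pihat_lascoux_span_all)
    moreover have "pihat i (rowprod ?J (a(i := a (Suc i)))) = rowprod J a"
    proof -
      have "?J - {i} = ?K" using i by auto
      moreover have "rowprod ?K (a(i := a (Suc i))) = rowprod ?K a"
        unfolding rowprod_def using i by (intro prod.cong) auto
      ultimately have "pihat i (rowprod ?J (a(i := a (Suc i)))) = rowp (Suc i) (a (Suc i)) * rowprod ?K a"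
        using pihat_rowprod[of ?J i "a(i := a (Suc i))"] fin i(1) by simp
      then show ?thesis by (simp only: rowprod_remove[OF fin i(3)])
    qed
    ultimately show ?thesis by simp
  next
    case False
    define r where "r = Max (insert 0 J)"
    have r: "r \<in> insert 0 J" unfolding r_def using fin by (intro Max_in) auto
    have le: "j \<le> r" if "j \<in> J" for j unfolding r_def using fin that by simp
    have "j \<in> J" if "1 \<le> j" "j \<le> r" for j
      using that(2,1)
    proof (induction j rule: inc_induct)
      case base
      then show ?case using r by auto
    next
      case (step k)
      then show ?case using False by auto
    qed
    then have J: "J = {1..r}" using le less.prems by force
    have "r \<le> n" using r less.prems by auto
    then show ?thesis
      using rowprod_factor[of r a] staircase_mult_lascoux_span[of r n] unfolding J by auto
  qed
qed

text \<open>Together with \<open>top_lascoux_in_rowspan\<close> this identifies the two spans, so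
  products of top Lascoux polynomials supported in \<open>{1..n}\<close> expand again in such
  polynomials.\<close>

lemma rowspan_subset: "rowspan n \<subseteq> lascoux_span n"
  unfolding rowspan_def lascoux_span_def
proof (rule qp.span_minimal, fold lascoux_span_def)
  show "{rowprod J a | J a. J \<subseteq> {1..n}} \<subseteq> lascoux_span n"
    using rowprod_in_lascoux_span by blast
  show "qp.subspace (lascoux_span n)" unfolding lascoux_span_def by (rule qp.subspace_span)
qed

subsection \<open>Structure constants\<close>

lemma in_span_lin_ext:
  assumes "f \<in> qp.span (B ` S)"
  shows "\<exists>d. Poly_Mapping.keys d \<subseteq> S \<and> f = lin_ext B d"
  using assms
proof (induction rule: qp.span_induct_alt)
  case base
  show ?case by (rule exI[of _ 0]) (simp add: lin_ext_def)
next
  case (step c x y)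
  then obtain s d where s: "x = B s" "s \<in> S" and d: "Poly_Mapping.keys d \<subseteq> S" "y = lin_ext B d" by blast
  interpret Vector_Spaces.linear scale scale "lin_ext B" by (rule qlinear_lin_ext)
  have "scale c x + y = lin_ext B (scale c (xpow s) + d)" by (simp add: add scale s d)
  moreover have "Poly_Mapping.keys (scale c (xpow s) + d) \<subseteq> S"
    using keys_add[of "scale c (xpow s)" d] s d
    by (auto simp: in_keys_iff lookup_scale xpow_def lookup_single when_def subset_iff split: if_splits)
  ultimately show ?case by blast
qed

text \<open>Coefficients are summed over the fibres of \<open>std m n\<close>; on
  \<open>snowy_box n m\<close> injectivity makes each fibre a single composition.\<close>

definition push_std :: "nat \<Rightarrow> nat \<Rightarrow> qpoly \<Rightarrow> ((nat \<Rightarrow> nat) \<Rightarrow>\<^sub>0 rat)" where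
  "push_std m n d = (\<Sum>\<delta>\<in>Poly_Mapping.keys d. Poly_Mapping.single (std m n \<delta>) (Poly_Mapping.lookup d \<delta>))"

lemma lookup_push_std:
  assumes "Poly_Mapping.keys d \<subseteq> snowy_box n m" and "\<delta> \<in> snowy_box n m"
  shows "Poly_Mapping.lookup (push_std m n d) (std m n \<delta>) = Poly_Mapping.lookup d \<delta>"
proof -
  have eq: "std m n \<beta> = std m n \<delta> \<longleftrightarrow> \<beta> = \<delta>" if "\<beta> \<in> Poly_Mapping.keys d" for \<beta>
    using inj_onD[OF std_inj] assms that by blast
  have "Poly_Mapping.lookup (push_std m n d) (std m n \<delta>) =
      (\<Sum>\<beta>\<in>Poly_Mapping.keys d. if \<beta> = \<delta> then Poly_Mapping.lookup d \<beta> else 0)"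
    unfolding push_std_def lookup_sum by (rule sum.cong) (auto simp: lookup_single when_def eq)
  then show ?thesis by (simp add: in_keys_iff)
qed

lemma keys_push_std: "Poly_Mapping.keys (push_std m n d) \<subseteq> std m n ` Poly_Mapping.keys d"
proof -
  have "Poly_Mapping.keys (push_std m n d) \<subseteq> (\<Union>\<delta>\<in>Poly_Mapping.keys d.
      Poly_Mapping.keys (Poly_Mapping.single (std m n \<delta>) (Poly_Mapping.lookup d \<delta>)))"
    unfolding push_std_def by (rule keys_sum)
  then show ?thesis by (auto split: if_splits)
qed

lemma schubert_expansion_push_std:
  assumes "Poly_Mapping.keys d \<subseteq> snowy_box n m"
  shows "is_schubert_expansion (reflect_poly m n (lin_ext top_lascoux d)) (push_std m n d)"
proof -
  let ?c = "push_std m n d"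
  have inj: "inj_on (std m n) (Poly_Mapping.keys d)" using std_inj assms by (rule inj_on_subset)
  have "reflect_poly m n (lin_ext top_lascoux d)
      = (\<Sum>\<delta>\<in>Poly_Mapping.keys d. scale (Poly_Mapping.lookup d \<delta>) (schubert (std m n \<delta>)))"
    unfolding lin_ext_def reflect_poly_sum_scale using assms
    by (intro sum.cong) (auto simp: reflect_poly_top_lascoux)
  also have "\<dots> = (\<Sum>\<delta>\<in>Poly_Mapping.keys d. scale (Poly_Mapping.lookup ?c (std m n \<delta>)) (schubert (std m n \<delta>)))"
    by (rule sum.cong[OF refl], subst lookup_push_std[OF assms]) (use assms in auto)
  also have "\<dots> = (\<Sum>w\<in>std m n ` Poly_Mapping.keys d. scale (Poly_Mapping.lookup ?c w) (schubert w))"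
    by (simp only: sum.reindex[OF inj] o_def)
  also have "\<dots> = (\<Sum>w\<in>Poly_Mapping.keys ?c. scale (Poly_Mapping.lookup ?c w) (schubert w))"
    by (rule sum_keys_superset[symmetric]) (simp_all add: keys_push_std)
  finally show ?thesis
    unfolding is_schubert_expansion_def using keys_push_std[of m n d] std_props(1) assms by blast
qed

text \<open>Multiplying by \<open>h\<close> and raising the bound by \<open>n\<close> leaves the
  reflection unchanged, since \<open>h\<close> reflects to 1. All monomials of the multiple lie
  above the staircase and have exponents at most \<open>n + m\<close>, so it expands with entries at
  most \<open>n + m\<close>. Uniqueness of Schubert expansions makes each
  \<open>std M n \<delta>\<close> equal to some \<open>std (n + M) n \<beta>\<close> with such a
  \<open>\<beta>\<close>. Its first \<open>n\<close> values are at least \<open>M + 1 - m\<close>,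
  which bounds the entries of \<open>\<delta>\<close> by \<open>m\<close>.\<close>

lemma snowy_box_bound:
  assumes f: "lin_ext top_lascoux d \<in> boxpoly n m" and d: "Poly_Mapping.keys d \<subseteq> snowy_box n M" and "m \<le> M"
  shows "Poly_Mapping.keys d \<subseteq> snowy_box n m"
proof
  let ?f = "lin_ext top_lascoux d"
  define h where "h = xpow (reflect n n 0)"
  have h: "h \<in> boxpoly n n" "reflect_poly n n h = 1"
    by (simp_all add: h_def xpow_in_span reflect_in_cbox reflect_reflect zero_in_cbox)
  have "h * ?f \<in> qp.span (top_lascoux ` snowy_box n (n + m))"
  proof (rule qlinear_in_span[OF qlinear_mult f])
    fix a assume "a \<in> xpow ` cbox n m"
    then obtain e where e: "a = xpow e" "e \<in> cbox n m" by blast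
    have "xpow (reflect n n 0 + e) \<in> qp.span (top_lascoux ` snowy_box n (n + m))"
    proof (rule xpow_in_lascoux_span[OF order_refl])
      show "reflect n n 0 + e \<in> cbox n (n + m)" using e by (intro cbox_add reflect_in_cbox)
      show "n + 1 - i \<le> entry (reflect n n 0 + e) i" if "i \<in> {1..n}" for i
        using that by (auto simp: lookup_add lookup_reflect)
    qed
    then show "h * a \<in> qp.span (top_lascoux ` snowy_box n (n + m))" by (simp add: h_def e xpow_add)
  qed
  then obtain c where c: "Poly_Mapping.keys c \<subseteq> snowy_box n (n + m)" "h * ?f = lin_ext top_lascoux c"
    using in_span_lin_ext by blast
  have "cbox n m \<subseteq> cbox n M" using \<open>m \<le> M\<close> by (intro cbox_mono) auto
  then have "?f \<in> boxpoly n M" using f qp.span_mono[OF image_mono] by blast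
  then have "reflect_poly (n + M) n (lin_ext top_lascoux c) = reflect_poly M n ?f"
    using reflect_poly_mult[OF h(1)] h(2) unfolding c(2)[symmetric] by simp
  moreover have cM: "Poly_Mapping.keys c \<subseteq> snowy_box n (n + M)"
    using c(1) snowy_box_mono[of n n "n + m" "n + M"] \<open>m \<le> M\<close> by auto
  ultimately have eq: "push_std (n + M) n c = push_std M n d"
    using schubert_expansion_push_std[OF cM] schubert_expansion_push_std[OF d] schubert_expansion_unique by metis
  fix \<delta> assume \<delta>: "\<delta> \<in> Poly_Mapping.keys d"
  then have \<delta>M: "\<delta> \<in> snowy_box n M" using d by blast
  have "std M n \<delta> \<in> Poly_Mapping.keys (push_std M n d)"
    using \<delta> lookup_push_std[OF d \<delta>M] by (simp add: in_keys_iff)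
  then obtain \<beta> where \<beta>: "\<beta> \<in> Poly_Mapping.keys c" "std M n \<delta> = std (n + M) n \<beta>"
    using keys_push_std[of "n + M" n c] unfolding eq by blast
  have "entry \<delta> i \<le> m" for i
  proof (cases "entry \<delta> i = 0")
    case False
    then have i: "i \<in> {1..n}" "std M n \<delta> (n + 1 - i) = M + 1 - entry \<delta> i"
      using std_value_small[OF \<delta>M, of i] by auto
    have mem: "n + 1 - i \<in> {1..n}" using i by auto
    have "entry \<beta> (n + 1 - (n + 1 - i)) \<le> n + m"
      using \<beta>(1) c(1) by (auto simp: snowy_box_def cboxD)
    moreover have "std (n + M) n \<beta> (n + 1 - i) = std_value (n + M) n \<beta> (n + 1 - i)"
      using \<beta>(1) cM mem by (intro std_props(3)) auto
    moreover have "1 \<le> n" using i(1) by simp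
    ultimately have "M + 1 - m \<le> std (n + M) n \<beta> (n + 1 - i)"
      unfolding std_value_def by (cases "entry \<beta> (n + 1 - (n + 1 - i)) = 0") (simp_all only: if_True if_False simp_thms, linarith+)
    then have "M + 1 - m \<le> M + 1 - entry \<delta> i" using i(2) \<beta>(2) by simp
    moreover have "entry \<delta> i \<le> M" using \<delta>M by (auto simp: snowy_box_def cboxD)
    ultimately show ?thesis by linarith
  qed simp
  then show "\<delta> \<in> snowy_box n m" using \<delta>M unfolding snowy_box_def cbox_def by blast
qed

lemma top_lascoux_product_expansion:
  assumes "\<alpha> \<in> snowy_box n m1" and "\<gamma> \<in> snowy_box n m2"
  shows "\<exists>d. Poly_Mapping.keys d \<subseteq> snowy_box n (m1 + m2) \<and> top_lascoux \<alpha> * top_lascoux \<gamma> = lin_ext top_lascoux d"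
proof -
  have "top_lascoux \<alpha> \<in> rowspan n" "top_lascoux \<gamma> \<in> rowspan n"
    using top_lascoux_in_rowspan[OF top_lascoux_rel_top_lascoux] snowy_box_weak assms by blast+
  then have "top_lascoux \<alpha> * top_lascoux \<gamma> \<in> qp.span (top_lascoux ` (\<Union>m. snowy_box n m))"
    using rowspan_mult rowspan_subset unfolding lascoux_span_def by blast
  then obtain d where d: "Poly_Mapping.keys d \<subseteq> (\<Union>m. snowy_box n m)"
    "top_lascoux \<alpha> * top_lascoux \<gamma> = lin_ext top_lascoux d"
    using in_span_lin_ext by blast
  \<comment> \<open>The expansion has finitely many terms, so one bound serves them all; it is taken
    at least \<open>m1 + m2\<close> so that it can be lowered to that value.\<close>
  have "\<exists>M\<ge>m1 + m2. Poly_Mapping.keys d \<subseteq> snowy_box n M"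
    using finite_keys[of d] d(1)
  proof (induction rule: finite_induct)
    case (insert \<delta> A)
    then obtain M m where "M \<ge> m1 + m2" "A \<subseteq> snowy_box n M" "\<delta> \<in> snowy_box n m" by blast
    then have "max M m \<ge> m1 + m2 \<and> insert \<delta> A \<subseteq> snowy_box n (max M m)"
      using snowy_box_mono[of n n M "max M m"] snowy_box_mono[of n n m "max M m"] by auto
    then show ?case by blast
  qed auto
  then obtain M where M: "m1 + m2 \<le> M" "Poly_Mapping.keys d \<subseteq> snowy_box n M" by blast
  have "lin_ext top_lascoux d \<in> boxpoly n (m1 + m2)"
    unfolding d(2)[symmetric] using assms by (intro boxpoly_mult top_lascoux_in_boxpoly)
  then show ?thesis using snowy_box_bound M d(2) by blast
qed

theorem theorem4p2:
  fixes \<alpha> \<gamma> \<delta> :: comp and m1 m2 n :: nat and u v w :: "nat \<Rightarrow> nat"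
  assumes "weak_composition \<alpha>" and "snowy \<alpha>"
    and "weak_composition \<gamma>" and "snowy \<gamma>"
    and "m1 \<ge> max_entry \<alpha>" and "m2 \<ge> max_entry \<gamma>"
    and "supp \<alpha> \<subseteq> {1..n}" and "supp \<gamma> \<subseteq> {1..n}"
    and "u = std m1 n \<alpha>" and "v = std m2 n \<gamma>"
    and "weak_composition \<delta>" and "snowy \<delta>"
    and "supp \<delta> \<subseteq> {1..n}" and "max_entry \<delta> \<le> m1 + m2"
    and "w = std (m1 + m2) n \<delta>"
  shows "top_lascoux_coeff \<alpha> \<gamma> \<delta> = schubert_coeff u v w"
proof -
  have \<alpha>: "\<alpha> \<in> snowy_box n m1" and \<gamma>: "\<gamma> \<in> snowy_box n m2" and \<delta>: "\<delta> \<in> snowy_box n (m1 + m2)"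
    using assms by (simp_all add: snowy_box_def cbox_def max_entry_le_iff)
  let ?f = "top_lascoux \<alpha> * top_lascoux \<gamma>"
  obtain d where d: "Poly_Mapping.keys d \<subseteq> snowy_box n (m1 + m2)" "?f = lin_ext top_lascoux d"
    using top_lascoux_product_expansion[OF \<alpha> \<gamma>] by blast
  have "is_top_lascoux_expansion ?f d"
    unfolding is_top_lascoux_expansion_def d(2) lin_ext_def using d(1) snowy_box_weak by blast
  then have "(THE d. is_top_lascoux_expansion ?f d) = d"
    using top_lascoux_expansion_unique by (intro the_equality)
  moreover have "schubert u * schubert v = reflect_poly (m1 + m2) n ?f"
    using \<alpha> \<gamma> by (simp add: assms(9,10) reflect_poly_mult[OF top_lascoux_in_boxpoly top_lascoux_in_boxpoly]
        reflect_poly_top_lascoux)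
  then have "is_schubert_expansion (schubert u * schubert v) (push_std (m1 + m2) n d)"
    using schubert_expansion_push_std[OF d(1)] d(2) by simp
  then have "(THE c. is_schubert_expansion (schubert u * schubert v) c) = push_std (m1 + m2) n d"
    using schubert_expansion_unique by (intro the_equality)
  ultimately show ?thesis
    using lookup_push_std[OF d(1) \<delta>] by (simp add: top_lascoux_coeff_def schubert_coeff_def assms(15))
qed

end
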